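(* Let $\mathcal{C}$ be a self-orthogonal subcategory of $\mathfrak{C}$ such that ${}_{\mathcal{C}}\mathscr{X}$ has a relative injective cogenerator. Then the assignment $\mathcal{D}\mapsto{}^{\bot}\mathcal{D}\cap{}_{\mathcal{C}}\mathscr{X}$ is a one-one correspondence from the class of relative coresolving, strongly covariantly finite subcategories in ${}_{\mathcal{C}}\mathscr{X}$ onto the class of relative resolving, strongly contravariantly finite subcategories in ${}_{\mathcal{C}}\mathscr{X}$. The inverse map is given by $\mathcal{B}\mapsto\mathcal{B}^{\bot}\cap{}_{\mathcal{C}}\mathscr{X}$.
   Context: Standing assumptions: $(\mathfrak{C},\mathbb{E},\mathfrak{s})$ is a Krull-Schmidt extriangulated category (in the sense of Nakaoka-Palu) with enough projectives and enough injectives, satisfying the WIC condition: if $gf$ is an inflation then so is $f$; if $gf$ is a deflation then so is $g$. "Subcategory" means full additive subcategory closed under isomorphisms and direct summands. $\mathbb{E}$-triangles: $A\to B\to C\dashrightarrow$ is an $\mathbb{E}$-triangle if it realizes some element of $\mathbb{E}(C,A)$; then $A\to B$ is an inflation with cone $C$, and $B\to C$ a deflation with cocone $A$. Higher extensions are $\mathbb{E}^{i+1}(X,Y)\cong\mathbb{E}(X,\Sigma^{i}Y)\cong\mathbb{E}(\Omega^{i}X,Y)$ for $i\ge 0$, where $\Omega$, $\Sigma$ denote syzygy and cosyzygy. For a class $\omega$ of objects: $\omega^{\bot}=\{Y\mid \mathbb{E}^{i}(X,Y)=0\ \forall i\ge1,\ \forall X\in\omega\}$, ${}^{\bot}\omega=\{Y\mid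 \mathbb{E}^{i}(Y,X)=0\ \forall i\ge1,\ \forall X\in\omega\}$; $\omega$ is self-orthogonal if $\omega\subseteq\omega^{\bot}$. For $\omega$ self-orthogonal, ${}_{\omega}\mathscr{X}$ is the class of $A$ for which there are $\mathbb{E}$-triangles $K_{i+1}\to W_i\to K_i\dashrightarrow$ ($i\ge 0$, $K_0=A$) with all $W_i\in\omega$ and all $K_i\in\omega^{\bot}$. For subcategories $\mathcal{D}\subseteq\mathcal{Y}$: $\mathcal{D}$ is strongly contravariantly finite in $\mathcal{Y}$ if every $Y\in\mathcal{Y}$ admits an $\mathbb{E}$-triangle $K\to D\xrightarrow{g}Y\dashrightarrow$ with $g$ a right $\mathcal{D}$-approximation ($D\in\mathcal{D}$ and every morphism from an object of $\mathcal{D}$ to $Y$ factors through $g$); strongly covariantly finite in $\mathcal{Y}$ if every $Y\in\mathcal{Y}$ admits an $\mathbb{E}$-triangle $Y\xrightarrow{g}D\to V\dashrightarrow$ with $g$ a left $\mathcal{D}$-approximation ($D\in\mathcal{D}$ and every morphism from $Y$ to an object of $\mathcal{D}$ factors through $g$). $\mathcal{D}$ is relative resolving (resp. relative coresolving) in $\mathcal{Y}$ if it is closed under extensions, direct summands and cocones of deflations (resp. cones of inflations), for $\mathbb{E}$-triangles with terms in $\mathcal{Y}$, and contains all projective (resp. injective) objects of $\mathcal{Y}$. Here $P\in\mathcal{Y}$ is projective (resp. $I\in\mathcal{Y}$ is injective) in $\mathcal{Y}$ if for each $\mathbb{E}$-triangle $A\to B\to C\dashrightarrow$ with terms in $\mathcal{Y}$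 every morphism $P\to C$ factors through $B\to C$ (resp. every morphism $A\to I$ factors through $A\to B$). A relative injective cogenerator of $\mathcal{Y}$ is a subcategory $\mathcal{I}\subseteq\mathcal{Y}\cap\mathcal{Y}^{\bot}$ such that each $Y\in\mathcal{Y}$ admits an $\mathbb{E}$-triangle $Y\to I_Y\to Y'\dashrightarrow$ with $I_Y\in\mathcal{I}$, $Y'\in\mathcal{Y}$. *)

theory Defs
  imports "HOL-Algebra.Ring"
begin

section \<open>Additive categories\<close>

text \<open>
  The abelian groups of morphisms and of extensions are HOL-Algebra commutative groups.  HOL-Algebra
  writes these multiplicatively, so the product of a hom group is the sum of morphisms, and its
  unit is the zero morphism.
\<close>

record ('o, 'm) hom_category =
  Ob :: "'o set"
  Hom :: "'o \<Rightarrow> 'o \<Rightarrow> 'm monoid"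
  Comp :: "'m \<Rightarrow> 'm \<Rightarrow> 'm" (infixl "\<cdot>\<index>" 75)
  Id :: "'o \<Rightarrow> 'm"

definition mor :: "('o, 'm, 'z) hom_category_scheme \<Rightarrow> 'm \<Rightarrow> 'o \<Rightarrow> 'o \<Rightarrow> bool" where
  "mor K f A B \<longleftrightarrow> A \<in> Ob K \<and> B \<in> Ob K \<and> f \<in> carrier (Hom K A B)"

abbreviation zero_mor :: "('o, 'm, 'z) hom_category_scheme \<Rightarrow> 'o \<Rightarrow> 'o \<Rightarrow> 'm" where
  "zero_mor K A B \<equiv> one (Hom K A B)"

abbreviation add_mor ::
  "('o, 'm, 'z) hom_category_scheme \<Rightarrow> 'o \<Rightarrow> 'o \<Rightarrow> 'm \<Rightarrow> 'm \<Rightarrow> 'm" where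
  "add_mor K A B f g \<equiv> f \<otimes>\<^bsub>Hom K A B\<^esub> g"

definition zero_object :: "('o, 'm, 'z) hom_category_scheme \<Rightarrow> 'o \<Rightarrow> bool" where
  "zero_object K Z \<longleftrightarrow> Z \<in> Ob K \<and> Id K Z = zero_mor K Z Z"

definition isomorphism :: "('o, 'm, 'z) hom_category_scheme \<Rightarrow> 'm \<Rightarrow> 'o \<Rightarrow> 'o \<Rightarrow> bool" where
  "isomorphism K f A B \<longleftrightarrow>
     mor K f A B \<and> (\<exists>g. mor K g B A \<and> g \<cdot>\<^bsub>K\<^esub> f = Id K A \<and> f \<cdot>\<^bsub>K\<^esub> g = Id K B)"

text \<open>\<open>S\<close> is the biproduct of \<open>A\<close> and \<open>B\<close> with injections \<open>i\<close>, \<open>j\<close> and projections \<open>p\<close>, \<open>q\<close>.\<close>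

definition biproduct ::
  "('o, 'm, 'z) hom_category_scheme \<Rightarrow> 'o \<Rightarrow> 'o \<Rightarrow> 'o \<Rightarrow> 'm \<Rightarrow> 'm \<Rightarrow> 'm \<Rightarrow> 'm \<Rightarrow> bool" where
  "biproduct K A B S i j p q \<longleftrightarrow>
     mor K i A S \<and> mor K j B S \<and> mor K p S A \<and> mor K q S B \<and>
     p \<cdot>\<^bsub>K\<^esub> i = Id K A \<and> q \<cdot>\<^bsub>K\<^esub> j = Id K B \<and>
     q \<cdot>\<^bsub>K\<^esub> i = zero_mor K A B \<and> p \<cdot>\<^bsub>K\<^esub> j = zero_mor K B A \<and>
     add_mor K S S (i \<cdot>\<^bsub>K\<^esub> p) (j \<cdot>\<^bsub>K\<^esub> q) = Id K S"

text \<open>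
  Hom sets of distinct pairs of objects are disjoint, so that a morphism determines its domain and
  codomain.
\<close>

locale additive_category =
  fixes K :: "('o, 'm, 'z) hom_category_scheme" (structure)
  assumes hom_disjoint:
      "mor K f A B \<Longrightarrow> mor K f A' B' \<Longrightarrow> A = A' \<and> B = B'"
    and hom_comm_group: "A \<in> Ob K \<Longrightarrow> B \<in> Ob K \<Longrightarrow> comm_group (Hom K A B)"
    and id_mor: "A \<in> Ob K \<Longrightarrow> mor K (Id K A) A A"
    and comp_mor: "mor K f A B \<Longrightarrow> mor K g B C \<Longrightarrow> mor K (g \<cdot> f) A C"
    and comp_id_right: "mor K f A B \<Longrightarrow> f \<cdot> Id K A = f"
    and comp_id_left: "mor K f A B \<Longrightarrow> Id K B \<cdot> f = f"
    and comp_assoc: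
      "mor K f A B \<Longrightarrow> mor K g B C \<Longrightarrow> mor K h C D \<Longrightarrow> (h \<cdot> g) \<cdot> f = h \<cdot> (g \<cdot> f)"
    and comp_add_right:
      "mor K f A B \<Longrightarrow> mor K f' A B \<Longrightarrow> mor K g B C \<Longrightarrow>
       g \<cdot> add_mor K A B f f' = add_mor K A C (g \<cdot> f) (g \<cdot> f')"
    and comp_add_left:
      "mor K f A B \<Longrightarrow> mor K g B C \<Longrightarrow> mor K g' B C \<Longrightarrow>
       add_mor K B C g g' \<cdot> f = add_mor K A C (g \<cdot> f) (g' \<cdot> f)"
    and ex_zero_object: "\<exists>Z. zero_object K Z"
    and ex_biproduct:
      "A \<in> Ob K \<Longrightarrow> B \<in> Ob K \<Longrightarrow> \<exists>S i j p q. biproduct K A B S i j p q"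

definition endo_ring :: "('o, 'm, 'z) hom_category_scheme \<Rightarrow> 'o \<Rightarrow> 'm ring" where
  "endo_ring K X =
     \<lparr>carrier = carrier (Hom K X X), mult = Comp K, one = Id K X,
      zero = zero_mor K X X, add = add_mor K X X\<rparr>"

text \<open>Locality of a possibly noncommutative ring: it is nonzero and the nonunits are closed under
  addition.\<close>

definition local_ring :: "('a, 'z) ring_scheme \<Rightarrow> bool" where
  "local_ring R \<longleftrightarrow> ring R \<and> \<one>\<^bsub>R\<^esub> \<noteq> \<zero>\<^bsub>R\<^esub> \<and>
     (\<forall>a \<in> carrier R - Units R. \<forall>b \<in> carrier R - Units R. a \<oplus>\<^bsub>R\<^esub> b \<notin> Units R)"

text \<open>
  Every object is a finite direct sum of objects with local endomorphism rings.  The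
  \<open>finprod\<close> is the sum of the morphisms \<open>i k \<cdot> p k\<close>; for \<open>n = 0\<close> the condition says that
  \<open>X\<close> is a zero object.
\<close>

definition krull_schmidt :: "('o, 'm, 'z) hom_category_scheme \<Rightarrow> bool" where
  "krull_schmidt K \<longleftrightarrow> (\<forall>X \<in> Ob K. \<exists>(n::nat) Y i p.
     (\<forall>k<n. Y k \<in> Ob K \<and> local_ring (endo_ring K (Y k)) \<and>
            mor K (i k) (Y k) X \<and> mor K (p k) X (Y k)) \<and>
     (\<forall>k<n. \<forall>l<n. p l \<cdot>\<^bsub>K\<^esub> i k = (if k = l then Id K (Y k) else zero_mor K (Y k) (Y l))) \<and>
     finprod (Hom K X X) (\<lambda>k. i k \<cdot>\<^bsub>K\<^esub> p k) {..<n} = Id K X)"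

text \<open>Full additive subcategories closed under isomorphisms and direct summands, given by their
  classes of objects.\<close>

definition subcategory :: "('o, 'm, 'z) hom_category_scheme \<Rightarrow> 'o set \<Rightarrow> bool" where
  "subcategory K \<D> \<longleftrightarrow> \<D> \<subseteq> Ob K \<and>
     (\<exists>Z \<in> \<D>. zero_object K Z) \<and>
     (\<forall>A B S i j p q. biproduct K A B S i j p q \<and> A \<in> \<D> \<and> B \<in> \<D> \<longrightarrow> S \<in> \<D>) \<and>
     (\<forall>A B f. isomorphism K f A B \<and> A \<in> \<D> \<longrightarrow> B \<in> \<D>) \<and>
     (\<forall>A B S i j p q. biproduct K A B S i j p q \<and> S \<in> \<D> \<longrightarrow> A \<in> \<D>)"


section \<open>Extriangulated categories\<close>

text \<open>
  \<open>Ext K C A\<close> is the group of extensions of \<open>C\<close> by \<open>A\<close>, contravariant in \<open>C\<close> (via \<open>Pull\<close>) and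
  covariant in \<open>A\<close> (via \<open>Push\<close>).  \<open>Real K \<delta>\<close> is the equivalence class of sequences realizing
  \<open>\<delta>\<close>, as a set of pairs of composable morphisms.
\<close>

record ('o, 'm, 'e) ext_category = "('o, 'm) hom_category" +
  Ext :: "'o \<Rightarrow> 'o \<Rightarrow> 'e monoid"
  Push :: "'m \<Rightarrow> 'e \<Rightarrow> 'e"
  Pull :: "'m \<Rightarrow> 'e \<Rightarrow> 'e"
  Real :: "'e \<Rightarrow> ('m \<times> 'm) set"

definition extension :: "('o, 'm, 'e, 'z) ext_category_scheme \<Rightarrow> 'e \<Rightarrow> 'o \<Rightarrow> 'o \<Rightarrow> bool" where
  "extension K \<delta> C A \<longleftrightarrow> C \<in> Ob K \<and> A \<in> Ob K \<and> \<delta> \<in> carrier (Ext K C A)"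

text \<open>The class of sequences from \<open>A\<close> to \<open>C\<close> equivalent to \<open>A \<rightarrow> B \<rightarrow> C\<close>.\<close>

definition seq_class ::
  "('o, 'm, 'z) hom_category_scheme \<Rightarrow> 'o \<Rightarrow> 'o \<Rightarrow> 'o \<Rightarrow> 'm \<Rightarrow> 'm \<Rightarrow> ('m \<times> 'm) set" where
  "seq_class K A B C x y =
     {(x', y'). \<exists>B' b. mor K x' A B' \<and> mor K y' B' C \<and> isomorphism K b B B' \<and>
                 b \<cdot>\<^bsub>K\<^esub> x = x' \<and> y' \<cdot>\<^bsub>K\<^esub> b = y}"

definition e_triangle ::
  "('o, 'm, 'e, 'z) ext_category_scheme \<Rightarrow> 'o \<Rightarrow> 'o \<Rightarrow> 'o \<Rightarrow> 'm \<Rightarrow> 'm \<Rightarrow> 'e \<Rightarrow> bool" where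
  "e_triangle K A B C x y \<delta> \<longleftrightarrow>
     mor K x A B \<and> mor K y B C \<and> extension K \<delta> C A \<and> (x, y) \<in> Real K \<delta>"

text \<open>The sum of two morphisms or extensions along biproducts of sources and targets.\<close>

definition mor_sum ::
  "('o, 'm, 'z) hom_category_scheme \<Rightarrow> 'o \<Rightarrow> 'o \<Rightarrow> 'm \<Rightarrow> 'm \<Rightarrow> 'm \<Rightarrow> 'm \<Rightarrow> 'm \<Rightarrow> 'm \<Rightarrow> 'm" where
  "mor_sum K S T p q i j f g =
     add_mor K S T (i \<cdot>\<^bsub>K\<^esub> f \<cdot>\<^bsub>K\<^esub> p) (j \<cdot>\<^bsub>K\<^esub> g \<cdot>\<^bsub>K\<^esub> q)"

definition ext_sum ::
  "('o, 'm, 'e, 'z) ext_category_scheme \<Rightarrow>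
     'o \<Rightarrow> 'o \<Rightarrow> 'm \<Rightarrow> 'm \<Rightarrow> 'm \<Rightarrow> 'm \<Rightarrow> 'e \<Rightarrow> 'e \<Rightarrow> 'e" where
  "ext_sum K S T p q i j \<delta> \<delta>' =
     Push K i (Pull K p \<delta>) \<otimes>\<^bsub>Ext K S T\<^esub> Push K j (Pull K q \<delta>')"

text \<open>
  The axioms of Nakaoka and Palu: \<open>Ext\<close> is a biadditive functor (ET1), \<open>Real\<close> is an additive
  realization (ET2), and (ET3), (ET4) hold together with their duals.  As an extension comes with
  its two end objects, extension groups of distinct pairs of objects are disjoint.
\<close>

locale extriangulated_category = additive_category K
  for K :: "('o, 'm, 'e, 'z) ext_category_scheme" (structure) +
  assumes ext_disjoint:
      "extension K \<delta> C A \<Longrightarrow> extension K \<delta> C' A' \<Longrightarrow> C = C' \<and> A = A'"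
    and ext_comm_group: "C \<in> Ob K \<Longrightarrow> A \<in> Ob K \<Longrightarrow> comm_group (Ext K C A)"
    and push_hom:
      "C \<in> Ob K \<Longrightarrow> mor K a A A' \<Longrightarrow> Push K a \<in> hom (Ext K C A) (Ext K C A')"
    and pull_hom:
      "A \<in> Ob K \<Longrightarrow> mor K c C' C \<Longrightarrow> Pull K c \<in> hom (Ext K C A) (Ext K C' A)"
    and push_id: "extension K \<delta> C A \<Longrightarrow> Push K (Id K A) \<delta> = \<delta>"
    and pull_id: "extension K \<delta> C A \<Longrightarrow> Pull K (Id K C) \<delta> = \<delta>"
    and push_comp:
      "extension K \<delta> C A \<Longrightarrow> mor K a A A' \<Longrightarrow> mor K a' A' A'' \<Longrightarrow>
       Push K (a' \<cdot> a) \<delta> = Push K a' (Push K a \<delta>)"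
    and pull_comp:
      "extension K \<delta> C A \<Longrightarrow> mor K c C' C \<Longrightarrow> mor K c' C'' C' \<Longrightarrow>
       Pull K (c \<cdot> c') \<delta> = Pull K c' (Pull K c \<delta>)"
    and push_pull:
      "extension K \<delta> C A \<Longrightarrow> mor K a A A' \<Longrightarrow> mor K c C' C \<Longrightarrow>
       Push K a (Pull K c \<delta>) = Pull K c (Push K a \<delta>)"
    and push_add:
      "extension K \<delta> C A \<Longrightarrow> mor K a A A' \<Longrightarrow> mor K a' A A' \<Longrightarrow>
       Push K (add_mor K A A' a a') \<delta> = Push K a \<delta> \<otimes>\<^bsub>Ext K C A'\<^esub> Push K a' \<delta>"
    and pull_add:
      "extension K \<delta> C A \<Longrightarrow> mor K c C' C \<Longrightarrow> mor K c' C' C \<Longrightarrow>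
       Pull K (add_mor K C' C c c') \<delta> = Pull K c \<delta> \<otimes>\<^bsub>Ext K C' A\<^esub> Pull K c' \<delta>"
    and real_class:
      "extension K \<delta> C A \<Longrightarrow>
       \<exists>B x y. mor K x A B \<and> mor K y B C \<and> Real K \<delta> = seq_class K A B C x y"
    and real_morphism:
      "e_triangle K A B C x y \<delta> \<Longrightarrow> e_triangle K A' B' C' x' y' \<delta>' \<Longrightarrow>
       mor K a A A' \<Longrightarrow> mor K c C C' \<Longrightarrow> Push K a \<delta> = Pull K c \<delta>' \<Longrightarrow>
       \<exists>b. mor K b B B' \<and> b \<cdot> x = x' \<cdot> a \<and> y' \<cdot> b = c \<cdot> y"
    and real_zero:
      "biproduct K A C S i j p q \<Longrightarrow> e_triangle K A S C i q \<one>\<^bsub>Ext K C A\<^esub>"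
    and real_sum:
      "e_triangle K A B C x y \<delta> \<Longrightarrow> e_triangle K A' B' C' x' y' \<delta>' \<Longrightarrow>
       biproduct K A A' SA iA jA pA qA \<Longrightarrow> biproduct K B B' SB iB jB pB qB \<Longrightarrow>
       biproduct K C C' SC iC jC pC qC \<Longrightarrow>
       e_triangle K SA SB SC
         (mor_sum K SA SB pA qA iB jB x x') (mor_sum K SB SC pB qB iC jC y y')
         (ext_sum K SC SA pC qC iA jA \<delta> \<delta>')"
    and ET3:
      "e_triangle K A B C x y \<delta> \<Longrightarrow> e_triangle K A' B' C' x' y' \<delta>' \<Longrightarrow>
       mor K a A A' \<Longrightarrow> mor K b B B' \<Longrightarrow> b \<cdot> x = x' \<cdot> a \<Longrightarrow>
       \<exists>c. mor K c C C' \<and> c \<cdot> y = y' \<cdot> b \<and> Push K a \<delta> = Pull K c \<delta>'"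
    and ET3_op:
      "e_triangle K A B C x y \<delta> \<Longrightarrow> e_triangle K A' B' C' x' y' \<delta>' \<Longrightarrow>
       mor K b B B' \<Longrightarrow> mor K c C C' \<Longrightarrow> c \<cdot> y = y' \<cdot> b \<Longrightarrow>
       \<exists>a. mor K a A A' \<and> b \<cdot> x = x' \<cdot> a \<and> Push K a \<delta> = Pull K c \<delta>'"
    and ET4:
      "e_triangle K A B D f f' \<delta> \<Longrightarrow> e_triangle K B C F g g' \<delta>' \<Longrightarrow>
       \<exists>E h h' d e \<delta>''. e_triangle K A C E h h' \<delta>'' \<and>
         e_triangle K D E F d e (Push K f' \<delta>') \<and>
         h = g \<cdot> f \<and> h' \<cdot> g = d \<cdot> f' \<and> e \<cdot> h' = g' \<and>
         Pull K d \<delta>'' = \<delta> \<and> Push K f \<delta>'' = Pull K e \<delta>'"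
    and ET4_op:
      "e_triangle K D A B f' f \<delta> \<Longrightarrow> e_triangle K F B C g' g \<delta>' \<Longrightarrow>
       \<exists>E h h' d e \<delta>''. e_triangle K E A C h' h \<delta>'' \<and>
         e_triangle K D E F d e (Pull K g' \<delta>) \<and>
         h = g \<cdot> f \<and> f \<cdot> h' = g' \<cdot> e \<and> h' \<cdot> d = f' \<and>
         Push K e \<delta>'' = \<delta>' \<and> Push K d \<delta> = Pull K g \<delta>''"

definition e_triangle_objs ::
  "('o, 'm, 'e, 'z) ext_category_scheme \<Rightarrow> 'o \<Rightarrow> 'o \<Rightarrow> 'o \<Rightarrow> bool" where
  "e_triangle_objs K A B C \<longleftrightarrow> (\<exists>x y \<delta>. e_triangle K A B C x y \<delta>)"

definition inflation :: "('o, 'm, 'e, 'z) ext_category_scheme \<Rightarrow> 'm \<Rightarrow> bool" where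
  "inflation K x \<longleftrightarrow> (\<exists>A B C y \<delta>. e_triangle K A B C x y \<delta>)"

definition deflation :: "('o, 'm, 'e, 'z) ext_category_scheme \<Rightarrow> 'm \<Rightarrow> bool" where
  "deflation K y \<longleftrightarrow> (\<exists>A B C x \<delta>. e_triangle K A B C x y \<delta>)"

definition WIC :: "('o, 'm, 'e, 'z) ext_category_scheme \<Rightarrow> bool" where
  "WIC K \<longleftrightarrow> (\<forall>A B C f g. mor K f A B \<and> mor K g B C \<longrightarrow>
     (inflation K (g \<cdot>\<^bsub>K\<^esub> f) \<longrightarrow> inflation K f) \<and>
     (deflation K (g \<cdot>\<^bsub>K\<^esub> f) \<longrightarrow> deflation K g))"

text \<open>Projective and injective objects relative to a class \<open>\<Y>\<close>; \<open>\<Y> = Ob K\<close> gives the absolute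
  notions.\<close>

definition projective_in :: "('o, 'm, 'e, 'z) ext_category_scheme \<Rightarrow> 'o set \<Rightarrow> 'o \<Rightarrow> bool" where
  "projective_in K \<Y> P \<longleftrightarrow> P \<in> \<Y> \<and>
     (\<forall>A B C x y \<delta> f. A \<in> \<Y> \<and> B \<in> \<Y> \<and> C \<in> \<Y> \<and> e_triangle K A B C x y \<delta> \<and> mor K f P C \<longrightarrow>
        (\<exists>g. mor K g P B \<and> y \<cdot>\<^bsub>K\<^esub> g = f))"

definition injective_in :: "('o, 'm, 'e, 'z) ext_category_scheme \<Rightarrow> 'o set \<Rightarrow> 'o \<Rightarrow> bool" where
  "injective_in K \<Y> I \<longleftrightarrow> I \<in> \<Y> \<and>
     (\<forall>A B C x y \<delta> f. A \<in> \<Y> \<and> B \<in> \<Y> \<and> C \<in> \<Y> \<and> e_triangle K A B C x y \<delta> \<and> mor K f A I \<longrightarrow>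
        (\<exists>g. mor K g B I \<and> g \<cdot>\<^bsub>K\<^esub> x = f))"

definition enough_projectives :: "('o, 'm, 'e, 'z) ext_category_scheme \<Rightarrow> bool" where
  "enough_projectives K \<longleftrightarrow>
     (\<forall>C \<in> Ob K. \<exists>A P. projective_in K (Ob K) P \<and> e_triangle_objs K A P C)"

definition enough_injectives :: "('o, 'm, 'e, 'z) ext_category_scheme \<Rightarrow> bool" where
  "enough_injectives K \<longleftrightarrow>
     (\<forall>A \<in> Ob K. \<exists>I C. injective_in K (Ob K) I \<and> e_triangle_objs K A I C)"


section \<open>Higher extensions and orthogonal classes\<close>

definition syzygy :: "('o, 'm, 'e, 'z) ext_category_scheme \<Rightarrow> 'o \<Rightarrow> 'o" where
  "syzygy K X = (SOME M. \<exists>P. projective_in K (Ob K) P \<and> e_triangle_objs K M P X)"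

text \<open>
  The group of \<open>i\<close>-fold extensions of \<open>X\<close> by \<open>Y\<close>, meaningful for \<open>i \<ge> 1\<close> only.  It is computed
  from the chosen syzygies of \<open>X\<close>; another choice, or cosyzygies of \<open>Y\<close>, gives an isomorphic group.
\<close>

definition higher_ext :: "('o, 'm, 'e, 'z) ext_category_scheme \<Rightarrow> nat \<Rightarrow> 'o \<Rightarrow> 'o \<Rightarrow> 'e monoid" where
  "higher_ext K i X Y = Ext K ((syzygy K ^^ (i - 1)) X) Y"

definition right_perp :: "('o, 'm, 'e, 'z) ext_category_scheme \<Rightarrow> 'o set \<Rightarrow> 'o set" where
  "right_perp K \<omega> =
     {Y \<in> Ob K. \<forall>i\<ge>1. \<forall>X \<in> \<omega>. carrier (higher_ext K i X Y) = {\<one>\<^bsub>higher_ext K i X Y\<^esub>}}"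

definition left_perp :: "('o, 'm, 'e, 'z) ext_category_scheme \<Rightarrow> 'o set \<Rightarrow> 'o set" where
  "left_perp K \<omega> =
     {Y \<in> Ob K. \<forall>i\<ge>1. \<forall>X \<in> \<omega>. carrier (higher_ext K i Y X) = {\<one>\<^bsub>higher_ext K i Y X\<^esub>}}"

definition self_orthogonal :: "('o, 'm, 'e, 'z) ext_category_scheme \<Rightarrow> 'o set \<Rightarrow> bool" where
  "self_orthogonal K \<omega> \<longleftrightarrow> \<omega> \<subseteq> right_perp K \<omega>"

text \<open>The class \<open>\<^sub>\<omega>\<X>\<close>.\<close>

definition resolved_class :: "('o, 'm, 'e, 'z) ext_category_scheme \<Rightarrow> 'o set \<Rightarrow> 'o set" where
  "resolved_class K \<omega> =
     {A. \<exists>L W :: nat \<Rightarrow> 'o. L 0 = A \<and>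
        (\<forall>i. W i \<in> \<omega> \<and> L i \<in> right_perp K \<omega> \<and> e_triangle_objs K (L (Suc i)) (W i) (L i))}"


section \<open>Relative notions\<close>

definition right_approximation ::
  "('o, 'm, 'z) hom_category_scheme \<Rightarrow> 'o set \<Rightarrow> 'm \<Rightarrow> 'o \<Rightarrow> 'o \<Rightarrow> bool" where
  "right_approximation K \<D> g D Y \<longleftrightarrow> D \<in> \<D> \<and> mor K g D Y \<and>
     (\<forall>D' \<in> \<D>. \<forall>f. mor K f D' Y \<longrightarrow> (\<exists>h. mor K h D' D \<and> g \<cdot>\<^bsub>K\<^esub> h = f))"

definition left_approximation ::
  "('o, 'm, 'z) hom_category_scheme \<Rightarrow> 'o set \<Rightarrow> 'm \<Rightarrow> 'o \<Rightarrow> 'o \<Rightarrow> bool" where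
  "left_approximation K \<D> g Y D \<longleftrightarrow> D \<in> \<D> \<and> mor K g Y D \<and>
     (\<forall>D' \<in> \<D>. \<forall>f. mor K f Y D' \<longrightarrow> (\<exists>h. mor K h D D' \<and> h \<cdot>\<^bsub>K\<^esub> g = f))"

definition strongly_contravariantly_finite ::
  "('o, 'm, 'e, 'z) ext_category_scheme \<Rightarrow> 'o set \<Rightarrow> 'o set \<Rightarrow> bool" where
  "strongly_contravariantly_finite K \<D> \<Y> \<longleftrightarrow> subcategory K \<D> \<and> \<D> \<subseteq> \<Y> \<and>
     (\<forall>Y \<in> \<Y>. \<exists>A D x g \<delta>. e_triangle K A D Y x g \<delta> \<and> right_approximation K \<D> g D Y)"

definition strongly_covariantly_finite ::
  "('o, 'm, 'e, 'z) ext_category_scheme \<Rightarrow> 'o set \<Rightarrow> 'o set \<Rightarrow> bool" where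
  "strongly_covariantly_finite K \<D> \<Y> \<longleftrightarrow> subcategory K \<D> \<and> \<D> \<subseteq> \<Y> \<and>
     (\<forall>Y \<in> \<Y>. \<exists>D V g y \<delta>. e_triangle K Y D V g y \<delta> \<and> left_approximation K \<D> g Y D)"

text \<open>Closure under direct summands is part of being a subcategory.\<close>

definition relative_resolving ::
  "('o, 'm, 'e, 'z) ext_category_scheme \<Rightarrow> 'o set \<Rightarrow> 'o set \<Rightarrow> bool" where
  "relative_resolving K \<D> \<Y> \<longleftrightarrow> subcategory K \<D> \<and> \<D> \<subseteq> \<Y> \<and>
     (\<forall>A B C. e_triangle_objs K A B C \<and> A \<in> \<D> \<and> B \<in> \<Y> \<and> C \<in> \<D> \<longrightarrow> B \<in> \<D>) \<and>
     (\<forall>A B C. e_triangle_objs K A B C \<and> A \<in> \<Y> \<and> B \<in> \<D> \<and> C \<in> \<D> \<longrightarrow> A \<in> \<D>) \<and>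
     (\<forall>P. projective_in K \<Y> P \<longrightarrow> P \<in> \<D>)"

definition relative_coresolving ::
  "('o, 'm, 'e, 'z) ext_category_scheme \<Rightarrow> 'o set \<Rightarrow> 'o set \<Rightarrow> bool" where
  "relative_coresolving K \<D> \<Y> \<longleftrightarrow> subcategory K \<D> \<and> \<D> \<subseteq> \<Y> \<and>
     (\<forall>A B C. e_triangle_objs K A B C \<and> A \<in> \<D> \<and> B \<in> \<Y> \<and> C \<in> \<D> \<longrightarrow> B \<in> \<D>) \<and>
     (\<forall>A B C. e_triangle_objs K A B C \<and> A \<in> \<D> \<and> B \<in> \<D> \<and> C \<in> \<Y> \<longrightarrow> C \<in> \<D>) \<and>
     (\<forall>I. injective_in K \<Y> I \<longrightarrow> I \<in> \<D>)"

definition relative_injective_cogenerator ::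
  "('o, 'm, 'e, 'z) ext_category_scheme \<Rightarrow> 'o set \<Rightarrow> 'o set \<Rightarrow> bool" where
  "relative_injective_cogenerator K \<I> \<Y> \<longleftrightarrow> subcategory K \<I> \<and> \<I> \<subseteq> \<Y> \<inter> right_perp K \<Y> \<and>
     (\<forall>Y \<in> \<Y>. \<exists>I \<in> \<I>. \<exists>Y' \<in> \<Y>. e_triangle_objs K Y I Y')"

end

theory Submission
  imports Defs
begin

text \<open>
  Everything needed about \<open>\<X> = \<^sub>\<C>\<X>\<close> is self-dual: it is an extension-closed subcategory in which
  \<open>\<C>\<close> is a projective generator and \<open>\<I>\<close> an injective cogenerator, with all higher extensions
  vanishing.  So it suffices to pass from coresolving to resolving classes; the converse is the
  same statement in the opposite category.

  Let \<open>\<D>\<close> be coresolving and strongly covariantly finite.  As the category is Krull-Schmidt and WIC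
  holds, each \<open>Y\<close> in \<open>\<X>\<close> has an extriangle \<open>Y \<rightarrow> D \<rightarrow> V\<close> with a minimal left \<open>\<D>\<close>-approximation.
  Wakamatsu's lemma gives \<open>\<bbbE>(V, \<D>) = 0\<close>, and dimension shifting along the cogenerator gives
  \<open>V \<in> \<^sup>\<bottom>\<D> \<inter> \<X>\<close>.  If \<open>Y\<close> is right orthogonal to \<open>\<^sup>\<bottom>\<D> \<inter> \<X>\<close>, this extriangle splits and \<open>Y \<in> \<D>\<close>.
  Pushing out an extriangle \<open>Y' \<rightarrow> C \<rightarrow> Y\<close> with \<open>C\<close> in \<open>\<C>\<close> along the approximation of \<open>Y'\<close> gives
  right \<open>(\<^sup>\<bottom>\<D> \<inter> \<X>)\<close>-approximations.
\<close>

section \<open>Additive categories\<close>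

text \<open>Two things stand between the statement and its self-duality.
  \<open>resolved_class\<close> is given by infinite resolutions on one side, so its closure under
  extensions and retracts is proved by coinduction on a single resolution step; afterwards only a
  generator and a cogenerator with symmetric properties remain visible. And
  \<open>higher_ext\<close> is computed from chosen syzygies, whose mirror images are cosyzygies. As
  only the vanishing of extensions is compared, it suffices to shift dimensions in vanishing
  statements.

  Closure under cones is not among the properties of \<X> at hand, so the cone of an approximation
  needs its own argument, which rests on the cogenerator.

  Minimality of an approximation g is used in one-sided form: an endomorphism \<phi> with \<phi> g =
  g has a right inverse. This is obtained by elimination over local endomorphism rings.\<close>

context additive_category
begin

text \<open>In the form \<open>arr\<close>, \<open>src\<close>, \<open>tgt\<close> the typing conditions of the arithmetic laws contain no unknown
  objects, so that conditional rewriting can discharge them.\<close>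

definition arr :: "'m \<Rightarrow> bool" where "arr f \<longleftrightarrow> (\<exists>A B. mor K f A B)"
definition src :: "'m \<Rightarrow> 'o" where "src f = (THE A. \<exists>B. mor K f A B)"
definition tgt :: "'m \<Rightarrow> 'o" where "tgt f = (THE B. \<exists>A. mor K f A B)"
definition neg_mor :: "'o \<Rightarrow> 'o \<Rightarrow> 'm \<Rightarrow> 'm" where "neg_mor A B f = inv\<^bsub>Hom K A B\<^esub> f"

lemma mor_obD: "mor K f A B \<Longrightarrow> A \<in> Ob K \<and> B \<in> Ob K"
  by (simp add: mor_def)

lemma mor_srcD: "mor K f A B \<Longrightarrow> src f = A \<and> tgt f = B"
  unfolding src_def tgt_def by (intro conjI the_equality) (auto dest: hom_disjoint)

lemma mor_iff: "mor K f A B \<longleftrightarrow> arr f \<and> src f = A \<and> tgt f = B \<and> A \<in> Ob K \<and> B \<in> Ob K"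
proof
  assume "mor K f A B"
  then show "arr f \<and> src f = A \<and> tgt f = B \<and> A \<in> Ob K \<and> B \<in> Ob K"
    using mor_srcD mor_obD arr_def by blast
next
  assume "arr f \<and> src f = A \<and> tgt f = B \<and> A \<in> Ob K \<and> B \<in> Ob K"
  then show "mor K f A B" using mor_srcD unfolding arr_def by blast
qed

lemma arr_mor: "arr f \<Longrightarrow> mor K f (src f) (tgt f)"
  by (metis arr_def mor_iff)

lemma arr_mor': "arr f \<Longrightarrow> src f = A \<Longrightarrow> mor K f A (tgt f)"
  using arr_mor by blast

lemma arr_ob: "arr f \<Longrightarrow> src f \<in> Ob K \<and> tgt f \<in> Ob K"
  using arr_mor mor_obD by blast

section \<open>Abelian group laws for morphisms\<close>

lemma mor_zero: "A \<in> Ob K \<Longrightarrow> B \<in> Ob K \<Longrightarrow> mor K (zero_mor K A B) A B"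
  using hom_comm_group[of A B] by (simp add: mor_def comm_group_def group_def monoid.one_closed)

lemma mor_add: "mor K f A B \<Longrightarrow> mor K g A B \<Longrightarrow> mor K (add_mor K A B f g) A B"
  using hom_comm_group[of A B] by (simp add: mor_def comm_group_def group_def monoid.m_closed)

lemma mor_neg: "mor K f A B \<Longrightarrow> mor K (neg_mor A B f) A B"
  using hom_comm_group[of A B] by (simp add: mor_def neg_mor_def comm_group_def group.inv_closed)

lemma add_assoc:
  "mor K f A B \<Longrightarrow> mor K g A B \<Longrightarrow> mor K h A B \<Longrightarrow>
    add_mor K A B (add_mor K A B f g) h = add_mor K A B f (add_mor K A B g h)"
  using hom_comm_group[of A B] by (simp add: mor_def comm_group_def group_def monoid.m_assoc)

lemma add_comm: "mor K f A B \<Longrightarrow> mor K g A B \<Longrightarrow> add_mor K A B f g = add_mor K A B g f"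
  using hom_comm_group[of A B]
  by (simp add: mor_def comm_group_def comm_monoid.m_comm)

lemma add_left_comm:
  "mor K f A B \<Longrightarrow> mor K g A B \<Longrightarrow> mor K h A B \<Longrightarrow>
    add_mor K A B f (add_mor K A B g h) = add_mor K A B g (add_mor K A B f h)"
  by (metis add_assoc add_comm)

lemma add_zero_left: "mor K f A B \<Longrightarrow> add_mor K A B (zero_mor K A B) f = f"
  using hom_comm_group[of A B] by (simp add: mor_def comm_group_def group_def monoid.l_one)

lemma add_zero_right: "mor K f A B \<Longrightarrow> add_mor K A B f (zero_mor K A B) = f"
  using hom_comm_group[of A B] by (simp add: mor_def comm_group_def group_def monoid.r_one)

lemma add_neg: "mor K f A B \<Longrightarrow> add_mor K A B f (neg_mor A B f) = zero_mor K A B"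
  using hom_comm_group[of A B] by (simp add: mor_def neg_mor_def comm_group_def group.r_inv)

lemma add_neg': "mor K f A B \<Longrightarrow> add_mor K A B (neg_mor A B f) f = zero_mor K A B"
  by (metis add_neg add_comm mor_neg)

lemma add_neg_cancel:
  "mor K f A B \<Longrightarrow> mor K g A B \<Longrightarrow> add_mor K A B f (add_mor K A B (neg_mor A B f) g) = g"
  by (metis add_neg add_assoc mor_neg add_zero_left)

lemma add_neg_cancel':
  "mor K f A B \<Longrightarrow> mor K g A B \<Longrightarrow> add_mor K A B (neg_mor A B f) (add_mor K A B f g) = g"
  by (metis add_neg' add_assoc mor_neg add_zero_left)

lemma add_left_cancel:
  "mor K f A B \<Longrightarrow> mor K g A B \<Longrightarrow> mor K h A B \<Longrightarrow>
    add_mor K A B f g = add_mor K A B f h \<Longrightarrow> g = h"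
  by (metis add_neg_cancel')

lemma neg_unique:
  "mor K f A B \<Longrightarrow> mor K g A B \<Longrightarrow> add_mor K A B f g = zero_mor K A B \<Longrightarrow> g = neg_mor A B f"
  by (metis add_neg add_left_cancel mor_neg)

lemma neg_neg: "mor K f A B \<Longrightarrow> neg_mor A B (neg_mor A B f) = f"
  by (metis neg_unique add_neg' mor_neg)

lemma neg_zero: "A \<in> Ob K \<Longrightarrow> B \<in> Ob K \<Longrightarrow> neg_mor A B (zero_mor K A B) = zero_mor K A B"
  by (metis neg_unique add_zero_left mor_zero)

lemma neg_add:
  assumes "mor K f A B" "mor K g A B"
  shows "neg_mor A B (add_mor K A B f g) = add_mor K A B (neg_mor A B f) (neg_mor A B g)"
proof -
  have "add_mor K A B (add_mor K A B f g) (add_mor K A B (neg_mor A B f) (neg_mor A B g)) = zero_mor K A B"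
    using assms by (metis add_assoc add_left_comm add_neg_cancel add_neg mor_neg mor_add)
  then show ?thesis
    using assms by (metis neg_unique mor_add mor_neg)
qed

lemma comp_zero_right:
  assumes "mor K g B C" "A \<in> Ob K" shows "g \<cdot> zero_mor K A B = zero_mor K A C"
proof -
  have B: "B \<in> Ob K" and C: "C \<in> Ob K" using assms mor_obD by auto
  let ?z = "g \<cdot> zero_mor K A B"
  have z: "mor K ?z A C" using comp_mor mor_zero assms B by blast
  have "add_mor K A C ?z ?z = add_mor K A C ?z (zero_mor K A C)"
    by (metis add_zero_right assms B comp_add_right mor_zero z)
  then show ?thesis using z mor_zero assms C add_left_cancel by blast
qed

lemma comp_zero_left:
  assumes "mor K f A B" "C \<in> Ob K" shows "zero_mor K B C \<cdot> f = zero_mor K A C"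
proof -
  have A: "A \<in> Ob K" and B: "B \<in> Ob K" using assms mor_obD by auto
  let ?z = "zero_mor K B C \<cdot> f"
  have z: "mor K ?z A C" using comp_mor mor_zero assms B by blast
  have "add_mor K A C ?z ?z = add_mor K A C ?z (zero_mor K A C)"
    by (metis add_zero_right assms B comp_add_left mor_zero z)
  then show ?thesis using z mor_zero assms A add_left_cancel by blast
qed

lemma comp_neg_right:
  assumes "mor K f A B" "mor K g B C" shows "g \<cdot> neg_mor A B f = neg_mor A C (g \<cdot> f)"
proof (rule neg_unique)
  show "add_mor K A C (g \<cdot> f) (g \<cdot> neg_mor A B f) = zero_mor K A C"
    by (metis add_neg assms comp_add_right comp_zero_right mor_neg mor_obD)
qed (use assms comp_mor mor_neg in blast)+

lemma comp_neg_left: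
  assumes "mor K f A B" "mor K g B C" shows "neg_mor B C g \<cdot> f = neg_mor A C (g \<cdot> f)"
proof (rule neg_unique)
  show "add_mor K A C (g \<cdot> f) (neg_mor B C g \<cdot> f) = zero_mor K A C"
    by (metis add_neg assms comp_add_left comp_zero_left mor_neg mor_obD)
qed (use assms comp_mor mor_neg in blast)+

lemma arrow_simps:
  "arr f \<Longrightarrow> arr g \<Longrightarrow> src g = tgt f \<Longrightarrow> arr (g \<cdot> f)"
  "arr f \<Longrightarrow> arr g \<Longrightarrow> src g = tgt f \<Longrightarrow> src (g \<cdot> f) = src f"
  "arr f \<Longrightarrow> arr g \<Longrightarrow> src g = tgt f \<Longrightarrow> tgt (g \<cdot> f) = tgt g"
  "A \<in> Ob K \<Longrightarrow> arr (Id K A)" "A \<in> Ob K \<Longrightarrow> src (Id K A) = A" "A \<in> Ob K \<Longrightarrow> tgt (Id K A) = A"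
  "A \<in> Ob K \<Longrightarrow> B \<in> Ob K \<Longrightarrow> arr (zero_mor K A B)"
  "A \<in> Ob K \<Longrightarrow> B \<in> Ob K \<Longrightarrow> src (zero_mor K A B) = A"
  "A \<in> Ob K \<Longrightarrow> B \<in> Ob K \<Longrightarrow> tgt (zero_mor K A B) = B"
  "arr f \<Longrightarrow> arr g \<Longrightarrow> src f = A \<Longrightarrow> tgt f = B \<Longrightarrow> src g = A \<Longrightarrow> tgt g = B \<Longrightarrow> arr (add_mor K A B f g)"
  "arr f \<Longrightarrow> arr g \<Longrightarrow> src f = A \<Longrightarrow> tgt f = B \<Longrightarrow> src g = A \<Longrightarrow> tgt g = B \<Longrightarrow> src (add_mor K A B f g) = A"
  "arr f \<Longrightarrow> arr g \<Longrightarrow> src f = A \<Longrightarrow> tgt f = B \<Longrightarrow> src g = A \<Longrightarrow> tgt g = B \<Longrightarrow> tgt (add_mor K A B f g) = B"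
  "arr f \<Longrightarrow> src f = A \<Longrightarrow> tgt f = B \<Longrightarrow> arr (neg_mor A B f)"
  "arr f \<Longrightarrow> src f = A \<Longrightarrow> tgt f = B \<Longrightarrow> src (neg_mor A B f) = A"
  "arr f \<Longrightarrow> src f = A \<Longrightarrow> tgt f = B \<Longrightarrow> tgt (neg_mor A B f) = B"
  using comp_mor[OF arr_mor[of f] arr_mor'[of g]] id_mor[of A] mor_zero[of A B] mor_add[of f A B g] mor_neg[of f A B]
    arr_ob[of f] arr_ob[of g]
  by (auto simp: mor_iff)

lemma comp_simps:
  "arr f \<Longrightarrow> arr g \<Longrightarrow> arr h \<Longrightarrow> src g = tgt f \<Longrightarrow> src h = tgt g \<Longrightarrow> (h \<cdot> g) \<cdot> f = h \<cdot> (g \<cdot> f)"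
  "arr f \<Longrightarrow> src f = A \<Longrightarrow> f \<cdot> Id K A = f"
  "arr f \<Longrightarrow> tgt f = B \<Longrightarrow> Id K B \<cdot> f = f"
  "arr g \<Longrightarrow> src g = B \<Longrightarrow> A \<in> Ob K \<Longrightarrow> g \<cdot> zero_mor K A B = zero_mor K A (tgt g)"
  "arr f \<Longrightarrow> tgt f = B \<Longrightarrow> C \<in> Ob K \<Longrightarrow> zero_mor K B C \<cdot> f = zero_mor K (src f) C"
  using comp_assoc[OF arr_mor[of f] arr_mor'[of g] arr_mor'[of h]] comp_id_right[of f] comp_id_left[of f]
    comp_zero_left[of f] comp_zero_right[of g] arr_ob[of f] arr_ob[of g]
  by (auto simp: mor_iff)

lemma distrib_simps:
  "arr f \<Longrightarrow> arr g \<Longrightarrow> src f = A \<Longrightarrow> tgt f = B \<Longrightarrow> src g = B \<Longrightarrow>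
    g \<cdot> neg_mor A B f = neg_mor A (tgt g) (g \<cdot> f)"
  "arr f \<Longrightarrow> arr g \<Longrightarrow> tgt f = B \<Longrightarrow> src g = B \<Longrightarrow> tgt g = C \<Longrightarrow>
    neg_mor B C g \<cdot> f = neg_mor (src f) C (g \<cdot> f)"
  "arr f \<Longrightarrow> arr f' \<Longrightarrow> arr g \<Longrightarrow> src f = A \<Longrightarrow> tgt f = B \<Longrightarrow> src f' = A \<Longrightarrow> tgt f' = B \<Longrightarrow> src g = B \<Longrightarrow>
    g \<cdot> add_mor K A B f f' = add_mor K A (tgt g) (g \<cdot> f) (g \<cdot> f')"
  "arr f \<Longrightarrow> arr g \<Longrightarrow> arr g' \<Longrightarrow> tgt f = B \<Longrightarrow> src g = B \<Longrightarrow> tgt g = C \<Longrightarrow> src g' = B \<Longrightarrow> tgt g' = C \<Longrightarrow>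
    add_mor K B C g g' \<cdot> f = add_mor K (src f) C (g \<cdot> f) (g' \<cdot> f)"
  using comp_neg_left[OF arr_mor[of f] arr_mor'[of g]] comp_neg_right[OF arr_mor[of f] arr_mor'[of g]]
    comp_add_left[of f "src f" B g C g'] comp_add_right[of f A B f' g "tgt g"]
    arr_ob[of f] arr_ob[of g]
  by (auto simp: mor_iff)

lemma group_simps:
  "arr f \<Longrightarrow> src f = A \<Longrightarrow> tgt f = B \<Longrightarrow> add_mor K A B (zero_mor K A B) f = f"
  "arr f \<Longrightarrow> src f = A \<Longrightarrow> tgt f = B \<Longrightarrow> add_mor K A B f (zero_mor K A B) = f"
  "arr f \<Longrightarrow> src f = A \<Longrightarrow> tgt f = B \<Longrightarrow> add_mor K A B f (neg_mor A B f) = zero_mor K A B"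
  "arr f \<Longrightarrow> src f = A \<Longrightarrow> tgt f = B \<Longrightarrow> add_mor K A B (neg_mor A B f) f = zero_mor K A B"
  "arr f \<Longrightarrow> src f = A \<Longrightarrow> tgt f = B \<Longrightarrow> neg_mor A B (neg_mor A B f) = f"
  "A \<in> Ob K \<Longrightarrow> B \<in> Ob K \<Longrightarrow> neg_mor A B (zero_mor K A B) = zero_mor K A B"
  "arr f \<Longrightarrow> arr g \<Longrightarrow> src f = A \<Longrightarrow> tgt f = B \<Longrightarrow> src g = A \<Longrightarrow> tgt g = B \<Longrightarrow>
    add_mor K A B f (add_mor K A B (neg_mor A B f) g) = g"
  "arr f \<Longrightarrow> arr g \<Longrightarrow> src f = A \<Longrightarrow> tgt f = B \<Longrightarrow> src g = A \<Longrightarrow> tgt g = B \<Longrightarrow>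
    add_mor K A B (neg_mor A B f) (add_mor K A B f g) = g"
  "arr f \<Longrightarrow> arr g \<Longrightarrow> src f = A \<Longrightarrow> tgt f = B \<Longrightarrow> src g = A \<Longrightarrow> tgt g = B \<Longrightarrow>
    neg_mor A B (add_mor K A B f g) = add_mor K A B (neg_mor A B f) (neg_mor A B g)"
  using add_zero_left[of f A B] add_zero_right[of f A B] add_neg[of f A B] add_neg'[of f A B] neg_neg[of f A B]
    neg_zero[of A B] add_neg_cancel[of f A B g] add_neg_cancel'[of f A B g] neg_add[of f A B g]
    arr_ob[of f]
  by (auto simp: mor_iff)

lemma add_ac_simps:
  "arr f \<Longrightarrow> arr g \<Longrightarrow> src f = A \<Longrightarrow> tgt f = B \<Longrightarrow> src g = A \<Longrightarrow> tgt g = B \<Longrightarrow>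
    add_mor K A B f g = add_mor K A B g f"
  "arr f \<Longrightarrow> arr g \<Longrightarrow> arr h \<Longrightarrow> src f = A \<Longrightarrow> tgt f = B \<Longrightarrow> src g = A \<Longrightarrow> tgt g = B \<Longrightarrow> src h = A \<Longrightarrow> tgt h = B \<Longrightarrow>
    add_mor K A B (add_mor K A B f g) h = add_mor K A B f (add_mor K A B g h)"
  "arr f \<Longrightarrow> arr g \<Longrightarrow> arr h \<Longrightarrow> src f = A \<Longrightarrow> tgt f = B \<Longrightarrow> src g = A \<Longrightarrow> tgt g = B \<Longrightarrow> src h = A \<Longrightarrow> tgt h = B \<Longrightarrow>
    add_mor K A B f (add_mor K A B g h) = add_mor K A B g (add_mor K A B f h)"
  using add_comm[of f A B g] add_assoc[of f A B g h] add_left_comm[of f A B g h] arr_ob[of f]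
  by (auto simp: mor_iff)

text \<open>Ordered rewriting by \<open>add_ac_simps\<close> can leave one term between a summand
  and its negative; these rules cancel across that gap.\<close>

lemma cancel_simps:
  assumes "arr f" "arr g" "src f = A" "tgt f = B" "src g = A" "tgt g = B"
  shows "add_mor K A B f (add_mor K A B g (neg_mor A B f)) = g"
    "add_mor K A B (neg_mor A B f) (add_mor K A B g f) = g"
    "arr h \<Longrightarrow> src h = A \<Longrightarrow> tgt h = B \<Longrightarrow>
      add_mor K A B f (add_mor K A B g (add_mor K A B (neg_mor A B f) h)) = add_mor K A B g h"
    "arr h \<Longrightarrow> src h = A \<Longrightarrow> tgt h = B \<Longrightarrow>
      add_mor K A B (neg_mor A B f) (add_mor K A B g (add_mor K A B f h)) = add_mor K A B g h"
proof -
  have m: "mor K f A B" "mor K g A B" "mor K (neg_mor A B f) A B"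
    using assms arr_mor[of f] arr_mor[of g] mor_neg[of f A B] by simp_all
  show "add_mor K A B f (add_mor K A B g (neg_mor A B f)) = g"
    using m add_left_comm add_neg add_zero_right by metis
  show "add_mor K A B (neg_mor A B f) (add_mor K A B g f) = g"
    using m add_left_comm add_neg' add_zero_right by metis
  assume "arr h" "src h = A" "tgt h = B"
  then have h: "mor K h A B" using arr_mor[of h] by simp
  show "add_mor K A B f (add_mor K A B g (add_mor K A B (neg_mor A B f) h)) = add_mor K A B g h"
    using m h add_left_comm[of f A B g] mor_add add_neg_cancel by simp
  show "add_mor K A B (neg_mor A B f) (add_mor K A B g (add_mor K A B f h)) = add_mor K A B g h"
    using m h add_left_comm[of "neg_mor A B f" A B g] mor_add add_neg_cancel' by simp
qed

lemmas cat_simps = mor_iff arrow_simps comp_simps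
lemmas add_simps = cat_simps distrib_simps group_simps cancel_simps add_ac_simps

text \<open>\<open>comp_simps\<close> associates composites to the right, where a known value of g f
  is no longer a subterm; this form still matches there.\<close>

lemma comp_reduce:
  "g \<cdot> f = h \<Longrightarrow> arr k \<Longrightarrow> arr f \<Longrightarrow> arr g \<Longrightarrow> src g = tgt f \<Longrightarrow> src f = tgt k \<Longrightarrow> g \<cdot> (f \<cdot> k) = h \<cdot> k"
  using comp_simps(1)[of k f g] by simp

section \<open>Isomorphisms, biproducts and zero objects\<close>

lemma isomorphismI:
  "mor K f A B \<Longrightarrow> mor K g B A \<Longrightarrow> g \<cdot> f = Id K A \<Longrightarrow> f \<cdot> g = Id K B \<Longrightarrow> isomorphism K f A B"
  by (auto simp: isomorphism_def)

lemma isomorphismE: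
  assumes "isomorphism K f A B"
  obtains g where "mor K f A B" "mor K g B A" "g \<cdot> f = Id K A" "f \<cdot> g = Id K B" "isomorphism K g B A"
  using assms unfolding isomorphism_def by blast

lemma biproductD:
  assumes "biproduct K A B S i j p q"
  shows "mor K i A S" "mor K j B S" "mor K p S A" "mor K q S B" "p \<cdot> i = Id K A" "q \<cdot> j = Id K B"
    "q \<cdot> i = zero_mor K A B" "p \<cdot> j = zero_mor K B A" "add_mor K S S (i \<cdot> p) (j \<cdot> q) = Id K S"
  using assms unfolding biproduct_def by auto

lemma biproduct_swap: "biproduct K A B S i j p q \<Longrightarrow> biproduct K B A S j i q p"
  unfolding biproduct_def by (metis add_comm comp_mor)

text \<open>The projections of a biproduct are jointly monic, so an endomorphism can be recognised
  as the identity one component at a time.\<close>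

lemma biproduct_id_criterion:
  assumes b: "biproduct K A B S i j p q" and u: "mor K u S S" "p \<cdot> u = p" "q \<cdot> u = q"
  shows "u = Id K S"
proof -
  note bm = biproductD[OF b]
  have "u = add_mor K S S (i \<cdot> p) (j \<cdot> q) \<cdot> u" using bm u comp_id_left by simp
  also have "\<dots> = add_mor K S S (i \<cdot> (p \<cdot> u)) (j \<cdot> (q \<cdot> u))"
    using bm(1-4) u(1) by (simp add: cat_simps distrib_simps)
  finally show ?thesis using u bm by simp
qed

lemma biproduct_iso:
  assumes b: "biproduct K A B S i j p q" and f: "mor K f S T" "mor K g T S" "g \<cdot> f = Id K S" "f \<cdot> g = Id K T"
  shows "biproduct K A B T (f \<cdot> i) (f \<cdot> j) (p \<cdot> g) (q \<cdot> g)"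
proof -
  note m = biproductD(1-4)[OF b]
  have ob: "A \<in> Ob K" "B \<in> Ob K" "S \<in> Ob K" "T \<in> Ob K" using m f mor_obD by blast+
  have gf: "g \<cdot> (f \<cdot> k) = k" if "mor K k X S" for k X
    using comp_assoc[OF that f(1,2)] comp_id_left[OF that] f(3) by simp
  have "add_mor K T T (f \<cdot> (i \<cdot> (p \<cdot> g))) (f \<cdot> (j \<cdot> (q \<cdot> g))) = f \<cdot> (add_mor K S S (i \<cdot> p) (j \<cdot> q) \<cdot> g)"
    using m f(1,2) by (simp add: cat_simps distrib_simps)
  also have "\<dots> = Id K T" using f by (simp add: biproductD(9)[OF b] cat_simps)
  finally show ?thesis
    unfolding biproduct_def using m f(1,2) ob gf[OF m(1)] gf[OF m(2)] biproductD(5-8)[OF b]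
    by (simp add: cat_simps)
qed

text \<open>The new second injection is j - i r j, the part of j that r kills. Since q i = 0, the
  projection q needs no change.\<close>

lemma biproduct_twist:
  assumes b: "biproduct K A B S i j p q" and r: "mor K r S A" "r \<cdot> i = Id K A"
  shows "\<exists>j'. biproduct K A B S i j' r q"
proof -
  note m = biproductD(1-4)[OF b]
  have ob: "A \<in> Ob K" "B \<in> Ob K" "S \<in> Ob K" using m mor_obD by blast+
  let ?j = "add_mor K B S j (neg_mor B S (i \<cdot> (r \<cdot> j)))"
  have ri: "r \<cdot> (i \<cdot> k) = k" if "mor K k X A" for k X
    using comp_assoc[OF that m(1) r(1)] comp_id_left[OF that] r(2) by simp
  have qi: "q \<cdot> (i \<cdot> k) = zero_mor K X B" if "mor K k X A" for k X
    using comp_assoc[OF that m(1) m(4)] comp_zero_left[OF that ob(2)] biproductD(7)[OF b] by simp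
  have jq: "j \<cdot> q = add_mor K S S (Id K S) (neg_mor S S (i \<cdot> p))"
    unfolding biproductD(9)[OF b, symmetric] using m ob by (simp add: add_simps)
  have "i \<cdot> (r \<cdot> (j \<cdot> q)) = add_mor K S S (i \<cdot> r) (neg_mor S S (i \<cdot> p))"
    unfolding jq using m r(1) ob ri[OF m(3)] by (simp add: add_simps)
  then have "add_mor K S S (i \<cdot> r) (?j \<cdot> q) = Id K S"
    using m r(1) ob biproductD(9)[OF b] by (simp add: add_simps)
  moreover have "mor K (r \<cdot> j) B A" using m r comp_mor by blast
  ultimately have "biproduct K A B S i ?j r q"
    unfolding biproduct_def using m r ob biproductD(6,7)[OF b] ri[of "r \<cdot> j"] qi[of "r \<cdot> j"]
    by (simp add: add_simps)
  then show ?thesis by blast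
qed

lemma zero_object_mor:
  assumes "zero_object K Z"
  shows "mor K f Z A \<Longrightarrow> f = zero_mor K Z A" "mor K f A Z \<Longrightarrow> f = zero_mor K A Z"
  using assms unfolding zero_object_def
  by (metis comp_id_right comp_zero_right mor_obD, metis comp_id_left comp_zero_left mor_obD)

lemma biproduct_zero:
  assumes "zero_object K Z" "A \<in> Ob K"
  shows "biproduct K A Z A (Id K A) (zero_mor K Z A) (Id K A) (zero_mor K A Z)"
  using assms unfolding biproduct_def zero_object_def by (auto simp: add_simps)

lemma zero_objects_isomorphic:
  assumes "zero_object K Z" "zero_object K Z'"
  shows "isomorphism K (zero_mor K Z Z') Z Z'"
  using assms unfolding zero_object_def
  by (intro isomorphismI[where g="zero_mor K Z' Z"]) (auto simp: cat_simps)

end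

section \<open>The opposite category\<close>

text \<open>Results of the locales below are dualized by instantiating them at this record;
  \<open>opposite_simps\<close> and \<open>opposite_notions\<close> then translate the instance back
  to \<open>K\<close>.\<close>

definition opposite :: "('o, 'm, 'e, 'z) ext_category_scheme \<Rightarrow> ('o, 'm, 'e) ext_category" where
  "opposite K =
     \<lparr>Ob = Ob K, Hom = (\<lambda>A B. Hom K B A), Comp = (\<lambda>g f. Comp K f g), Id = Id K,
      Ext = (\<lambda>C A. Ext K A C), Push = Pull K, Pull = Push K, Real = (\<lambda>\<delta>. prod.swap ` Real K \<delta>)\<rparr>"

lemma opposite_simps [simp]:
  "Ob (opposite K) = Ob K" "Hom (opposite K) A B = Hom K B A" "Comp (opposite K) g f = Comp K f g"
  "Id (opposite K) = Id K" "Ext (opposite K) C A = Ext K A C" "Push (opposite K) = Pull K"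
  "Pull (opposite K) = Push K" "Real (opposite K) \<delta> = prod.swap ` Real K \<delta>"
  by (auto simp: opposite_def)

lemma opposite_notions [simp]:
  "mor (opposite K) f A B \<longleftrightarrow> mor K f B A"
  "zero_object (opposite K) A \<longleftrightarrow> zero_object K A"
  "isomorphism (opposite K) f A B \<longleftrightarrow> isomorphism K f B A"
  "biproduct (opposite K) A B S i j p q \<longleftrightarrow> biproduct K A B S p q i j"
  "extension (opposite K) \<delta> C A \<longleftrightarrow> extension K \<delta> A C"
  "e_triangle (opposite K) A B C x y \<delta> \<longleftrightarrow> e_triangle K C B A y x \<delta>"
  "e_triangle_objs (opposite K) A B C \<longleftrightarrow> e_triangle_objs K C B A"
  "inflation (opposite K) f \<longleftrightarrow> deflation K f"
  "deflation (opposite K) f \<longleftrightarrow> inflation K f"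
proof -
  show mor: "mor (opposite K) f A B \<longleftrightarrow> mor K f B A" for f A B by (auto simp: mor_def)
  show "zero_object (opposite K) A \<longleftrightarrow> zero_object K A" by (auto simp: zero_object_def)
  show "isomorphism (opposite K) f A B \<longleftrightarrow> isomorphism K f B A" by (auto simp: isomorphism_def mor)
  show "biproduct (opposite K) A B S i j p q \<longleftrightarrow> biproduct K A B S p q i j"
    by (auto simp: biproduct_def mor)
  show ext: "extension (opposite K) \<delta> C A \<longleftrightarrow> extension K \<delta> A C" for \<delta> C A by (auto simp: extension_def)
  show tri: "e_triangle (opposite K) A B C x y \<delta> \<longleftrightarrow> e_triangle K C B A y x \<delta>" for A B C x y \<delta>
    by (auto simp: e_triangle_def mor ext pair_in_swap_image)
  show "e_triangle_objs (opposite K) A B C \<longleftrightarrow> e_triangle_objs K C B A"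
    by (auto simp: e_triangle_objs_def tri)
  show "inflation (opposite K) f \<longleftrightarrow> deflation K f" "deflation (opposite K) f \<longleftrightarrow> inflation K f"
    unfolding inflation_def deflation_def tri by blast+
qed

text \<open>The isomorphism of middle terms that witnesses equivalence changes direction in the
  opposite category; its inverse restores the direction.\<close>

lemma (in extriangulated_category) seq_class_opposite:
  assumes "mor K x A B" "mor K y B C"
  shows "seq_class (opposite K) C B A y x = prod.swap ` seq_class K A B C x y"
proof -
  have *: "(\<exists>b. isomorphism K b B' B \<and> y \<cdot> b = y' \<and> b \<cdot> x' = x) \<longleftrightarrow>
      (\<exists>b. isomorphism K b B B' \<and> b \<cdot> x = x' \<and> y' \<cdot> b = y)" (is "?L \<longleftrightarrow> ?R")
    if "mor K x' A B'" "mor K y' B' C" for x' y' B'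
  proof
    assume ?L
    then obtain b c where bc: "mor K b B' B" "mor K c B B'" "c \<cdot> b = Id K B'" "b \<cdot> c = Id K B"
      "isomorphism K c B B'" "y \<cdot> b = y'" "b \<cdot> x' = x"
      by (metis isomorphismE)
    have "c \<cdot> x = x'" using comp_assoc[OF that(1) bc(1,2)] bc comp_id_left[OF that(1)] by simp
    moreover have "y' \<cdot> c = y" using comp_assoc[OF bc(2,1) assms(2)] bc comp_id_right[OF assms(2)] by simp
    ultimately show ?R using bc by blast
  next
    assume ?R
    then obtain b c where bc: "mor K b B B'" "mor K c B' B" "c \<cdot> b = Id K B" "b \<cdot> c = Id K B'"
      "isomorphism K c B' B" "b \<cdot> x = x'" "y' \<cdot> b = y"
      by (metis isomorphismE)
    have "c \<cdot> x' = x" using comp_assoc[OF assms(1) bc(1,2)] bc comp_id_left[OF assms(1)] by simp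
    moreover have "y \<cdot> c = y'" using comp_assoc[OF bc(2,1) that(2)] bc comp_id_right[OF that(2)] by simp
    ultimately show ?L using bc by blast
  qed
  show ?thesis
    unfolding seq_class_def using * by (fastforce simp: image_iff)
qed

lemma additive_category_opposite:
  assumes "additive_category K" shows "additive_category (opposite K)"
proof -
  interpret additive_category K by fact
  show ?thesis
  proof (rule additive_category.intro)
    show "mor (opposite K) f A B \<Longrightarrow> mor (opposite K) f A' B' \<Longrightarrow> A = A' \<and> B = B'" for f A B A' B'
      using hom_disjoint by auto
    show "\<exists>Z. zero_object (opposite K) Z" using ex_zero_object by simp
    show "\<exists>S i j p q. biproduct (opposite K) A B S i j p q"
      if "A \<in> Ob (opposite K)" "B \<in> Ob (opposite K)" for A B
      using ex_biproduct[of A B] that by (simp del: ex_simps) blast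
  qed (auto simp: hom_comm_group id_mor comp_id_right comp_id_left comp_assoc comp_add_right comp_add_left
      intro: comp_mor)
qed

context extriangulated_category
begin

lemma mor_sum_opposite:
  assumes "mor K f A B" "mor K g A' B'" "mor K p S A" "mor K q S A'" "mor K i B T" "mor K j B' T"
  shows "mor_sum (opposite K) T S i j p q f g = mor_sum K S T p q i j f g"
  using comp_assoc[OF assms(3,1,5)] comp_assoc[OF assms(4,2,6)] by (simp add: mor_sum_def)

lemma opposite: "extriangulated_category (opposite K)"
proof -
  interpret op: additive_category "opposite K" by (rule additive_category_opposite) unfold_locales
  show ?thesis
  proof (rule extriangulated_category.intro[OF op.additive_category_axioms], rule extriangulated_category_axioms.intro)
    show "extension (opposite K) \<delta> C A \<Longrightarrow> extension (opposite K) \<delta> C' A' \<Longrightarrow> C = C' \<and> A = A'" for \<delta> C A C' A'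
      using ext_disjoint by auto
    show "\<exists>B x y. mor (opposite K) x A B \<and> mor (opposite K) y B C \<and>
        Real (opposite K) \<delta> = seq_class (opposite K) A B C x y" if "extension (opposite K) \<delta> C A" for \<delta> C A
    proof -
      obtain B x y where "mor K x C B" "mor K y B A" "Real K \<delta> = seq_class K C B A x y"
        using real_class[of \<delta> A C] \<open>extension (opposite K) \<delta> C A\<close> by auto
      then show ?thesis using seq_class_opposite by (metis opposite_notions(1) opposite_simps(8))
    qed
    show "\<exists>b. mor (opposite K) b B B' \<and> Comp (opposite K) b x = Comp (opposite K) x' a \<and>
        Comp (opposite K) y' b = Comp (opposite K) c y"
      if "e_triangle (opposite K) A B C x y \<delta>" "e_triangle (opposite K) A' B' C' x' y' \<delta>'"
        "mor (opposite K) a A A'" "mor (opposite K) c C C'"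
        "Push (opposite K) a \<delta> = Pull (opposite K) c \<delta>'" for A B C x y \<delta> A' B' C' x' y' \<delta>' a c
      using real_morphism[of C' B' A' y' x' \<delta>' C B A y x \<delta> c a] that by fastforce
    show "e_triangle (opposite K) A S C i q \<one>\<^bsub>Ext (opposite K) C A\<^esub>"
      if "biproduct (opposite K) A C S i j p q" for A C S i j p q
      using real_zero[OF biproduct_swap[of A C S p q i j]] that by simp
    show "e_triangle (opposite K) SA SB SC
         (mor_sum (opposite K) SA SB pA qA iB jB x x') (mor_sum (opposite K) SB SC pB qB iC jC y y')
         (ext_sum (opposite K) SC SA pC qC iA jA \<delta> \<delta>')"
      if h: "e_triangle (opposite K) A B C x y \<delta>" "e_triangle (opposite K) A' B' C' x' y' \<delta>'"
       "biproduct (opposite K) A A' SA iA jA pA qA" "biproduct (opposite K) B B' SB iB jB pB qB"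
       "biproduct (opposite K) C C' SC iC jC pC qC"
     for A B C x y \<delta> A' B' C' x' y' \<delta>' SA iA jA pA qA SB iB jB pB qB SC iC jC pC qC
    proof -
      have t: "e_triangle K C B A y x \<delta>" "e_triangle K C' B' A' y' x' \<delta>'" using h by auto
      have b: "biproduct K A A' SA pA qA iA jA" "biproduct K B B' SB pB qB iB jB" "biproduct K C C' SC pC qC iC jC"
        using h by auto
      have m: "mor K x B A" "mor K x' B' A'" "mor K y C B" "mor K y' C' B'" "extension K \<delta> A C" "extension K \<delta>' A' C'"
        using t by (auto simp: e_triangle_def)
      note bm = biproductD(1-4)[OF b(1)] biproductD(1-4)[OF b(2)] biproductD(1-4)[OF b(3)]
      \<comment> \<open>\<open>ext_sum\<close> pulls back before it pushes out, and its dual does so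
        in the other order; the two operations commute.\<close>
      have "ext_sum (opposite K) SC SA pC qC iA jA \<delta> \<delta>' = ext_sum K SA SC iA jA pC qC \<delta> \<delta>'"
        unfolding ext_sum_def using push_pull[OF m(5) bm(9,3)] push_pull[OF m(6) bm(10,4)] by simp
      then show ?thesis
        using real_sum[OF t b(3,2,1)] mor_sum_opposite[OF m(1,2) bm(7,8,1,2)] mor_sum_opposite[OF m(3,4) bm(11,12,5,6)]
        by simp
    qed
    show "\<exists>c. mor (opposite K) c C C' \<and> Comp (opposite K) c y = Comp (opposite K) y' b \<and>
        Push (opposite K) a \<delta> = Pull (opposite K) c \<delta>'"
      if "e_triangle (opposite K) A B C x y \<delta>" "e_triangle (opposite K) A' B' C' x' y' \<delta>'"
        "mor (opposite K) a A A'" "mor (opposite K) b B B'"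
        "Comp (opposite K) b x = Comp (opposite K) x' a" for A B C x y \<delta> A' B' C' x' y' \<delta>' a b
      using ET3_op[of C' B' A' y' x' \<delta>' C B A y x \<delta> b a] that by fastforce
    show "\<exists>a. mor (opposite K) a A A' \<and> Comp (opposite K) b x = Comp (opposite K) x' a \<and>
        Push (opposite K) a \<delta> = Pull (opposite K) c \<delta>'"
      if "e_triangle (opposite K) A B C x y \<delta>" "e_triangle (opposite K) A' B' C' x' y' \<delta>'"
        "mor (opposite K) b B B'" "mor (opposite K) c C C'"
        "Comp (opposite K) c y = Comp (opposite K) y' b" for A B C x y \<delta> A' B' C' x' y' \<delta>' b c
      using ET3[of C' B' A' y' x' \<delta>' C B A y x \<delta> c b] that by fastforce
    show "\<exists>E h h' d e \<delta>''. e_triangle (opposite K) A C E h h' \<delta>'' \<and>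
         e_triangle (opposite K) D E F d e (Push (opposite K) f' \<delta>') \<and>
         h = Comp (opposite K) g f \<and> Comp (opposite K) h' g = Comp (opposite K) d f' \<and>
         Comp (opposite K) e h' = g' \<and>
         Pull (opposite K) d \<delta>'' = \<delta> \<and> Push (opposite K) f \<delta>'' = Pull (opposite K) e \<delta>'"
      if t: "e_triangle (opposite K) A B D f f' \<delta>" "e_triangle (opposite K) B C F g g' \<delta>'"
      for A B D f f' \<delta> C F g g' \<delta>'
    proof -
      obtain E h h' d e \<delta>'' where "e_triangle K E C A h' h \<delta>''" "e_triangle K F E D d e (Pull K f' \<delta>')"
        "h = f \<cdot> g" "g \<cdot> h' = f' \<cdot> e" "h' \<cdot> d = g'" "Push K e \<delta>'' = \<delta>" "Push K d \<delta>' = Pull K f \<delta>''"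
        using ET4_op[of F C B g' g \<delta>' D A f' f \<delta>] t by auto
      then show ?thesis
        by (intro exI[of _ E] exI[of _ h] exI[of _ h'] exI[of _ e] exI[of _ d] exI[of _ \<delta>'']) auto
    qed
    show "\<exists>E h h' d e \<delta>''. e_triangle (opposite K) E A C h' h \<delta>'' \<and>
         e_triangle (opposite K) D E F d e (Pull (opposite K) g' \<delta>) \<and>
         h = Comp (opposite K) g f \<and> Comp (opposite K) f h' = Comp (opposite K) g' e \<and>
         Comp (opposite K) h' d = f' \<and>
         Push (opposite K) e \<delta>'' = \<delta>' \<and> Push (opposite K) d \<delta> = Pull (opposite K) g \<delta>''"
      if t: "e_triangle (opposite K) D A B f' f \<delta>" "e_triangle (opposite K) F B C g' g \<delta>'"
      for A B D f f' \<delta> C F g g' \<delta>'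
    proof -
      obtain E h h' d e \<delta>'' where "e_triangle K C A E h h' \<delta>''" "e_triangle K F E D d e (Push K g' \<delta>)"
        "h = f \<cdot> g" "h' \<cdot> f = d \<cdot> g'" "e \<cdot> h' = f'" "Pull K d \<delta>'' = \<delta>'" "Push K g \<delta>'' = Pull K e \<delta>"
        using ET4[of C B F g g' \<delta>' A D f f' \<delta>] t by auto
      then show ?thesis
        by (intro exI[of _ E] exI[of _ h] exI[of _ h'] exI[of _ e] exI[of _ d] exI[of _ \<delta>'']) auto
    qed
  qed (auto simp: ext_comm_group push_hom pull_hom push_id pull_id push_comp pull_comp push_pull push_add pull_add)
qed

end

section \<open>Exact sequences of an extriangle\<close>

context extriangulated_category
begin

lemma e_triangleD:
  assumes "e_triangle K A B C x y \<delta>"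
  shows "mor K x A B" "mor K y B C" "extension K \<delta> C A" "A \<in> Ob K" "B \<in> Ob K" "C \<in> Ob K"
  using assms by (auto simp: e_triangle_def mor_iff)

lemma extension_obD: "extension K \<delta> C A \<Longrightarrow> C \<in> Ob K \<and> A \<in> Ob K"
  by (simp add: extension_def)

lemma extension_zero: "C \<in> Ob K \<Longrightarrow> A \<in> Ob K \<Longrightarrow> extension K \<one>\<^bsub>Ext K C A\<^esub> C A"
  using ext_comm_group[of C A] by (simp add: extension_def comm_group_def group_def monoid.one_closed)

lemma extension_add:
  "extension K \<delta> C A \<Longrightarrow> extension K \<epsilon> C A \<Longrightarrow> extension K (\<delta> \<otimes>\<^bsub>Ext K C A\<^esub> \<epsilon>) C A"
  using ext_comm_group[of C A] by (simp add: extension_def comm_group_def group_def monoid.m_closed)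

lemma extension_add_zero:
  assumes "extension K \<delta> C A"
  shows "\<delta> \<otimes>\<^bsub>Ext K C A\<^esub> \<one>\<^bsub>Ext K C A\<^esub> = \<delta>" "\<one>\<^bsub>Ext K C A\<^esub> \<otimes>\<^bsub>Ext K C A\<^esub> \<delta> = \<delta>"
  using ext_comm_group[of C A] assms
  by (simp_all add: extension_def comm_group_def group_def monoid.r_one monoid.l_one)

lemma extension_push: "extension K \<delta> C A \<Longrightarrow> mor K a A A' \<Longrightarrow> extension K (Push K a \<delta>) C A'"
  using push_hom[of C a A A'] by (auto simp: extension_def mor_def hom_def)

lemma extension_pull: "extension K \<delta> C A \<Longrightarrow> mor K c C' C \<Longrightarrow> extension K (Pull K c \<delta>) C' A"
  using pull_hom[of A c C' C] by (auto simp: extension_def mor_def hom_def)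

lemma push_sum:
  "extension K \<delta> C A \<Longrightarrow> extension K \<epsilon> C A \<Longrightarrow> mor K a A A' \<Longrightarrow>
    Push K a (\<delta> \<otimes>\<^bsub>Ext K C A\<^esub> \<epsilon>) = Push K a \<delta> \<otimes>\<^bsub>Ext K C A'\<^esub> Push K a \<epsilon>"
  using push_hom[of C a A A'] by (auto simp: extension_def hom_def)

lemma push_zero:
  "C \<in> Ob K \<Longrightarrow> mor K a A A' \<Longrightarrow> Push K a \<one>\<^bsub>Ext K C A\<^esub> = \<one>\<^bsub>Ext K C A'\<^esub>"
  using push_hom[of C a A A'] ext_comm_group[of C A] ext_comm_group[of C A']
  by (simp add: mor_def comm_group_def hom_one)

lemma pull_zero:
  "A \<in> Ob K \<Longrightarrow> mor K c C' C \<Longrightarrow> Pull K c \<one>\<^bsub>Ext K C A\<^esub> = \<one>\<^bsub>Ext K C' A\<^esub>"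
  using pull_hom[of A c C' C] ext_comm_group[of C A] ext_comm_group[of C' A]
  by (simp add: mor_def comm_group_def hom_one)

lemma push_zero_mor:
  assumes "extension K \<delta> C A" "A' \<in> Ob K" shows "Push K (zero_mor K A A') \<delta> = \<one>\<^bsub>Ext K C A'\<^esub>"
proof -
  have ob: "C \<in> Ob K" "A \<in> Ob K" using assms by (auto simp: extension_def)
  let ?e = "Push K (zero_mor K A A') \<delta>"
  have "?e \<otimes>\<^bsub>Ext K C A'\<^esub> ?e = ?e"
    using push_add[OF assms(1) mor_zero mor_zero, of A'] ob assms by (simp add: add_zero_left mor_zero)
  moreover have "?e \<in> carrier (Ext K C A')"
    using extension_push[OF assms(1) mor_zero] ob assms by (auto simp: extension_def)
  ultimately show ?thesis
    using ext_comm_group[of C A'] ob assms by (metis comm_group_def group.l_cancel_one)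
qed

lemma pull_zero_mor:
  "extension K \<delta> C A \<Longrightarrow> C' \<in> Ob K \<Longrightarrow> Pull K (zero_mor K C' C) \<delta> = \<one>\<^bsub>Ext K C' A\<^esub>"
  using extriangulated_category.push_zero_mor[OF opposite, of \<delta> A C C'] by simp

lemma triangle_zero_right: "zero_object K Z \<Longrightarrow> A \<in> Ob K \<Longrightarrow>
    e_triangle K A A Z (Id K A) (zero_mor K A Z) \<one>\<^bsub>Ext K Z A\<^esub>"
  using real_zero[OF biproduct_zero] .

lemma triangle_zero_left: "zero_object K Z \<Longrightarrow> A \<in> Ob K \<Longrightarrow>
    e_triangle K Z A A (zero_mor K Z A) (Id K A) \<one>\<^bsub>Ext K A Z\<^esub>"
  using real_zero[OF biproduct_swap[OF biproduct_zero]] .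

text \<open>\<open>ET3\<close>, applied to the extriangle A -> A -> Z with Z zero and to the pair
  (1, x), makes y x factor through Z.\<close>

lemma triangle_comp_zero:
  assumes t: "e_triangle K A B C x y \<delta>" shows "y \<cdot> x = zero_mor K A C"
proof -
  note m = e_triangleD[OF t]
  obtain Z where Z: "zero_object K Z" using ex_zero_object by blast
  then have "Z \<in> Ob K" by (simp add: zero_object_def)
  obtain c where "mor K c Z C" "c \<cdot> zero_mor K A Z = y \<cdot> x"
    using ET3[OF triangle_zero_right[OF Z m(4)] t id_mor[OF m(4)] m(1)] m by auto
  then show ?thesis using m \<open>Z \<in> Ob K\<close> comp_zero_right by metis
qed

text \<open>f is the middle part of a morphism from X -> X -> Z, with Z zero, to the given
  extriangle; \<open>ET3_op\<close> supplies the first part, which is the factor sought.\<close>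

lemma triangle_factor:
  assumes t: "e_triangle K A B C x y \<delta>" and f: "mor K f X B" "y \<cdot> f = zero_mor K X C"
  shows "\<exists>a. mor K a X A \<and> x \<cdot> a = f"
proof -
  note m = e_triangleD[OF t]
  obtain Z where Z: "zero_object K Z" using ex_zero_object by blast
  have ob: "Z \<in> Ob K" "X \<in> Ob K" using Z f by (auto simp: zero_object_def mor_iff)
  have "zero_mor K Z C \<cdot> zero_mor K X Z = y \<cdot> f"
    using f m ob by (simp add: cat_simps)
  from ET3_op[OF triangle_zero_right[OF Z ob(2)] t f(1) mor_zero[OF ob(1) m(6)] this]
  show ?thesis using f comp_id_right by metis
qed

text \<open>The pair (1, y) starts at the extriangle Z -> B -> B with Z zero, whose class is zero,
  so by \<open>ET3_op\<close> the pulled back class is the image of zero.\<close>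

lemma triangle_pull_zero:
  assumes t: "e_triangle K A B C x y \<delta>" shows "Pull K y \<delta> = \<one>\<^bsub>Ext K B A\<^esub>"
proof -
  note m = e_triangleD[OF t]
  obtain Z where Z: "zero_object K Z" using ex_zero_object by blast
  obtain a where "mor K a Z A" "Push K a \<one>\<^bsub>Ext K B Z\<^esub> = Pull K y \<delta>"
    using ET3_op[OF triangle_zero_left[OF Z m(5)] t id_mor[OF m(5)] m(2)] m by auto
  then show ?thesis using push_zero m by metis
qed

text \<open>The zero class is realized by the biproduct of A and X, so f is the last part of a
  morphism from that extriangle. Restricting its middle part to X gives the lift.\<close>

lemma triangle_lift:
  assumes t: "e_triangle K A B C x y \<delta>" and f: "mor K f X C" "Pull K f \<delta> = \<one>\<^bsub>Ext K X A\<^esub>"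
  shows "\<exists>g. mor K g X B \<and> y \<cdot> g = f"
proof -
  note m = e_triangleD[OF t]
  have X: "X \<in> Ob K" using f by (auto simp: mor_iff)
  obtain S i j p q where b: "biproduct K A X S i j p q" using ex_biproduct m X by meson
  have "Push K (Id K A) \<one>\<^bsub>Ext K X A\<^esub> = Pull K f \<delta>"
    using f push_id extension_zero m X by metis
  from real_morphism[OF real_zero[OF b] t id_mor[OF m(4)] f(1) this]
  obtain g where g: "mor K g S B" "y \<cdot> g = f \<cdot> q" by blast
  have "y \<cdot> (g \<cdot> j) = (y \<cdot> g) \<cdot> j"
    using comp_assoc[OF biproductD(2)[OF b] g(1) m(2)] by simp
  also have "\<dots> = f \<cdot> (q \<cdot> j)"
    using g comp_assoc[OF biproductD(2,4)[OF b] f(1)] by simp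
  also have "\<dots> = f" using biproductD(6)[OF b] comp_id_right[OF f(1)] by simp
  finally show ?thesis using comp_mor[OF biproductD(2)[OF b] g(1)] by blast
qed

lemma triangle_push_zero: "e_triangle K A B C x y \<delta> \<Longrightarrow> Push K x \<delta> = \<one>\<^bsub>Ext K C B\<^esub>"
  using extriangulated_category.triangle_pull_zero[OF opposite, of C B A y x \<delta>] by simp

lemma triangle_extend:
  "e_triangle K A B C x y \<delta> \<Longrightarrow> mor K f A X \<Longrightarrow> Push K f \<delta> = \<one>\<^bsub>Ext K C X\<^esub> \<Longrightarrow>
    \<exists>g. mor K g B X \<and> g \<cdot> x = f"
  using extriangulated_category.triangle_lift[OF opposite, of C B A y x \<delta> f X] by simp

lemma ex_triangle:
  assumes "extension K \<delta> C A" shows "\<exists>B x y. e_triangle K A B C x y \<delta>"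
proof -
  obtain B x y where m: "mor K x A B" "mor K y B C" and R: "Real K \<delta> = seq_class K A B C x y"
    using real_class[OF assms] by blast
  have "B \<in> Ob K" using m by (simp add: mor_iff)
  then have "isomorphism K (Id K B) B B"
    using id_mor comp_id_left by (metis isomorphismI)
  then have "(x, y) \<in> Real K \<delta>"
    unfolding R seq_class_def using m comp_id_left comp_id_right by blast
  then show ?thesis using m assms by (auto simp: e_triangle_def)
qed

text \<open>Realize \<alpha> as A -> M -> X. As its pushforward vanishes, x extends over M, and
  \<open>ET3\<close> completes this to a morphism of extriangles that is the identity on A; its last
  part is h.\<close>

lemma triangle_push_kernel:
  assumes t: "e_triangle K A B C x y \<delta>" and a: "extension K \<alpha> X A" "Push K x \<alpha> = \<one>\<^bsub>Ext K X B\<^esub>"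
  shows "\<exists>h. mor K h X C \<and> \<alpha> = Pull K h \<delta>"
proof -
  note m = e_triangleD[OF t]
  obtain M k n where s: "e_triangle K A M X k n \<alpha>" using ex_triangle a by blast
  obtain g where g: "mor K g M B" "g \<cdot> k = x" using triangle_extend[OF s m(1) a(2)] by blast
  have "g \<cdot> k = x \<cdot> Id K A" using g m comp_id_right by simp
  from ET3[OF s t id_mor[OF m(4)] g(1) this] show ?thesis using push_id a by metis
qed

lemma triangle_pull_kernel:
  "e_triangle K A B C x y \<delta> \<Longrightarrow> extension K \<gamma> C X \<Longrightarrow> Pull K y \<gamma> = \<one>\<^bsub>Ext K B X\<^esub> \<Longrightarrow>
    \<exists>h. mor K h A X \<and> \<gamma> = Push K h \<delta>"
  using extriangulated_category.triangle_push_kernel[OF opposite, of C B A y x \<delta> \<gamma> X] by simp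

text \<open>Realize \<beta> as B -> M -> X and let E be the cone of A -> M. By \<open>ET4\<close>
  the map E -> X has class \<open>Push K y \<beta>\<close>, which is zero, so it has a section;
  pulling the class of A -> M -> E back along the section gives \<alpha>.\<close>

lemma triangle_push_exact:
  assumes t: "e_triangle K A B C x y \<delta>" and b: "extension K \<beta> X B" "Push K y \<beta> = \<one>\<^bsub>Ext K X C\<^esub>"
  shows "\<exists>\<alpha>. extension K \<alpha> X A \<and> \<beta> = Push K x \<alpha>"
proof -
  note m = e_triangleD[OF t]
  obtain M g g' where s: "e_triangle K B M X g g' \<beta>" using ex_triangle b by blast
  obtain E h h' d e \<delta>'' where E: "e_triangle K A M E h h' \<delta>''" "e_triangle K C E X d e (Push K y \<beta>)"
    "Push K x \<delta>'' = Pull K e \<beta>"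
    using ET4[OF t s] by blast
  note E_mor = e_triangleD[OF E(2)]
  have "Pull K (Id K X) (Push K y \<beta>) = \<one>\<^bsub>Ext K X C\<^esub>"
    using b pull_id E_mor(3) by simp
  from triangle_lift[OF E(2) id_mor[OF E_mor(6)] this]
  obtain r where r: "mor K r X E" "e \<cdot> r = Id K X" by blast
  have "Push K x (Pull K r \<delta>'') = Pull K r (Pull K e \<beta>)"
    using push_pull[OF _ m(1) r(1)] e_triangleD(3)[OF E(1)] E(3) by simp
  also have "\<dots> = \<beta>" using pull_comp[OF b(1) E_mor(2) r(1)] r(2) pull_id b(1) by simp
  finally show ?thesis using extension_pull[OF e_triangleD(3)[OF E(1)] r(1)] by metis
qed

section \<open>Uniqueness of realizations and transport along isomorphisms\<close>

lemma triangle_endo_iso: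
  assumes t: "e_triangle K A B C x y \<delta>" and u: "mor K u B B" "u \<cdot> x = x" "y \<cdot> u = y"
  shows "\<exists>v. mor K v B B \<and> v \<cdot> u = Id K B \<and> u \<cdot> v = Id K B"
proof -
  note m = e_triangleD[OF t]
  \<comment> \<open>n = u - 1 kills x and is killed by y. It therefore factors through x and has
    square zero, so that 1 - n inverts u = 1 + n.\<close>
  define n where "n = add_mor K B B u (neg_mor B B (Id K B))"
  have n: "mor K n B B" using u m unfolding n_def by (simp add: add_simps)
  have nx: "n \<cdot> x = zero_mor K A B" using u m unfolding n_def by (simp add: add_simps)
  have "y \<cdot> n = zero_mor K B C" using u m unfolding n_def by (simp add: add_simps)
  then obtain w where w: "mor K w B A" "x \<cdot> w = n" using triangle_factor[OF t n] by blast
  have nn: "n \<cdot> n = zero_mor K B B"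
    using comp_assoc[OF w(1) m(1) n] w nx comp_zero_left[OF w(1) m(5)] by simp
  have un: "u = add_mor K B B (Id K B) n" using u m unfolding n_def by (simp add: add_simps)
  let ?v = "add_mor K B B (Id K B) (neg_mor B B n)"
  have "mor K ?v B B" "?v \<cdot> u = Id K B" "u \<cdot> ?v = Id K B"
    unfolding un using n nn m by (simp_all add: add_simps)
  then show ?thesis by blast
qed

lemma isomorphism_two_sided:
  assumes "mor K f A B" "mor K g B A" "mor K h B A" "g \<cdot> f = Id K A" "f \<cdot> h = Id K B"
  shows "isomorphism K f A B"
proof -
  have "g = h" using comp_assoc[OF assms(3,1,2)] assms comp_id_left comp_id_right by metis
  then show ?thesis using assms isomorphismI by blast
qed

text \<open>A short five lemma with comparison maps in both directions: b' b and b b' are invertible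
  by \<open>triangle_endo_iso\<close>, so b has a left and a right inverse.\<close>

lemma triangle_middle_iso:
  assumes t: "e_triangle K A B C x y \<delta>" "e_triangle K A B' C' x' y' \<delta>'"
    and b: "mor K b B B'" "b \<cdot> x = x'" "y' \<cdot> b = c \<cdot> y" and b': "mor K b' B' B" "b' \<cdot> x' = x" "y \<cdot> b' = c' \<cdot> y'"
    and c: "mor K c C C'" "mor K c' C' C" "c' \<cdot> c = Id K C" "c \<cdot> c' = Id K C'"
  shows "isomorphism K b B B'"
proof -
  note m = e_triangleD[OF t(1)] and m' = e_triangleD[OF t(2)]
  have 1: "(b' \<cdot> b) \<cdot> x = x" using comp_assoc[OF m(1) b(1) b'(1)] b b' by simp
  have "y \<cdot> (b' \<cdot> b) = (c' \<cdot> y') \<cdot> b" using comp_assoc[OF b(1) b'(1) m(2)] b' by simp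
  also have "\<dots> = c' \<cdot> (c \<cdot> y)" using comp_assoc[OF b(1) m'(2) c(2)] b by simp
  also have "\<dots> = y" using comp_assoc[OF m(2) c(1,2)] c comp_id_left m by simp
  finally obtain v where v: "mor K v B B" "v \<cdot> (b' \<cdot> b) = Id K B"
    using triangle_endo_iso[OF t(1) comp_mor[OF b(1) b'(1)] 1] by blast
  have 2: "(b \<cdot> b') \<cdot> x' = x'" using comp_assoc[OF m'(1) b'(1) b(1)] b b' by simp
  have "y' \<cdot> (b \<cdot> b') = (c \<cdot> y) \<cdot> b'" using comp_assoc[OF b'(1) b(1) m'(2)] b by simp
  also have "\<dots> = c \<cdot> (c' \<cdot> y')" using comp_assoc[OF b'(1) m(2) c(1)] b' by simp
  also have "\<dots> = y'" using comp_assoc[OF m'(2) c(2,1)] c comp_id_left m' by simp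
  finally obtain w where w: "mor K w B' B'" "(b \<cdot> b') \<cdot> w = Id K B'"
    using triangle_endo_iso[OF t(2) comp_mor[OF b'(1) b(1)] 2] by blast
  show ?thesis
    using isomorphism_two_sided[OF b(1) comp_mor[OF b'(1) v(1)] comp_mor[OF w(1) b'(1)]]
      comp_assoc[OF b(1) b'(1) v(1)] comp_assoc[OF w(1) b'(1) b(1)] v w by simp
qed

lemma triangle_unique:
  assumes t: "e_triangle K A B C x y \<delta>" "e_triangle K A B' C x' y' \<delta>"
  shows "\<exists>b. isomorphism K b B B' \<and> b \<cdot> x = x' \<and> y' \<cdot> b = y"
proof -
  note m = e_triangleD[OF t(1)] and m' = e_triangleD[OF t(2)]
  have i: "Push K (Id K A) \<delta> = Pull K (Id K C) \<delta>" using push_id pull_id m by simp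
  obtain b where b: "mor K b B B'" "b \<cdot> x = x'" "y' \<cdot> b = Id K C \<cdot> y"
    using real_morphism[OF t id_mor[OF m(4)] id_mor[OF m(6)] i] m' comp_id_right by metis
  obtain b' where b': "mor K b' B' B" "b' \<cdot> x' = x" "y \<cdot> b' = Id K C \<cdot> y'"
    using real_morphism[OF t(2,1) id_mor[OF m(4)] id_mor[OF m(6)] i] m comp_id_right by metis
  have "Id K C \<cdot> Id K C = Id K C" "mor K (Id K C) C C" using id_mor comp_id_left m by metis+
  then have "isomorphism K b B B'" using triangle_middle_iso[OF t b b'] by blast
  then show ?thesis using b m comp_id_left by metis
qed

text \<open>The realization axiom describes \<open>Real K \<delta>\<close> through one unnamed
  sequence with middle term \<open>B0\<close>, so the given isomorphism has to be composed with one
  from \<open>B0\<close> to \<open>B\<close>.\<close>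

lemma triangle_replace:
  assumes t: "e_triangle K A B C x y \<delta>" and b: "isomorphism K b B B'"
    and m: "mor K x' A B'" "mor K y' B' C" and e: "b \<cdot> x = x'" "y' \<cdot> b = y"
  shows "e_triangle K A B' C x' y' \<delta>"
proof -
  note tm = e_triangleD[OF t]
  obtain B0 x0 y0 where R: "mor K x0 A B0" "mor K y0 B0 C" "Real K \<delta> = seq_class K A B0 C x0 y0"
    using real_class[OF tm(3)] by blast
  have "(x, y) \<in> Real K \<delta>" using t by (simp add: e_triangle_def)
  then obtain b0 B1 where b0: "mor K x A B1" "isomorphism K b0 B0 B1" "b0 \<cdot> x0 = x" "y \<cdot> b0 = y0"
    unfolding R seq_class_def by blast
  have [simp]: "B1 = B" using hom_disjoint b0(1) tm(1) by blast
  obtain c0 where c0: "mor K b0 B0 B" "mor K c0 B B0" "c0 \<cdot> b0 = Id K B0" "b0 \<cdot> c0 = Id K B"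
    using b0(2) by (auto elim: isomorphismE)
  obtain c where c: "mor K b B B'" "mor K c B' B" "c \<cdot> b = Id K B" "b \<cdot> c = Id K B'"
    using b by (auto elim: isomorphismE)
  have "isomorphism K (b \<cdot> b0) B0 B'"
  proof (rule isomorphismI)
    show "mor K (b \<cdot> b0) B0 B'" "mor K (c0 \<cdot> c) B' B0" using c c0 comp_mor by blast+
    show "(c0 \<cdot> c) \<cdot> (b \<cdot> b0) = Id K B0" "(b \<cdot> b0) \<cdot> (c0 \<cdot> c) = Id K B'"
      using c c0 by (simp_all add: cat_simps comp_reduce[OF c(3)] comp_reduce[OF c0(4)])
  qed
  moreover have "(b \<cdot> b0) \<cdot> x0 = x'" using comp_assoc[OF R(1) c0(1) c(1)] b0 e by simp
  moreover have "y' \<cdot> (b \<cdot> b0) = y0" using comp_assoc[OF c0(1) c(1) m(2)] b0 e by simp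
  ultimately have "(x', y') \<in> Real K \<delta>" unfolding R seq_class_def using m by blast
  then show ?thesis using m tm by (simp add: e_triangle_def)
qed

text \<open>The class pulled back along c' is realized by some extriangle; c and c' induce
  comparison maps both ways between it and the given one, so its middle term can be exchanged for
  B.\<close>

lemma triangle_iso_right:
  assumes t: "e_triangle K A B C x y \<delta>" and c: "mor K c C C'" "mor K c' C' C" "c' \<cdot> c = Id K C" "c \<cdot> c' = Id K C'"
  shows "e_triangle K A B C' x (c \<cdot> y) (Pull K c' \<delta>)"
proof -
  note m = e_triangleD[OF t]
  have e: "extension K (Pull K c' \<delta>) C' A" using extension_pull m c by blast
  obtain B' x' y' where s: "e_triangle K A B' C' x' y' (Pull K c' \<delta>)" using ex_triangle[OF e] by blast
  note m' = e_triangleD[OF s]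
  have 1: "Push K (Id K A) \<delta> = Pull K c (Pull K c' \<delta>)"
    using push_id[OF m(3)] pull_comp[OF m(3) c(2,1)] pull_id[OF m(3)] c by simp
  have 2: "Push K (Id K A) (Pull K c' \<delta>) = Pull K c' \<delta>" using push_id e by blast
  obtain b where b: "mor K b B B'" "b \<cdot> x = x'" "y' \<cdot> b = c \<cdot> y"
    using real_morphism[OF t s id_mor[OF m(4)] c(1) 1] m' comp_id_right by metis
  obtain b' where b': "mor K b' B' B" "b' \<cdot> x' = x" "y \<cdot> b' = c' \<cdot> y'"
    using real_morphism[OF s t id_mor[OF m(4)] c(2) 2] m comp_id_right by metis
  have "isomorphism K b' B' B" using triangle_middle_iso[OF s t b' b c(2,1,4,3)] .
  moreover have "(c \<cdot> y) \<cdot> b' = y'"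
    using comp_assoc[OF b'(1) m(2) c(1)] b'(3) comp_assoc[OF m'(2) c(2,1)] c(4) comp_id_left m' by simp
  ultimately show ?thesis
    using triangle_replace[OF s _ m(1) comp_mor[OF m(2) c(1)]] b' by blast
qed

lemma triangle_split:
  assumes t: "e_triangle K A S C x y \<one>\<^bsub>Ext K C A\<^esub>"
  shows "\<exists>j p. biproduct K A C S x j p y"
proof -
  note m = e_triangleD[OF t]
  obtain T i j p q where b: "biproduct K A C T i j p q" using ex_biproduct m by meson
  obtain f where "isomorphism K f T S" and f: "f \<cdot> i = x" "y \<cdot> f = q"
    using triangle_unique[OF real_zero[OF b] t] by blast
  then obtain g where g: "mor K f T S" "mor K g S T" "g \<cdot> f = Id K T" "f \<cdot> g = Id K S"
    by (auto elim: isomorphismE)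
  have "q \<cdot> g = y" using comp_assoc[OF g(2,1) m(2)] f g comp_id_right m by simp
  then show ?thesis using biproduct_iso[OF b g] f by auto
qed

section \<open>Pullback and pushout of two extriangles\<close>

lemma triangle_pullback_half:
  assumes b: "biproduct K A1 A2 S i j p q" and t: "e_triangle K S M C g g' \<mu>"
    and t2: "e_triangle K A2 B2 C x2 y2 (Push K q \<mu>)"
  shows "\<exists>m n. e_triangle K A1 M B2 m n (Pull K y2 (Push K p \<mu>))"
proof -
  note bm = biproductD[OF b] and m2 = e_triangleD[OF t2]
  have mu: "extension K \<mu> C S" using e_triangleD[OF t] by simp
  \<comment> \<open>\<open>ET4\<close> for A1 -> S -> M identifies the cone of A1 -> M as a
    realization of the second component of \<mu>, hence as a copy of \<open>B2\<close>.\<close>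
  obtain E h h' d e \<delta>'' where E: "e_triangle K A1 M E h h' \<delta>''" "e_triangle K A2 E C d e (Push K q \<mu>)"
    "Push K i \<delta>'' = Pull K e \<mu>"
    using ET4[OF real_zero[OF b] t] by blast
  note e = e_triangleD[OF E(2)]
  have d3: "extension K \<delta>'' E A1" using e_triangleD[OF E(1)] by simp
  \<comment> \<open>Since p i = 1, the class \<delta>'' is recovered from its pushforward along i,
    which \<open>ET4\<close> describes.\<close>
  have "\<delta>'' = Push K p (Push K i \<delta>'')"
    using push_comp[OF d3 bm(1,3)] bm(5) push_id[OF d3] by simp
  then have d: "\<delta>'' = Pull K e (Push K p \<mu>)" using E(3) push_pull[OF mu bm(3) e(2)] by simp
  obtain f where "isomorphism K f E B2" "y2 \<cdot> f = e" using triangle_unique[OF E(2) t2] by blast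
  then obtain f' where f: "mor K f E B2" "mor K f' B2 E" "f' \<cdot> f = Id K E" "f \<cdot> f' = Id K B2" "y2 \<cdot> f = e"
    by (auto elim: isomorphismE)
  have "e \<cdot> f' = y2" using comp_assoc[OF f(2,1) m2(2)] f comp_id_right m2 by simp
  then have "Pull K f' \<delta>'' = Pull K y2 (Push K p \<mu>)"
    unfolding d using pull_comp[OF extension_push[OF mu bm(3)] e(2) f(2)] by simp
  then show ?thesis using triangle_iso_right[OF E(1) f(1-4)] by auto
qed

text \<open>Both extriangles come from one realization of the class in \<open>Ext C (A1 \<oplus> A2)\<close> with components
  \<open>\<delta>1\<close> and \<open>\<delta>2\<close>.\<close>

lemma triangle_pullback:
  assumes t1: "e_triangle K A1 B1 C x1 y1 \<delta>1" and t2: "e_triangle K A2 B2 C x2 y2 \<delta>2"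
  shows "\<exists>M m1 n1 m2 n2. e_triangle K A1 M B2 m1 n1 (Pull K y2 \<delta>1) \<and> e_triangle K A2 M B1 m2 n2 (Pull K y1 \<delta>2)"
proof -
  note m1 = e_triangleD[OF t1] and m2 = e_triangleD[OF t2]
  obtain S i j p q where b: "biproduct K A1 A2 S i j p q" using ex_biproduct m1 m2 by meson
  note bm = biproductD[OF b]
  define \<mu> where "\<mu> = Push K i \<delta>1 \<otimes>\<^bsub>Ext K C S\<^esub> Push K j \<delta>2"
  have e: "extension K (Push K i \<delta>1) C S" "extension K (Push K j \<delta>2) C S"
    using extension_push m1 m2 bm by blast+
  have mu: "extension K \<mu> C S" unfolding \<mu>_def using extension_add e by blast
  have 1: "Push K p \<mu> = \<delta>1"
    unfolding \<mu>_def push_sum[OF e bm(3)]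
    using push_comp[OF m1(3) bm(1,3)] push_comp[OF m2(3) bm(2,3)] bm push_id[OF m1(3)]
      push_zero_mor[OF m2(3) m1(4)] extension_add_zero[OF m1(3)] by simp
  have 2: "Push K q \<mu> = \<delta>2"
    unfolding \<mu>_def push_sum[OF e bm(4)]
    using push_comp[OF m1(3) bm(1,4)] push_comp[OF m2(3) bm(2,4)] bm push_id[OF m2(3)]
      push_zero_mor[OF m1(3) m2(4)] extension_add_zero[OF m2(3)] by simp
  obtain M g g' where t: "e_triangle K S M C g g' \<mu>" using ex_triangle[OF mu] by blast
  show ?thesis
    using triangle_pullback_half[OF b t, of B2 x2 y2] triangle_pullback_half[OF biproduct_swap[OF b] t, of B1 x1 y1]
      t1 t2 unfolding 1 2 by blast
qed

lemma triangle_pushout: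
  assumes "e_triangle K A B1 C1 x1 y1 \<delta>1" "e_triangle K A B2 C2 x2 y2 \<delta>2"
  shows "\<exists>M m1 n1 m2 n2. e_triangle K B2 M C1 m1 n1 (Push K x2 \<delta>1) \<and> e_triangle K B1 M C2 m2 n2 (Push K x1 \<delta>2)"
  using extriangulated_category.triangle_pullback[OF opposite, of C1 B1 A y1 x1 \<delta>1 C2 B2 y2 x2 \<delta>2] assms
  by simp blast

end

section \<open>Minimal approximations\<close>

text \<open>This is locality of the endomorphism ring in the form used to choose a pivot. Being free
  of ring structures and symmetric in composition, it passes to the opposite category at
  once.\<close>

definition local_object :: "('o, 'm, 'z) hom_category_scheme \<Rightarrow> 'o \<Rightarrow> bool" where
  "local_object K Y \<longleftrightarrow> Y \<in> Ob K \<and>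
     (\<forall>a b. mor K a Y Y \<and> mor K b Y Y \<and> add_mor K Y Y a b = Id K Y \<longrightarrow>
        isomorphism K a Y Y \<or> isomorphism K b Y Y)"

text \<open>The index set is an arbitrary finite set, so that deleting one index needs no
  renumbering of the summands.\<close>

definition local_decomposition ::
  "('o, 'm, 'z) hom_category_scheme \<Rightarrow> nat set \<Rightarrow> 'o \<Rightarrow> (nat \<Rightarrow> 'o) \<Rightarrow> (nat \<Rightarrow> 'm) \<Rightarrow> (nat \<Rightarrow> 'm) \<Rightarrow> bool"
where
  "local_decomposition K J D Y i p \<longleftrightarrow> finite J \<and> D \<in> Ob K \<and>
     (\<forall>k\<in>J. local_object K (Y k) \<and> mor K (i k) (Y k) D \<and> mor K (p k) D (Y k)) \<and>
     (\<forall>k\<in>J. \<forall>l\<in>J. p l \<cdot>\<^bsub>K\<^esub> i k = (if k = l then Id K (Y k) else zero_mor K (Y k) (Y l))) \<and>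
     finprod (Hom K D D) (\<lambda>k. i k \<cdot>\<^bsub>K\<^esub> p k) J = Id K D"

lemma local_object_opposite [simp]: "local_object (opposite K) Y \<longleftrightarrow> local_object K Y"
  by (simp add: local_object_def)

lemma local_decomposition_opposite:
  "local_decomposition K J D Y i p \<Longrightarrow> local_decomposition (opposite K) J D Y p i"
  unfolding local_decomposition_def by auto

text \<open>The Krull-Schmidt property is kept as the existence of local decompositions, because in
  this form it is visibly self-dual: injections and projections change places.\<close>

locale ks_extriangulated = extriangulated_category K
  for K :: "('o, 'm, 'e, 'z) ext_category_scheme" (structure) +
  assumes enough_projectives: "enough_projectives K"
    and enough_injectives: "enough_injectives K"
    and WIC: "WIC K"
    and ex_local_decomposition: "D \<in> Ob K \<Longrightarrow> \<exists>J Y i p. local_decomposition K J D Y i p"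

lemma projective_in_opposite [simp]: "projective_in (opposite K) \<Y> P \<longleftrightarrow> injective_in K \<Y> P"
  by (auto simp: projective_in_def injective_in_def)

lemma injective_in_opposite [simp]: "injective_in (opposite K) \<Y> P \<longleftrightarrow> projective_in K \<Y> P"
  by (auto simp: projective_in_def injective_in_def)

lemma WIC_opposite: "WIC K \<Longrightarrow> WIC (opposite K)"
  by (simp add: WIC_def) blast

lemma (in ks_extriangulated) ks_opposite: "ks_extriangulated (opposite K)"
proof (rule ks_extriangulated.intro[OF opposite], rule ks_extriangulated_axioms.intro)
  show "enough_projectives (opposite K)"
    using enough_injectives unfolding enough_projectives_def enough_injectives_def by simp blast
  show "enough_injectives (opposite K)"
    using enough_projectives unfolding enough_projectives_def enough_injectives_def by simp blast
  show "WIC (opposite K)" using WIC WIC_opposite by blast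
  show "\<exists>J Y i p. local_decomposition (opposite K) J D Y i p" if "D \<in> Ob (opposite K)" for D
    using ex_local_decomposition[of D] local_decomposition_opposite that by fastforce
qed

lemma (in additive_category) local_object_endo_ring:
  assumes "Y \<in> Ob K" "local_ring (endo_ring K Y)" shows "local_object K Y"
proof -
  have units: "x \<in> Units (endo_ring K Y) \<longleftrightarrow> isomorphism K x Y Y" for x
    using assms(1) by (auto simp: Units_def endo_ring_def isomorphism_def mor_def)
  have "Id K Y \<cdot> Id K Y = Id K Y" using id_mor comp_id_left assms(1) by blast
  then have one: "Id K Y \<in> Units (endo_ring K Y)"
    unfolding units using id_mor[OF assms(1)] isomorphismI by blast
  have "isomorphism K a Y Y \<or> isomorphism K b Y Y"
    if "mor K a Y Y" "mor K b Y Y" "add_mor K Y Y a b = Id K Y" for a b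
  proof (rule ccontr)
    assume "\<not> ?thesis"
    moreover have "a \<in> carrier (endo_ring K Y)" "b \<in> carrier (endo_ring K Y)"
      using that by (simp_all add: mor_def endo_ring_def)
    ultimately have "a \<in> carrier (endo_ring K Y) - Units (endo_ring K Y)"
      "b \<in> carrier (endo_ring K Y) - Units (endo_ring K Y)"
      by (auto simp: units)
    then have "a \<oplus>\<^bsub>endo_ring K Y\<^esub> b \<notin> Units (endo_ring K Y)"
      using assms(2) by (auto simp: local_ring_def)
    then show False using that one by (simp add: endo_ring_def)
  qed
  then show ?thesis using assms(1) by (auto simp: local_object_def)
qed

lemma (in additive_category) krull_schmidt_decomposition:
  assumes "krull_schmidt K" "D \<in> Ob K"
  shows "\<exists>J Y i p. local_decomposition K J D Y i p"
proof -
  from bspec[OF assms(1)[unfolded krull_schmidt_def] assms(2)]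
  obtain n :: nat and Y i p where "(\<forall>k<n. Y k \<in> Ob K \<and> local_ring (endo_ring K (Y k)) \<and>
            mor K (i k) (Y k) D \<and> mor K (p k) D (Y k)) \<and>
     (\<forall>k<n. \<forall>l<n. p l \<cdot> i k = (if k = l then Id K (Y k) else zero_mor K (Y k) (Y l))) \<and>
     finprod (Hom K D D) (\<lambda>k. i k \<cdot> p k) {..<n} = Id K D"
    by (elim exE)
  then have "local_decomposition K {..<n} D Y i p"
    using local_object_endo_ring assms(2) unfolding local_decomposition_def by simp
  then show ?thesis by blast
qed

text \<open>Moves a finite sum of idempotents of D to a complement of a summand. The typing of the
  sum is part of the induction because distributivity depends on it.\<close>

lemma (in additive_category) comp_finprod:
  assumes "finite J" "\<And>l. l \<in> J \<Longrightarrow> mor K (f l) A B" "mor K g B C" "mor K h Z A"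
  shows "g \<cdot> (finprod (Hom K A B) f J \<cdot> h) = finprod (Hom K Z C) (\<lambda>l. g \<cdot> (f l \<cdot> h)) J \<and>
    mor K (finprod (Hom K A B) f J) A B"
  using assms(1,2)
proof (induction J rule: finite_induct)
  case empty
  have ob: "A \<in> Ob K" "B \<in> Ob K" "C \<in> Ob K" "Z \<in> Ob K" using assms by (auto simp: mor_iff)
  interpret AB: comm_group "Hom K A B" by (rule hom_comm_group[OF ob(1,2)])
  interpret ZC: comm_group "Hom K Z C" by (rule hom_comm_group[OF ob(4,3)])
  show ?case using assms(3,4) ob mor_zero[OF ob(1,2)] by (simp add: comp_simps mor_iff)
next
  case (insert x F)
  have ob: "A \<in> Ob K" "B \<in> Ob K" "C \<in> Ob K" "Z \<in> Ob K" using assms by (auto simp: mor_iff)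
  interpret AB: comm_group "Hom K A B" by (rule hom_comm_group[OF ob(1,2)])
  interpret ZC: comm_group "Hom K Z C" by (rule hom_comm_group[OF ob(4,3)])
  have f: "mor K (f l) A B" "mor K (g \<cdot> (f l \<cdot> h)) Z C" if "l \<in> insert x F" for l
    using insert.prems[OF that] comp_mor[OF comp_mor[OF assms(4) insert.prems[OF that]] assms(3)] by simp_all
  have 1: "finprod (Hom K A B) f (insert x F) = add_mor K A B (f x) (finprod (Hom K A B) f F)"
    using insert.hyps f by (intro AB.finprod_insert) (auto simp: mor_def)
  have 2: "finprod (Hom K Z C) (\<lambda>l. g \<cdot> (f l \<cdot> h)) (insert x F) =
      add_mor K Z C (g \<cdot> (f x \<cdot> h)) (finprod (Hom K Z C) (\<lambda>l. g \<cdot> (f l \<cdot> h)) F)"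
    using insert.hyps f by (intro ZC.finprod_insert) (auto simp: mor_def)
  have IH: "g \<cdot> (finprod (Hom K A B) f F \<cdot> h) = finprod (Hom K Z C) (\<lambda>l. g \<cdot> (f l \<cdot> h)) F"
    "mor K (finprod (Hom K A B) f F) A B"
    using insert by auto
  show ?case
    unfolding 1 2 IH(1)[symmetric] using IH(2) f(1)[of x] assms(3,4) ob mor_add
    by (simp add: comp_add_left comp_add_right comp_mor)
qed

context ks_extriangulated
begin

text \<open>The identity r s is an inflation, so WIC makes s one. The class of the resulting
  extriangle equals its pushforward along r s, hence is zero, and the extriangle splits. The
  projection found in this way is then exchanged for r.\<close>

lemma retract_biproduct:
  assumes s: "mor K s A S" and r: "mor K r S A" "r \<cdot> s = Id K A"
  shows "\<exists>B j q. biproduct K A B S s j r q"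
proof -
  have A: "A \<in> Ob K" using s by (simp add: mor_iff)
  obtain Z where "zero_object K Z" using ex_zero_object by blast
  then have "inflation K (r \<cdot> s)"
    using triangle_zero_right A r unfolding inflation_def by metis
  then have "inflation K s" using WIC s r(1) unfolding WIC_def by blast
  then obtain A' S' B y \<delta> where t: "e_triangle K A' S' B s y \<delta>" unfolding inflation_def by blast
  have [simp]: "A' = A" "S' = S" using e_triangleD(1)[OF t] s hom_disjoint by blast+
  note m = e_triangleD[OF t, simplified]
  have "\<delta> = Push K r (Push K s \<delta>)" using push_comp[OF m(3) s r(1)] r(2) push_id m by simp
  then have "\<delta> = \<one>\<^bsub>Ext K B A\<^esub>" using triangle_push_zero[OF t] push_zero[OF m(6) r(1)] by simp
  then obtain j p where "biproduct K A B S s j p y" using triangle_split[of A S B s y] t by auto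
  then show ?thesis using biproduct_twist r by blast
qed

lemma decomposition_complement:
  assumes d: "local_decomposition K J D Y i p" and k: "k \<in> J" and r: "mor K r D (Y k)" "r \<cdot> i k = Id K (Y k)"
  shows "\<exists>D0 j q. biproduct K (Y k) D0 D (i k) j r q \<and>
    local_decomposition K (J - {k}) D0 Y (\<lambda>l. q \<cdot> i l) (\<lambda>l. p l \<cdot> j)"
proof -
  have D: "D \<in> Ob K" "finite J" using d by (auto simp: local_decomposition_def)
  have ip: "mor K (i l) (Y l) D" "mor K (p l) D (Y l)" "Y l \<in> Ob K" "local_object K (Y l)" if "l \<in> J" for l
    using d that by (auto simp: local_decomposition_def local_object_def)
  have pi: "p l \<cdot> i l' = (if l' = l then Id K (Y l') else zero_mor K (Y l') (Y l))" if "l' \<in> J" "l \<in> J" for l l'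
    using d that by (auto simp: local_decomposition_def)
  obtain D0 j q where b: "biproduct K (Y k) D0 D (i k) j r q"
    using retract_biproduct ip k r by blast
  note bm = biproductD[OF b]
  have D0: "D0 \<in> Ob K" using bm by (simp add: mor_iff)
  have jq: "j \<cdot> q = add_mor K D D (Id K D) (neg_mor D D (i k \<cdot> r))"
    unfolding bm(9)[symmetric] using bm(1-4) D by (simp add: add_simps)
  have pq: "(p m \<cdot> j) \<cdot> (q \<cdot> i l) = (if l = m then Id K (Y l) else zero_mor K (Y l) (Y m))"
    if "l \<in> J - {k}" "m \<in> J - {k}" for l m
  proof -
    have m: "mor K (p m) D (Y m)" "mor K (i l) (Y l) D" using ip that by auto
    have "(p m \<cdot> j) \<cdot> (q \<cdot> i l) = p m \<cdot> ((j \<cdot> q) \<cdot> i l)"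
      using m bm(1-4) by (simp add: cat_simps)
    also have "\<dots> = add_mor K (Y l) (Y m) (p m \<cdot> i l) (neg_mor (Y l) (Y m) ((p m \<cdot> i k) \<cdot> (r \<cdot> i l)))"
      unfolding jq using m bm(1-4) by (simp add: cat_simps distrib_simps)
    also have "p m \<cdot> i k = zero_mor K (Y k) (Y m)" using pi[of k m] that k by auto
    finally show ?thesis
      using m bm(1-4) pi[of l m] that by (simp add: cat_simps group_simps)
  qed
  interpret DD: comm_group "Hom K D D" by (rule hom_comm_group[OF D(1) D(1)])
  let ?F = "\<lambda>l. i l \<cdot> p l"
  let ?e = "finprod (Hom K D D) ?F (J - {k})"
  have F: "mor K (?F l) D D" if "l \<in> J" for l using ip that comp_mor by blast
  have "finprod (Hom K D D) ?F (insert k (J - {k})) = add_mor K D D (?F k) ?e"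
    using D F k by (intro DD.finprod_insert) (auto simp: mor_def)
  then have e: "add_mor K D D (?F k) ?e = Id K D"
    using d k by (simp add: local_decomposition_def insert_absorb)
  have c: "q \<cdot> (?e \<cdot> j) = finprod (Hom K D0 D0) (\<lambda>l. q \<cdot> (?F l \<cdot> j)) (J - {k})" "mor K ?e D D"
    using comp_finprod[of "J - {k}" ?F D D q D0 j D0] F D bm by auto
  have "?e = add_mor K D D (Id K D) (neg_mor D D (?F k))"
    unfolding e[symmetric] using c(2) F[OF k] ip[OF k] by (simp add: add_simps)
  then have "q \<cdot> (?e \<cdot> j) = add_mor K D0 D0 (q \<cdot> j) (neg_mor D0 D0 ((q \<cdot> i k) \<cdot> (p k \<cdot> j)))"
    using ip[OF k] bm(1-4) by (simp add: cat_simps distrib_simps)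
  then have qej: "q \<cdot> (?e \<cdot> j) = Id K D0"
    unfolding bm(6,7) using ip[OF k] bm(2) by (simp add: cat_simps group_simps)
  interpret D0D0: comm_group "Hom K D0 D0" by (rule hom_comm_group[OF D0 D0])
  have "finprod (Hom K D0 D0) (\<lambda>l. (q \<cdot> i l) \<cdot> (p l \<cdot> j)) (J - {k}) =
      finprod (Hom K D0 D0) (\<lambda>l. q \<cdot> (?F l \<cdot> j)) (J - {k})"
  proof (rule D0D0.finprod_cong')
    fix l assume "l \<in> J - {k}"
    then show "(q \<cdot> i l) \<cdot> (p l \<cdot> j) = q \<cdot> (?F l \<cdot> j)"
      using ip[of l] bm(1-4) by (simp add: cat_simps)
  next
    have "mor K (q \<cdot> (?F l \<cdot> j)) D0 D0" if "l \<in> J - {k}" for l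
      using F[of l] that bm(2,4) comp_mor by blast
    then show "(\<lambda>l. q \<cdot> (?F l \<cdot> j)) \<in> J - {k} \<rightarrow> carrier (Hom K D0 D0)"
      by (auto simp: mor_def)
  qed simp
  moreover have "mor K (q \<cdot> i l) (Y l) D0" "mor K (p l \<cdot> j) D0 (Y l)" if "l \<in> J" for l
    using ip[OF that] bm(2,4) comp_mor by blast+
  ultimately have "local_decomposition K (J - {k}) D0 Y (\<lambda>l. q \<cdot> i l) (\<lambda>l. p l \<cdot> j)"
    unfolding local_decomposition_def using D D0 ip pq qej c by auto
  then show ?thesis using b by blast
qed

text \<open>Gaussian elimination for a matrix over local rings: either every pivot is invertible, which
  gives a right inverse, or some entry of \<open>1 - \<phi>\<close> is invertible after row operations.\<close>

lemma right_inverse_or_local_summand: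
  assumes "local_decomposition K J D Y i p" "mor K \<phi> D D"
  shows "(\<exists>\<theta>. mor K \<theta> D D \<and> \<phi> \<cdot> \<theta> = Id K D) \<or>
    (\<exists>k\<in>J. \<exists>s. mor K s D (Y k) \<and> s \<cdot> (add_mor K D D (Id K D) (neg_mor D D \<phi>) \<cdot> i k) = Id K (Y k))"
  using assms
proof (induction "card J" arbitrary: J D i p \<phi>)
  case 0
  then have D: "D \<in> Ob K" "J = {}" by (auto simp: local_decomposition_def)
  interpret DD: comm_group "Hom K D D" by (rule hom_comm_group[OF D(1) D(1)])
  have "zero_object K D" using 0 D by (simp add: local_decomposition_def zero_object_def)
  then have "\<phi> \<cdot> Id K D = Id K D"
    using 0 D zero_object_mor(1) id_mor comp_mor by metis
  then show ?case using id_mor D by blast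
next
  case (Suc n)
  then obtain k where k: "k \<in> J" by fastforce
  note d = Suc.prems(1) and \<phi> = Suc.prems(2)
  have D: "D \<in> Ob K" "finite J" using d by (auto simp: local_decomposition_def)
  have ip: "mor K (i l) (Y l) D" "mor K (p l) D (Y l)" "Y l \<in> Ob K" "local_object K (Y l)" if "l \<in> J" for l
    using d that by (auto simp: local_decomposition_def local_object_def)
  have pi: "p l \<cdot> i l' = (if l' = l then Id K (Y l') else zero_mor K (Y l') (Y l))" if "l' \<in> J" "l \<in> J" for l l'
    using d that by (auto simp: local_decomposition_def)
  note ik = ip(1)[OF k] and pk = ip(2)[OF k] and Yk = ip(3)[OF k]
  have pik: "p k \<cdot> i k = Id K (Y k)" using pi k by simp
  define \<psi> where "\<psi> = add_mor K D D (Id K D) (neg_mor D D \<phi>)"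
  have \<psi>: "mor K \<psi> D D" unfolding \<psi>_def using \<phi> D by (simp add: add_simps)
  \<comment> \<open>a and b are the diagonal entries at k of \<phi> and 1 - \<phi>. They add up to
    1, so one of them is invertible.\<close>
  define a where "a = p k \<cdot> (\<phi> \<cdot> i k)"
  define b where "b = p k \<cdot> (\<psi> \<cdot> i k)"
  have a: "mor K a (Y k) (Y k)" and b: "mor K b (Y k) (Y k)"
    unfolding a_def b_def using ik pk \<phi> \<psi> comp_mor by blast+
  have "add_mor K (Y k) (Y k) a b = Id K (Y k)"
    unfolding a_def b_def \<psi>_def using ik pk \<phi> D Yk pik by (simp add: add_simps)
  then consider "isomorphism K b (Y k) (Y k)" | "isomorphism K a (Y k) (Y k)"
    using ip(4)[OF k] a b unfolding local_object_def by blast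
  then show ?case
  proof cases
    case 1
    then obtain c where c: "mor K c (Y k) (Y k)" "c \<cdot> b = Id K (Y k)" by (auto elim: isomorphismE)
    have "(c \<cdot> p k) \<cdot> (\<psi> \<cdot> i k) = Id K (Y k)"
      using comp_assoc[OF comp_mor[OF ik \<psi>] pk c(1)] c(2) unfolding b_def by simp
    then show ?thesis using k comp_mor[OF pk c(1)] unfolding \<psi>_def by blast
  next
    case 2
    then obtain c where c: "mor K c (Y k) (Y k)" "c \<cdot> a = Id K (Y k)" "a \<cdot> c = Id K (Y k)"
      by (auto elim: isomorphismE)
    obtain D0 j q where b: "biproduct K (Y k) D0 D (i k) j (p k) q"
      and d0: "local_decomposition K (J - {k}) D0 Y (\<lambda>l. q \<cdot> i l) (\<lambda>l. p l \<cdot> j)"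
      using decomposition_complement[OF d k pk pik] by blast
    note bm = biproductD[OF b]
    have D0: "D0 \<in> Ob K" using bm by (simp add: mor_iff)
    \<comment> \<open>Row operation clearing the pivot column, with c the inverse of the pivot a: u
      kills \<phi> i and still satisfies u j = 1.\<close>
    define u where "u = add_mor K D D0 q (neg_mor D D0 (q \<cdot> (\<phi> \<cdot> (i k \<cdot> (c \<cdot> p k)))))"
    have u: "mor K u D D0" unfolding u_def using bm(1-4) \<phi> c D D0 by (simp add: add_simps)
    have cp: "c \<cdot> (p k \<cdot> (\<phi> \<cdot> i k)) = Id K (Y k)" using c(2) unfolding a_def by simp
    have u\<phi>i: "u \<cdot> (\<phi> \<cdot> i k) = zero_mor K (Y k) D0"
      unfolding u_def using bm(1-4) \<phi> c(1) D D0 by (simp add: cat_simps distrib_simps cp group_simps)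
    have uj: "u \<cdot> j = Id K D0"
      unfolding u_def using bm(1-8) \<phi> c(1) D D0 by (simp add: cat_simps distrib_simps group_simps)
    \<comment> \<open>The Schur complement of the pivot, an endomorphism of the smaller
      object.\<close>
    define \<phi>' where "\<phi>' = u \<cdot> (\<phi> \<cdot> j)"
    have \<phi>': "mor K \<phi>' D0 D0" unfolding \<phi>'_def using u \<phi> bm comp_mor by blast
    have "u \<cdot> \<phi> = (u \<cdot> \<phi>) \<cdot> add_mor K D D (i k \<cdot> p k) (j \<cdot> q)"
      using bm(9) u \<phi> comp_mor comp_id_right by metis
    also have "\<dots> = add_mor K D D0 ((u \<cdot> (\<phi> \<cdot> i k)) \<cdot> p k) (\<phi>' \<cdot> q)"
      unfolding \<phi>'_def using bm(1-4) u \<phi> by (simp add: cat_simps distrib_simps)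
    also have "\<dots> = \<phi>' \<cdot> q"
      unfolding u\<phi>i using bm(1-4) \<phi>' D0 by (simp add: cat_simps group_simps)
    finally have u\<phi>: "u \<cdot> \<phi> = \<phi>' \<cdot> q" .
    have "n = card (J - {k})" using Suc.hyps(2) k D by simp
    from Suc.hyps(1)[OF this d0 \<phi>'] show ?thesis
    proof (elim disjE exE bexE conjE)
      fix w assume w: "mor K w D0 D0" "\<phi>' \<cdot> w = Id K D0"
      \<comment> \<open>j w u solves \<phi> x = 1 up to the error z = 1 - v, and u z = 0. The pivot
        column removes such an error, which is the first summand of \<theta> below.\<close>
      define v where "v = \<phi> \<cdot> (j \<cdot> (w \<cdot> u))"
      have v: "mor K v D D" unfolding v_def using \<phi> bm w u comp_mor by blast
      have uv: "u \<cdot> v = u"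
        using comp_assoc[OF comp_mor[OF comp_mor[OF u w(1)] bm(2)] \<phi> u] u\<phi>
          comp_assoc[OF comp_mor[OF comp_mor[OF u w(1)] bm(2)] bm(4) \<phi>']
          comp_assoc[OF comp_mor[OF u w(1)] bm(2,4)] comp_id_left[OF comp_mor[OF u w(1)]] bm(6)
          comp_assoc[OF u w(1) \<phi>'] w(2) comp_id_left[OF u]
        unfolding v_def by simp
      define z where "z = add_mor K D D (Id K D) (neg_mor D D v)"
      have z: "mor K z D D" unfolding z_def using v D by (simp add: add_simps)
      define \<theta> where "\<theta> = add_mor K D D (i k \<cdot> (c \<cdot> (p k \<cdot> z))) (j \<cdot> (w \<cdot> u))"
      have \<theta>: "mor K \<theta> D D" unfolding \<theta>_def using bm(1-4) c w u z by (simp add: add_simps)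
      have e: "\<phi> \<cdot> \<theta> = add_mor K D D (\<phi> \<cdot> (i k \<cdot> (c \<cdot> (p k \<cdot> z)))) v"
        unfolding \<theta>_def v_def using bm(1-4) c(1) w(1) u z \<phi> by (simp add: cat_simps distrib_simps)
      have "p k \<cdot> (\<phi> \<cdot> (i k \<cdot> (c \<cdot> (p k \<cdot> z)))) = (a \<cdot> c) \<cdot> (p k \<cdot> z)"
        unfolding a_def using bm(1-4) c(1) z \<phi> by (simp add: cat_simps)
      also have "\<dots> = p k \<cdot> z" using c(3) comp_id_left comp_mor[OF z pk] by simp
      finally have "p k \<cdot> (\<phi> \<cdot> \<theta>) = add_mor K D (Y k) (p k \<cdot> z) (p k \<cdot> v)"
        unfolding e using bm(1-4) c(1) z v \<phi> by (simp add: cat_simps distrib_simps)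
      also have "\<dots> = p k" unfolding z_def using pk v by (simp add: add_simps)
      finally have 1: "p k \<cdot> (\<phi> \<cdot> \<theta>) = p k" .
      have "q \<cdot> (\<phi> \<cdot> (i k \<cdot> (c \<cdot> p k))) = add_mor K D D0 q (neg_mor D D0 u)"
        unfolding u_def using bm(1-4) \<phi> c(1) D D0 by (simp add: add_simps)
      then have "(q \<cdot> (\<phi> \<cdot> (i k \<cdot> (c \<cdot> p k)))) \<cdot> z = add_mor K D D0 (q \<cdot> z) (neg_mor D D0 (u \<cdot> z))"
        using bm(1-4) u z by (simp add: cat_simps distrib_simps)
      also have "u \<cdot> z = zero_mor K D D0"
        unfolding z_def using u v uv by (simp add: add_simps)
      finally have "q \<cdot> (\<phi> \<cdot> (i k \<cdot> (c \<cdot> (p k \<cdot> z)))) = q \<cdot> z"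
        using bm(1-4) \<phi> c(1) z by (simp add: cat_simps group_simps)
      then have "q \<cdot> (\<phi> \<cdot> \<theta>) = add_mor K D D0 (q \<cdot> z) (q \<cdot> v)"
        unfolding e using bm(1-4) c(1) z v \<phi> by (simp add: cat_simps distrib_simps)
      also have "\<dots> = q" unfolding z_def using bm(4) v by (simp add: add_simps)
      finally have "\<phi> \<cdot> \<theta> = Id K D"
        using biproduct_id_criterion[OF b comp_mor[OF \<theta> \<phi>] 1] by blast
      then show ?thesis using \<theta> by blast
    next
      fix l s assume l: "l \<in> J - {k}" and s: "mor K s D0 (Y l)"
        "s \<cdot> (add_mor K D0 D0 (Id K D0) (neg_mor D0 D0 \<phi>') \<cdot> (q \<cdot> i l)) = Id K (Y l)"
      have il: "mor K (i l) (Y l) D" using ip l by blast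
      \<comment> \<open>1 - \<phi>' = u (1 - \<phi>) j because u j = 1, so prefixing the row
        operation u carries an invertible entry of 1 - \<phi>' back to 1 - \<phi>.\<close>
      have "add_mor K D0 D0 (Id K D0) (neg_mor D0 D0 \<phi>') = u \<cdot> (\<psi> \<cdot> j)"
        unfolding \<psi>_def \<phi>'_def using u \<phi> bm(2) D uj by (simp add: cat_simps distrib_simps)
      moreover have "j \<cdot> (q \<cdot> i l) = i l"
      proof -
        have "p k \<cdot> i l = zero_mor K (Y l) (Y k)" using pi[of l k] l k by auto
        then have "i k \<cdot> (p k \<cdot> i l) = zero_mor K (Y l) D" using bm(1) il by (simp add: cat_simps)
        moreover have "add_mor K D D (i k \<cdot> p k) (j \<cdot> q) \<cdot> i l = i l" using bm(9) il comp_id_left by simp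
        ultimately show ?thesis using bm(1-4) il by (simp add: cat_simps distrib_simps group_simps)
      qed
      ultimately have "(s \<cdot> u) \<cdot> (\<psi> \<cdot> i l) = Id K (Y l)"
        using s u \<psi> il bm(1-4) by (simp add: cat_simps)
      then show ?thesis unfolding \<psi>_def using l comp_mor[OF u s(1)] by blast
    qed
  qed
qed

text \<open>Induction on the number of local summands of D. If \<phi> g = g and \<phi> has no right
  inverse, some summand has a retraction r = s (1 - \<phi>), and r g = 0. So g takes values in the
  complement; there it is still an inflation by WIC, and still an approximation.\<close>

lemma ex_minimal_left_approximation:
  assumes sub: "subcategory K \<D>"
    and "e_triangle K Y D V g v \<rho>" "left_approximation K \<D> g Y D"
  shows "\<exists>D V g v \<rho>. e_triangle K Y D V g v \<rho> \<and> left_approximation K \<D> g Y D \<and>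
    (\<forall>\<phi>. mor K \<phi> D D \<and> \<phi> \<cdot> g = g \<longrightarrow> (\<exists>\<theta>. mor K \<theta> D D \<and> \<phi> \<cdot> \<theta> = Id K D))"
proof -
  have "D \<in> Ob K" using e_triangleD(5)[OF assms(2)] .
  then obtain J T i p where "local_decomposition K J D T i p" using ex_local_decomposition by blast
  then show ?thesis using assms(2,3)
  proof (induction "card J" arbitrary: J D V g v \<rho> i p rule: less_induct)
    case less
    note t = less.prems(2) and app = less.prems(3)
    note m = e_triangleD[OF t]
    show ?case
    proof (cases "\<forall>\<phi>. mor K \<phi> D D \<and> \<phi> \<cdot> g = g \<longrightarrow> (\<exists>\<theta>. mor K \<theta> D D \<and> \<phi> \<cdot> \<theta> = Id K D)")
      case True
      then show ?thesis using t app by blast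
    next
      case False
      then obtain \<phi> where \<phi>: "mor K \<phi> D D" "\<phi> \<cdot> g = g" "\<nexists>\<theta>. mor K \<theta> D D \<and> \<phi> \<cdot> \<theta> = Id K D" by blast
      define \<psi> where "\<psi> = add_mor K D D (Id K D) (neg_mor D D \<phi>)"
      have \<psi>: "mor K \<psi> D D" "\<psi> \<cdot> g = zero_mor K Y D"
        unfolding \<psi>_def using \<phi> m by (simp_all add: add_simps)
      obtain k s where k: "k \<in> J" and s: "mor K s D (T k)" "s \<cdot> (\<psi> \<cdot> i k) = Id K (T k)"
        using right_inverse_or_local_summand[OF less.prems(1) \<phi>(1)] \<phi>(3) unfolding \<psi>_def by blast
      have ik: "mor K (i k) (T k) D" and J: "finite J"
        using less.prems(1) k by (auto simp: local_decomposition_def)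
      define r where "r = s \<cdot> \<psi>"
      have r: "mor K r D (T k)" "r \<cdot> i k = Id K (T k)"
        unfolding r_def using s \<psi>(1) ik comp_mor comp_assoc[OF ik \<psi>(1) s(1)] by auto
      have Tk: "T k \<in> Ob K" using r by (simp add: mor_iff)
      have rg: "r \<cdot> g = zero_mor K Y (T k)"
        unfolding r_def using comp_assoc[OF m(1) \<psi>(1) s(1)] \<psi>(2) comp_zero_right[OF s(1) m(4)] by simp
      obtain D0 j q where b: "biproduct K (T k) D0 D (i k) j r q"
        and d0: "local_decomposition K (J - {k}) D0 T (\<lambda>l. q \<cdot> i l) (\<lambda>l. p l \<cdot> j)"
        using decomposition_complement[OF less.prems(1) k r] by blast
      note bm = biproductD[OF b]
      have qg: "mor K (q \<cdot> g) Y D0" using comp_mor[OF m(1) bm(4)] .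
      have "g = add_mor K D D (i k \<cdot> r) (j \<cdot> q) \<cdot> g" using bm(9) comp_id_left[OF m(1)] by simp
      also have "\<dots> = add_mor K Y D (i k \<cdot> (r \<cdot> g)) (j \<cdot> (q \<cdot> g))"
        using bm(1-4) m by (simp add: cat_simps distrib_simps)
      also have "\<dots> = j \<cdot> (q \<cdot> g)"
        unfolding rg using bm(1-4) m by (simp add: cat_simps group_simps)
      finally have g: "j \<cdot> (q \<cdot> g) = g" by simp
      have "inflation K (j \<cdot> (q \<cdot> g))" unfolding g inflation_def using t by blast
      then have "inflation K (q \<cdot> g)" using WIC qg bm(2) unfolding WIC_def by blast
      then obtain A B V' v' \<rho>' where t': "e_triangle K A B V' (q \<cdot> g) v' \<rho>'" unfolding inflation_def by blast
      have "A = Y" "B = D0" using hom_disjoint[OF e_triangleD(1)[OF t'] qg] by auto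
      note t' = t'[unfolded this]
      have "left_approximation K \<D> (q \<cdot> g) Y D0"
        unfolding left_approximation_def
      proof (intro conjI ballI allI impI)
        have "D \<in> \<D>" using app by (simp add: left_approximation_def)
        then show "D0 \<in> \<D>" using sub biproduct_swap[OF b] unfolding subcategory_def by blast
        show "mor K (q \<cdot> g) Y D0" by fact
        fix D' f assume "D' \<in> \<D>" "mor K f Y D'"
        then obtain h where h: "mor K h D D'" "h \<cdot> g = f" using app unfolding left_approximation_def by blast
        have "(h \<cdot> j) \<cdot> (q \<cdot> g) = f" using comp_assoc[OF qg bm(2) h(1)] g h(2) by simp
        then show "\<exists>h. mor K h D0 D' \<and> h \<cdot> (q \<cdot> g) = f" using comp_mor[OF bm(2) h(1)] by blast
      qed
      moreover have "card (J - {k}) < card J" by (rule card_Diff1_less[OF J k])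
      ultimately show ?thesis using less.hyps[OF _ d0 t'] by blast
    qed
  qed
qed

end

section \<open>Vanishing of extensions\<close>

text \<open>Vacuously true when C or A is not an object, which spares the rules below many typing
  hypotheses.\<close>

definition ext_trivial :: "('o, 'm, 'e, 'z) ext_category_scheme \<Rightarrow> 'o \<Rightarrow> 'o \<Rightarrow> bool" where
  "ext_trivial K C A \<longleftrightarrow> (\<forall>\<delta>. extension K \<delta> C A \<longrightarrow> \<delta> = \<one>\<^bsub>Ext K C A\<^esub>)"

text \<open>The n-th syzygy computes extensions of degree n + 1, so starting at n = 0 covers all
  positive degrees.\<close>

definition ext_orthogonal :: "('o, 'm, 'e, 'z) ext_category_scheme \<Rightarrow> 'o \<Rightarrow> 'o \<Rightarrow> bool" where
  "ext_orthogonal K X Y \<longleftrightarrow> (\<forall>n. ext_trivial K ((syzygy K ^^ n) X) Y)"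

lemma ext_trivial_opposite [simp]: "ext_trivial (opposite K) C A \<longleftrightarrow> ext_trivial K A C"
  by (simp add: ext_trivial_def)

lemma ext_orthogonal_trivial: "ext_orthogonal K X Y \<Longrightarrow> ext_trivial K X Y"
  unfolding ext_orthogonal_def by (metis funpow_0)

context extriangulated_category
begin

lemma ext_trivial_iff:
  "C \<in> Ob K \<Longrightarrow> A \<in> Ob K \<Longrightarrow> ext_trivial K C A \<longleftrightarrow> carrier (Ext K C A) = {\<one>\<^bsub>Ext K C A\<^esub>}"
  using extension_zero[of C A] by (auto simp: ext_trivial_def extension_def)

lemma ext_trivial_split:
  assumes "e_triangle K A S C x y \<delta>" "ext_trivial K C A"
  shows "\<exists>j p. biproduct K A C S x j p y"
  using triangle_split[of A S C x y] e_triangleD[OF assms(1)] assms by (auto simp: ext_trivial_def)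

lemma ext_trivial_middle:
  assumes t: "e_triangle_objs K A B C" and v: "ext_trivial K X A" "ext_trivial K X C"
  shows "ext_trivial K X B"
  unfolding ext_trivial_def
proof (intro allI impI)
  fix \<beta> assume \<beta>: "extension K \<beta> X B"
  obtain x y \<delta> where t: "e_triangle K A B C x y \<delta>" using t by (auto simp: e_triangle_objs_def)
  note m = e_triangleD[OF t]
  obtain \<alpha> where \<alpha>: "extension K \<alpha> X A" "\<beta> = Push K x \<alpha>"
    using triangle_push_exact[OF t \<beta>] extension_push[OF \<beta> m(2)] v(2) by (auto simp: ext_trivial_def)
  then show "\<beta> = \<one>\<^bsub>Ext K X B\<^esub>"
    using v(1) push_zero[OF _ m(1)] extension_obD[OF \<beta>] by (auto simp: ext_trivial_def)
qed

text \<open>With M as syzygy of X, this is exactness of Ext(X, B) -> Ext(X, C) -> Ext(M, A), the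
  last group being the second extensions of X by A. A class \<gamma> dies on P, hence comes from
  some h on M; the obstruction to lifting h to B lies in Ext(M, A).\<close>

lemma ext_trivial_cone:
  assumes s: "e_triangle_objs K M P X" and t: "e_triangle_objs K A B C"
    and v: "ext_trivial K P C" "ext_trivial K X B" "ext_trivial K M A"
  shows "ext_trivial K X C"
  unfolding ext_trivial_def
proof (intro allI impI)
  fix \<gamma> assume \<gamma>: "extension K \<gamma> X C"
  obtain x y \<delta> where t: "e_triangle K A B C x y \<delta>" using t by (auto simp: e_triangle_objs_def)
  obtain k n \<epsilon> where s: "e_triangle K M P X k n \<epsilon>" using s by (auto simp: e_triangle_objs_def)
  note m = e_triangleD[OF t] and m' = e_triangleD[OF s]
  obtain h where h: "mor K h M C" "\<gamma> = Push K h \<epsilon>"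
    using triangle_pull_kernel[OF s \<gamma>] extension_pull[OF \<gamma> m'(2)] v(1) by (auto simp: ext_trivial_def)
  obtain g where g: "mor K g M B" "y \<cdot> g = h"
    using triangle_lift[OF t h(1)] extension_pull[OF m(3) h(1)] v(3) by (auto simp: ext_trivial_def)
  have "\<gamma> = Push K y (Push K g \<epsilon>)" using push_comp[OF m'(3) g(1) m(2)] g h by simp
  also have "Push K g \<epsilon> = \<one>\<^bsub>Ext K X B\<^esub>"
    using extension_push[OF m'(3) g(1)] v(2) by (simp add: ext_trivial_def)
  finally show "\<gamma> = \<one>\<^bsub>Ext K X C\<^esub>" using push_zero[OF m'(6) m(2)] by simp
qed

text \<open>The next piece of the same sequence, Ext(X, C) -> Ext(M, A) -> Ext(M, B). A class
  \<alpha> comes from some h on M; h extends over P when Ext(X, C) vanishes, so \<alpha> comes from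
  Ext(P, A).\<close>

lemma ext_trivial_cocone:
  assumes s: "e_triangle_objs K M P X" and t: "e_triangle_objs K A B C"
    and v: "ext_trivial K P A" "ext_trivial K X C" "ext_trivial K M B"
  shows "ext_trivial K M A"
  unfolding ext_trivial_def
proof (intro allI impI)
  fix \<alpha> assume \<alpha>: "extension K \<alpha> M A"
  obtain x y \<delta> where t: "e_triangle K A B C x y \<delta>" using t by (auto simp: e_triangle_objs_def)
  obtain k n \<epsilon> where s: "e_triangle K M P X k n \<epsilon>" using s by (auto simp: e_triangle_objs_def)
  note m = e_triangleD[OF t] and m' = e_triangleD[OF s]
  obtain h where h: "mor K h M C" "\<alpha> = Pull K h \<delta>"
    using triangle_push_kernel[OF t \<alpha>] extension_push[OF \<alpha> m(1)] v(3) by (auto simp: ext_trivial_def)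
  obtain g where g: "mor K g P C" "g \<cdot> k = h"
    using triangle_extend[OF s h(1)] extension_push[OF m'(3) h(1)] v(2) by (auto simp: ext_trivial_def)
  have "\<alpha> = Pull K k (Pull K g \<delta>)" using pull_comp[OF m(3) g(1) m'(1)] g h by simp
  also have "Pull K g \<delta> = \<one>\<^bsub>Ext K P A\<^esub>"
    using extension_pull[OF m(3) g(1)] v(1) by (simp add: ext_trivial_def)
  finally show "\<alpha> = \<one>\<^bsub>Ext K M A\<^esub>" using pull_zero[OF m(4) m'(1)] by simp
qed

lemma ext_trivial_retract:
  assumes v: "ext_trivial K X S" and s: "mor K s A S" and r: "mor K r S A" "r \<cdot> s = Id K A"
  shows "ext_trivial K X A"
  unfolding ext_trivial_def
proof (intro allI impI)
  fix \<alpha> assume \<alpha>: "extension K \<alpha> X A"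
  have "\<alpha> = Push K r (Push K s \<alpha>)" using push_comp[OF \<alpha> s r(1)] r(2) push_id[OF \<alpha>] by simp
  also have "Push K s \<alpha> = \<one>\<^bsub>Ext K X S\<^esub>"
    using extension_push[OF \<alpha> s] v by (simp add: ext_trivial_def)
  finally show "\<alpha> = \<one>\<^bsub>Ext K X A\<^esub>" using push_zero[OF _ r(1)] extension_obD[OF \<alpha>] by simp
qed

lemma ext_trivial_zero_object:
  assumes "zero_object K Z" shows "ext_trivial K X Z"
  unfolding ext_trivial_def
proof (intro allI impI)
  fix \<delta> assume d: "extension K \<delta> X Z"
  have "\<delta> = Push K (zero_mor K Z Z) \<delta>" using push_id[OF d] assms by (simp add: zero_object_def)
  then show "\<delta> = \<one>\<^bsub>Ext K X Z\<^esub>" using push_zero_mor[OF d] assms by (simp add: zero_object_def)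
qed

lemma ext_trivial_projective:
  assumes P: "projective_in K (Ob K) P" shows "ext_trivial K P Y"
  unfolding ext_trivial_def
proof (intro allI impI)
  fix \<delta> assume d: "extension K \<delta> P Y"
  then obtain B x y where t: "e_triangle K Y B P x y \<delta>" using ex_triangle by blast
  note m = e_triangleD[OF t]
  obtain g where g: "mor K g P B" "y \<cdot> g = Id K P"
    using P id_mor[OF m(6)] m t unfolding projective_in_def by blast
  have "\<delta> = Pull K g (Pull K y \<delta>)" using pull_comp[OF d m(2) g(1)] g pull_id[OF d] by simp
  then show "\<delta> = \<one>\<^bsub>Ext K P Y\<^esub>" using triangle_pull_zero[OF t] pull_zero[OF m(4) g(1)] by simp
qed

end

context ks_extriangulated
begin

section \<open>Dimension shifting by syzygies and cosyzygies\<close>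

lemma syzygy_triangle:
  assumes "X \<in> Ob K" shows "\<exists>P. projective_in K (Ob K) P \<and> e_triangle_objs K (syzygy K X) P X"
  unfolding syzygy_def
  by (rule someI_ex) (use enough_projectives assms in \<open>auto simp: enough_projectives_def\<close>)

lemma syzygy_power_ob: "X \<in> Ob K \<Longrightarrow> (syzygy K ^^ n) X \<in> Ob K"
proof (induction n)
  case (Suc n)
  then show ?case
    using syzygy_triangle[of "(syzygy K ^^ n) X"] e_triangleD(4) by (auto simp: e_triangle_objs_def)
qed simp

lemma cosyzygy_triangle:
  "Y \<in> Ob K \<Longrightarrow> \<exists>I. injective_in K (Ob K) I \<and> e_triangle_objs K Y I (syzygy (opposite K) Y)"
  using ks_extriangulated.syzygy_triangle[OF ks_opposite, of Y] by simp

lemma ext_trivial_injective: "injective_in K (Ob K) I \<Longrightarrow> ext_trivial K X I"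
  using extriangulated_category.ext_trivial_projective[OF opposite, of I X] by simp

text \<open>Both sides say that the second extensions of X by Y vanish, computed in either variable;
  a syzygy in the opposite category is a cosyzygy.\<close>

lemma ext_trivial_syzygy_iff:
  assumes "X \<in> Ob K" "Y \<in> Ob K"
  shows "ext_trivial K (syzygy K X) Y \<longleftrightarrow> ext_trivial K X (syzygy (opposite K) Y)"
proof -
  obtain P where P: "projective_in K (Ob K) P" "e_triangle_objs K (syzygy K X) P X"
    using syzygy_triangle assms by blast
  obtain I where I: "injective_in K (Ob K) I" "e_triangle_objs K Y I (syzygy (opposite K) Y)"
    using cosyzygy_triangle assms by blast
  show ?thesis
    using ext_trivial_cone[OF P(2) I(2)] ext_trivial_cocone[OF P(2) I(2)]
      ext_trivial_projective[OF P(1)] ext_trivial_injective[OF I(1)] by blast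
qed

lemma ext_trivial_syzygy_power_iff:
  "X \<in> Ob K \<Longrightarrow> Y \<in> Ob K \<Longrightarrow>
    ext_trivial K ((syzygy K ^^ n) X) Y \<longleftrightarrow> ext_trivial K X ((syzygy (opposite K) ^^ n) Y)"
proof (induction n arbitrary: X)
  case (Suc n)
  have "syzygy K X \<in> Ob K" using syzygy_power_ob[OF Suc.prems(1), of 1] by simp
  moreover have "(syzygy (opposite K) ^^ n) Y \<in> Ob K"
    using ks_extriangulated.syzygy_power_ob[OF ks_opposite, of Y n] Suc.prems(2) by simp
  ultimately show ?case
    \<comment> \<open>The outer n syzygies cross over by induction at \<open>syzygy K X\<close>; the
      innermost one crosses last.\<close>
    using Suc.IH[of "syzygy K X"] Suc.prems ext_trivial_syzygy_iff by (simp add: funpow_swap1)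
qed simp

lemma ext_orthogonal_opposite:
  "X \<in> Ob K \<Longrightarrow> Y \<in> Ob K \<Longrightarrow> ext_orthogonal (opposite K) Y X \<longleftrightarrow> ext_orthogonal K X Y"
  by (simp add: ext_orthogonal_def ext_trivial_syzygy_power_iff)

lemma ext_orthogonal_middle:
  "e_triangle_objs K A B C \<Longrightarrow> ext_orthogonal K X A \<Longrightarrow> ext_orthogonal K X C \<Longrightarrow> ext_orthogonal K X B"
  unfolding ext_orthogonal_def using ext_trivial_middle by blast

text \<open>Vanishing for C in one degree uses A in the next degree and B in the same one, so
  orthogonality in all degrees is what makes this work.\<close>

lemma ext_orthogonal_cone:
  assumes "X \<in> Ob K" "e_triangle_objs K A B C" "ext_orthogonal K X A" "ext_orthogonal K X B"
  shows "ext_orthogonal K X C"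
  unfolding ext_orthogonal_def
proof
  fix n
  obtain P where P: "projective_in K (Ob K) P" "e_triangle_objs K (syzygy K ((syzygy K ^^ n) X)) P ((syzygy K ^^ n) X)"
    using syzygy_triangle syzygy_power_ob assms(1) by blast
  have "ext_trivial K ((syzygy K ^^ n) X) B" "ext_trivial K ((syzygy K ^^ Suc n) X) A"
    using assms(3,4) unfolding ext_orthogonal_def by blast+
  then show "ext_trivial K ((syzygy K ^^ n) X) C"
    using ext_trivial_cone[OF P(2) assms(2)] ext_trivial_projective[OF P(1)] by simp
qed

lemma ext_orthogonal_retract:
  "ext_orthogonal K X S \<Longrightarrow> mor K s A S \<Longrightarrow> mor K r S A \<Longrightarrow> r \<cdot> s = Id K A \<Longrightarrow> ext_orthogonal K X A"
  unfolding ext_orthogonal_def using ext_trivial_retract by blast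

lemma ext_orthogonal_zero_object: "zero_object K Z \<Longrightarrow> ext_orthogonal K X Z"
  unfolding ext_orthogonal_def using ext_trivial_zero_object by blast

section \<open>Orthogonal classes and their duality\<close>

lemma right_perp_iff:
  assumes "\<omega> \<subseteq> Ob K"
  shows "Y \<in> right_perp K \<omega> \<longleftrightarrow> Y \<in> Ob K \<and> (\<forall>X\<in>\<omega>. ext_orthogonal K X Y)"
proof -
  have "(\<forall>i\<ge>1. carrier (higher_ext K i X Y) = {\<one>\<^bsub>higher_ext K i X Y\<^esub>}) \<longleftrightarrow> ext_orthogonal K X Y"
    if "X \<in> Ob K" "Y \<in> Ob K" for X
    using that syzygy_power_ob ext_trivial_iff unfolding ext_orthogonal_def higher_ext_def
    by (metis One_nat_def diff_Suc_1 le_add1 plus_1_eq_Suc)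
  then show ?thesis using assms unfolding right_perp_def by blast
qed

lemma left_perp_iff:
  assumes "\<omega> \<subseteq> Ob K"
  shows "Y \<in> left_perp K \<omega> \<longleftrightarrow> Y \<in> Ob K \<and> (\<forall>X\<in>\<omega>. ext_orthogonal K Y X)"
proof -
  have "(\<forall>i\<ge>1. carrier (higher_ext K i Y X) = {\<one>\<^bsub>higher_ext K i Y X\<^esub>}) \<longleftrightarrow> ext_orthogonal K Y X"
    if "X \<in> Ob K" "Y \<in> Ob K" for X
    using that syzygy_power_ob ext_trivial_iff unfolding ext_orthogonal_def higher_ext_def
    by (metis One_nat_def diff_Suc_1 le_add1 plus_1_eq_Suc)
  then show ?thesis using assms unfolding left_perp_def by blast
qed

lemma left_perp_opposite: "\<omega> \<subseteq> Ob K \<Longrightarrow> left_perp (opposite K) \<omega> = right_perp K \<omega>"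
  using ks_extriangulated.left_perp_iff[OF ks_opposite, of \<omega>] right_perp_iff[of \<omega>]
    ext_orthogonal_opposite by (auto simp: subset_iff)

lemma right_perp_opposite: "\<omega> \<subseteq> Ob K \<Longrightarrow> right_perp (opposite K) \<omega> = left_perp K \<omega>"
  using ks_extriangulated.right_perp_iff[OF ks_opposite, of \<omega>] left_perp_iff[of \<omega>]
    ext_orthogonal_opposite by (auto simp: subset_iff)

text \<open>Pull \<epsilon> back along v to an extension M of D by D'. Since v g = 0, g lifts to M,
  and as M is in \<D> the lift factors as l g. Then n l fixes g, so it has a right inverse, and M
  splits. Hence \<epsilon> is pushed out of \<rho> along a map Y -> D', which factors through g, and
  g annihilates \<rho>.\<close>

lemma wakamatsu:
  assumes t: "e_triangle K Y D V g v \<rho>" and app: "left_approximation K \<D> g Y D"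
    and min: "\<And>\<phi>. mor K \<phi> D D \<Longrightarrow> \<phi> \<cdot> g = g \<Longrightarrow> \<exists>\<theta>. mor K \<theta> D D \<and> \<phi> \<cdot> \<theta> = Id K D"
    and closed: "\<And>M. e_triangle_objs K D' M D \<Longrightarrow> M \<in> \<D>" and D': "D' \<in> \<D>"
  shows "ext_trivial K V D'"
  unfolding ext_trivial_def
proof (intro allI impI)
  fix \<epsilon> assume \<epsilon>: "extension K \<epsilon> V D'"
  note m = e_triangleD[OF t]
  let ?e = "Pull K v \<epsilon>"
  have e: "extension K ?e D D'" using extension_pull \<epsilon> m by blast
  have ob: "D' \<in> Ob K" using \<epsilon> by (simp add: extension_def)
  obtain M k n where s: "e_triangle K D' M D k n ?e" using ex_triangle[OF e] by blast
  note m' = e_triangleD[OF s]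
  have M: "M \<in> \<D>" using closed s by (auto simp: e_triangle_objs_def)
  have "Pull K g ?e = \<one>\<^bsub>Ext K Y D'\<^esub>"
    using pull_comp[OF \<epsilon> m(2,1)] triangle_comp_zero[OF t] pull_zero_mor[OF \<epsilon> m(4)] by simp
  then obtain h where h: "mor K h Y M" "n \<cdot> h = g" using triangle_lift[OF s m(1)] by blast
  obtain l where l: "mor K l D M" "l \<cdot> g = h" using app M h(1) unfolding left_approximation_def by blast
  have "(n \<cdot> l) \<cdot> g = g" using comp_assoc[OF m(1) l(1) m'(2)] l h by simp
  then obtain \<theta> where \<theta>: "mor K \<theta> D D" "(n \<cdot> l) \<cdot> \<theta> = Id K D"
    using min comp_mor[OF l(1) m'(2)] by blast
  have "?e = Pull K \<theta> (Pull K l (Pull K n ?e))"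
    using \<theta> pull_comp[OF e comp_mor[OF l(1) m'(2)] \<theta>(1)] pull_comp[OF e m'(2) l(1)] pull_id[OF e] by simp
  then have "?e = \<one>\<^bsub>Ext K D D'\<^esub>"
    using triangle_pull_zero[OF s] pull_zero[OF ob] l(1) \<theta>(1) by simp
  then obtain a where a: "mor K a Y D'" "\<epsilon> = Push K a \<rho>" using triangle_pull_kernel[OF t \<epsilon>] by blast
  obtain b where b: "mor K b D D'" "b \<cdot> g = a" using app D' a(1) unfolding left_approximation_def by blast
  have "\<epsilon> = Push K b (Push K g \<rho>)" using a b push_comp[OF m(3,1) b(1)] by simp
  then show "\<epsilon> = \<one>\<^bsub>Ext K V D'\<^esub>" using triangle_push_zero[OF t] push_zero[OF m(6) b(1)] by simp
qed

end

section \<open>Subcategories\<close>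

lemma left_approximation_opposite [simp]:
  "left_approximation (opposite K) \<D> g Y D \<longleftrightarrow> right_approximation K \<D> g D Y"
  "right_approximation (opposite K) \<D> g D Y \<longleftrightarrow> left_approximation K \<D> g Y D"
  by (simp_all add: left_approximation_def right_approximation_def)

context extriangulated_category
begin

lemma subcategory_opposite [simp]: "subcategory (opposite K) \<D> \<longleftrightarrow> subcategory K \<D>"
proof -
  have "(\<exists>f. isomorphism K f A B) \<longleftrightarrow> (\<exists>f. isomorphism K f B A)" for A B
    using isomorphismE by metis
  then show ?thesis unfolding subcategory_def by simp blast
qed

lemma strongly_finite_opposite [simp]:
  "strongly_contravariantly_finite (opposite K) \<D> \<Y> \<longleftrightarrow> strongly_covariantly_finite K \<D> \<Y>"
  "strongly_covariantly_finite (opposite K) \<D> \<Y> \<longleftrightarrow> strongly_contravariantly_finite K \<D> \<Y>"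
  unfolding strongly_contravariantly_finite_def strongly_covariantly_finite_def by simp_all blast+

lemma relative_resolving_opposite [simp]:
  "relative_resolving (opposite K) \<D> \<Y> \<longleftrightarrow> relative_coresolving K \<D> \<Y>"
  "relative_coresolving (opposite K) \<D> \<Y> \<longleftrightarrow> relative_resolving K \<D> \<Y>"
  unfolding relative_resolving_def relative_coresolving_def by simp_all blast+

lemma relative_coresolvingD:
  assumes "relative_coresolving K \<D> \<Y>"
  shows "subcategory K \<D>" "\<D> \<subseteq> \<Y>"
    "\<And>A B C. e_triangle_objs K A B C \<Longrightarrow> A \<in> \<D> \<Longrightarrow> B \<in> \<Y> \<Longrightarrow> C \<in> \<D> \<Longrightarrow> B \<in> \<D>"
    "\<And>A B C. e_triangle_objs K A B C \<Longrightarrow> A \<in> \<D> \<Longrightarrow> B \<in> \<D> \<Longrightarrow> C \<in> \<Y> \<Longrightarrow> C \<in> \<D>"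
    "\<And>I. injective_in K \<Y> I \<Longrightarrow> I \<in> \<D>"
proof -
  note c = assms[unfolded relative_coresolving_def]
  note c' = c[THEN conjunct2, THEN conjunct2]
  show "subcategory K \<D>" "\<D> \<subseteq> \<Y>" using c[THEN conjunct1] c[THEN conjunct2, THEN conjunct1] by simp_all
  show "B \<in> \<D>" if "e_triangle_objs K A B C" "A \<in> \<D>" "B \<in> \<Y>" "C \<in> \<D>" for A B C
    using c'[THEN conjunct1, rule_format, of A B C] that by simp
  show "C \<in> \<D>" if "e_triangle_objs K A B C" "A \<in> \<D>" "B \<in> \<D>" "C \<in> \<Y>" for A B C
    using c'[THEN conjunct2, THEN conjunct1, rule_format, of A B C] that by simp
  show "I \<in> \<D>" if "injective_in K \<Y> I" for I
    using c'[THEN conjunct2, THEN conjunct2, rule_format, OF that] .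
qed

lemma triangle_objs_pushout:
  assumes "e_triangle_objs K A B1 C1" "e_triangle_objs K A B2 C2"
  shows "\<exists>M. e_triangle_objs K B2 M C1 \<and> e_triangle_objs K B1 M C2"
proof -
  obtain x1 y1 \<delta>1 x2 y2 \<delta>2 where "e_triangle K A B1 C1 x1 y1 \<delta>1" "e_triangle K A B2 C2 x2 y2 \<delta>2"
    using assms by (auto simp: e_triangle_objs_def)
  from triangle_pushout[OF this] show ?thesis unfolding e_triangle_objs_def by blast
qed

text \<open>Closure under retracts covers isomorphic copies and direct summands at once.\<close>

lemma subcategoryI:
  assumes "\<D> \<subseteq> Ob K" "Z \<in> \<D>" "zero_object K Z"
    and sum: "\<And>A B S i j p q. biproduct K A B S i j p q \<Longrightarrow> A \<in> \<D> \<Longrightarrow> B \<in> \<D> \<Longrightarrow> S \<in> \<D>"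
    and retract: "\<And>A S s r. S \<in> \<D> \<Longrightarrow> mor K s A S \<Longrightarrow> mor K r S A \<Longrightarrow> r \<cdot> s = Id K A \<Longrightarrow> A \<in> \<D>"
  shows "subcategory K \<D>"
  unfolding subcategory_def
proof (intro conjI allI impI; (elim conjE)?)
  show "B \<in> \<D>" if "isomorphism K f A B" "A \<in> \<D>" for A B f
    using that retract by (blast elim: isomorphismE)
  show "A \<in> \<D>" if "biproduct K A B S i j p q" "S \<in> \<D>" for A B S i j p q
    using biproductD(1,3,5)[OF that(1)] that(2) retract by blast
qed (use assms in blast)+

lemma subcategory_ob: "subcategory K \<D> \<Longrightarrow> \<D> \<subseteq> Ob K"
  by (simp add: subcategory_def)

lemma subcategory_biproduct:
  "subcategory K \<D> \<Longrightarrow> biproduct K A B S i j p q \<Longrightarrow> A \<in> \<D> \<Longrightarrow> B \<in> \<D> \<Longrightarrow> S \<in> \<D>"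
  unfolding subcategory_def by blast

lemma subcategory_summand:
  "subcategory K \<D> \<Longrightarrow> biproduct K A B S i j p q \<Longrightarrow> S \<in> \<D> \<Longrightarrow> A \<in> \<D>"
  unfolding subcategory_def by blast

lemma subcategory_summand':
  "subcategory K \<D> \<Longrightarrow> biproduct K A B S i j p q \<Longrightarrow> S \<in> \<D> \<Longrightarrow> B \<in> \<D>"
  using biproduct_swap subcategory_summand by blast

lemma subcategory_zero: "subcategory K \<D> \<Longrightarrow> zero_object K Z \<Longrightarrow> Z \<in> \<D>"
  unfolding subcategory_def using zero_objects_isomorphic by blast

end

text \<open>A subcategory is closed under summands of biproducts; retracts are such summands thanks
  to WIC.\<close>

lemma (in ks_extriangulated) subcategory_retract:
  "subcategory K \<D> \<Longrightarrow> S \<in> \<D> \<Longrightarrow> mor K s A S \<Longrightarrow> mor K r S A \<Longrightarrow> r \<cdot> s = Id K A \<Longrightarrow> A \<in> \<D>"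
  using retract_biproduct subcategory_summand by blast

section \<open>Classes with a projective generator and an injective cogenerator\<close>

text \<open>The assumptions are symmetric: passing to the opposite category exchanges \<P> and \<I>
  and preserves all of them.\<close>

locale generated_class = ks_extriangulated K
  for K :: "('o, 'm, 'e, 'z) ext_category_scheme" (structure) +
  fixes \<X> \<P> \<I> :: "'o set"
  assumes subcategory_class: "subcategory K \<X>"
    and extension_closed: "e_triangle_objs K A B C \<Longrightarrow> A \<in> \<X> \<Longrightarrow> C \<in> \<X> \<Longrightarrow> B \<in> \<X>"
    and generator: "subcategory K \<P>" "\<P> \<subseteq> \<X>" "Q \<in> \<P> \<Longrightarrow> Y \<in> \<X> \<Longrightarrow> ext_orthogonal K Q Y"
      "Y \<in> \<X> \<Longrightarrow> \<exists>Q\<in>\<P>. \<exists>Y'\<in>\<X>. e_triangle_objs K Y' Q Y"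
    and cogenerator: "subcategory K \<I>" "\<I> \<subseteq> \<X>" "J \<in> \<I> \<Longrightarrow> Y \<in> \<X> \<Longrightarrow> ext_orthogonal K Y J"
      "Y \<in> \<X> \<Longrightarrow> \<exists>J\<in>\<I>. \<exists>Y'\<in>\<X>. e_triangle_objs K Y J Y'"
begin

lemma class_ob: "Y \<in> \<X> \<Longrightarrow> Y \<in> Ob K"
  using subcategory_ob[OF subcategory_class] by blast

lemma generated_opposite: "generated_class (opposite K) \<X> \<I> \<P>"
proof (rule generated_class.intro[OF ks_opposite], rule generated_class_axioms.intro)
  show "ext_orthogonal (opposite K) Q Y" if "Q \<in> \<I>" "Y \<in> \<X>" for Q Y
    using cogenerator(2,3) that class_ob ext_orthogonal_opposite by blast
  show "ext_orthogonal (opposite K) Y J" if "J \<in> \<P>" "Y \<in> \<X>" for J Y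
    using generator(2,3) that class_ob ext_orthogonal_opposite by blast
qed (use subcategory_class extension_closed generator cogenerator in auto)

lemma cogenerator_injective:
  assumes "J \<in> \<I>" shows "injective_in K \<X> J"
  unfolding injective_in_def
proof (intro conjI allI impI; (elim conjE)?)
  show "J \<in> \<X>" using assms cogenerator by blast
  fix A B C x y \<delta> f
  assume C: "C \<in> \<X>" and t: "e_triangle K A B C x y \<delta>" and f: "mor K f A J"
  have "ext_trivial K C J" using ext_orthogonal_trivial[OF cogenerator(3)[OF assms C]] .
  then show "\<exists>g. mor K g B J \<and> g \<cdot> x = f"
    using triangle_extend[OF t f] extension_push[OF e_triangleD(3)[OF t] f] by (simp add: ext_trivial_def)
qed

text \<open>The cover of Q by the generator has a section, so Q is a retract of an object of
  \<P>.\<close>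

lemma projective_in_generator:
  assumes "projective_in K \<X> Q" shows "Q \<in> \<P>"
proof -
  have Q: "Q \<in> \<X>" using assms by (simp add: projective_in_def)
  obtain Q0 Y' x y \<delta> where Q0: "Q0 \<in> \<P>" and Y': "Y' \<in> \<X>" and t: "e_triangle K Y' Q0 Q x y \<delta>"
    using generator(4)[OF Q] by (auto simp: e_triangle_objs_def)
  note m = e_triangleD[OF t]
  obtain g where "mor K g Q Q0" "y \<cdot> g = Id K Q"
    using assms Q Q0 Y' t id_mor[OF m(6)] generator(2) unfolding projective_in_def by blast
  then show ?thesis using subcategory_retract[OF generator(1) Q0] m(2) by blast
qed

text \<open>Push A -> B -> Z out along A -> J -> A' with J in \<I>. The middle term M is an
  extension of A' by B, hence in \<X>; it is also an extension of Z by J, which splits, so Z is a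
  summand of M.\<close>

lemma cone_closed:
  assumes "e_triangle_objs K A B Z" "A \<in> \<X>" "B \<in> \<X>" "\<And>J. J \<in> \<I> \<Longrightarrow> ext_trivial K Z J"
  shows "Z \<in> \<X>"
proof -
  obtain J A' where J: "J \<in> \<I>" and A': "A' \<in> \<X>" "e_triangle_objs K A J A'"
    using cogenerator(4)[OF assms(2)] by blast
  obtain M where M: "e_triangle_objs K J M Z" "e_triangle_objs K B M A'"
    using triangle_objs_pushout[OF assms(1) A'(2)] by blast
  have "M \<in> \<X>" using extension_closed[OF M(2) assms(3) A'(1)] .
  moreover obtain m n \<epsilon> where "e_triangle K J M Z m n \<epsilon>"
    using M(1) by (auto simp: e_triangle_objs_def)
  note M = this
  ultimately show ?thesis
    using ext_trivial_split[OF M assms(4)[OF J]] subcategory_summand'[OF subcategory_class] by blast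
qed

text \<open>For D' -> J -> D'' with J in \<I>, extensions of V by D' in degree n + 1 vanish once
  those by D'' vanish in degree n, because V is orthogonal to J. Coresolving classes contain J and
  hence D'', so the induction stays inside \<D>.\<close>

lemma ext_orthogonal_coresolving:
  assumes D: "relative_coresolving K \<D> \<X>" and V: "V \<in> \<X>" and v: "\<And>D. D \<in> \<D> \<Longrightarrow> ext_trivial K V D"
    and D': "D' \<in> \<D>"
  shows "ext_orthogonal K V D'"
proof -
  have "ext_trivial K ((syzygy K ^^ n) V) D'" if "D' \<in> \<D>" for n D'
    using that
  proof (induction n arbitrary: D')
    case (Suc n)
    have "D' \<in> \<X>" using relative_coresolvingD(2)[OF D] Suc.prems by blast
    then obtain J D'' where J: "J \<in> \<I>" and D'': "D'' \<in> \<X>" "e_triangle_objs K D' J D''"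
      using cogenerator(4) by blast
    have "J \<in> \<D>" using relative_coresolvingD(5)[OF D cogenerator_injective[OF J]] .
    then have "D'' \<in> \<D>" using relative_coresolvingD(4)[OF D D''(2) Suc.prems] D''(1) by blast
    then have IH: "ext_trivial K ((syzygy K ^^ n) V) D''" using Suc.IH by blast
    obtain P where P: "projective_in K (Ob K) P" "e_triangle_objs K (syzygy K ((syzygy K ^^ n) V)) P ((syzygy K ^^ n) V)"
      using syzygy_triangle syzygy_power_ob class_ob[OF V] by blast
    have "ext_trivial K ((syzygy K ^^ Suc n) V) J"
      using cogenerator(3)[OF J V] unfolding ext_orthogonal_def by blast
    then show ?case
      using ext_trivial_cocone[OF P(2) D''(2) ext_trivial_projective[OF P(1)] IH] by simp
  qed (simp add: v)
  then show ?thesis using D' by (simp add: ext_orthogonal_def)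
qed

lemma special_left_approximation:
  assumes D: "relative_coresolving K \<D> \<X>" "strongly_covariantly_finite K \<D> \<X>" and Y: "Y \<in> \<X>"
  shows "\<exists>D\<in>\<D>. \<exists>V \<in> left_perp K \<D> \<inter> \<X>. e_triangle_objs K Y D V"
proof -
  note sub = relative_coresolvingD(1,2)[OF D(1)]
  obtain D V g v \<rho> where "e_triangle K Y D V g v \<rho>" "left_approximation K \<D> g Y D"
    using D(2) Y unfolding strongly_covariantly_finite_def by blast
  from ex_minimal_left_approximation[OF sub(1) this]
  obtain D V g v \<rho> where t: "e_triangle K Y D V g v \<rho>" and app: "left_approximation K \<D> g Y D"
    and min: "\<forall>\<phi>. mor K \<phi> D D \<and> \<phi> \<cdot> g = g \<longrightarrow> (\<exists>\<theta>. mor K \<theta> D D \<and> \<phi> \<cdot> \<theta> = Id K D)"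
    by blast
  have DD: "D \<in> \<D>" using app by (simp add: left_approximation_def)
  have v: "ext_trivial K V D'" if "D' \<in> \<D>" for D'
  proof (rule wakamatsu[OF t app _ _ that])
    fix M assume M: "e_triangle_objs K D' M D"
    \<comment> \<open>Relative extension closure of \<D> speaks only of middle terms in \<X>, so
      membership in \<X> comes first.\<close>
    then have "M \<in> \<X>" using extension_closed that DD sub(2) by blast
    then show "M \<in> \<D>" using relative_coresolvingD(3)[OF D(1) M that _ DD] by blast
  qed (use min in blast)
  \<comment> \<open>This turns the vanishing of Ext(V, \<D>) into the hypothesis of
    \<open>cone_closed\<close>.\<close>
  have "J \<in> \<D>" if "J \<in> \<I>" for J
    using relative_coresolvingD(5)[OF D(1) cogenerator_injective[OF that]] .
  then have V: "V \<in> \<X>"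
    using cone_closed[of Y D V] t Y DD sub(2) v by (auto simp: e_triangle_objs_def)
  have "\<D> \<subseteq> Ob K" using subcategory_ob sub by blast
  then have "V \<in> left_perp K \<D>"
    using left_perp_iff ext_orthogonal_coresolving[OF D(1) V v] class_ob[OF V] by blast
  moreover have "e_triangle_objs K Y D V" using t by (auto simp: e_triangle_objs_def)
  ultimately show ?thesis using V DD by blast
qed

lemma right_perp_left_perp:
  assumes D: "relative_coresolving K \<D> \<X>" "strongly_covariantly_finite K \<D> \<X>"
  shows "right_perp K (left_perp K \<D> \<inter> \<X>) \<inter> \<X> = \<D>"
proof -
  have sub: "subcategory K \<D>" "\<D> \<subseteq> \<X>" "\<D> \<subseteq> Ob K"
    using relative_coresolvingD(1,2)[OF D(1)] subcategory_ob[of \<D>] by auto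
  have ob: "left_perp K \<D> \<inter> \<X> \<subseteq> Ob K" using class_ob by blast
  show ?thesis
  proof (intro equalityI subsetI)
    fix Y assume Y: "Y \<in> right_perp K (left_perp K \<D> \<inter> \<X>) \<inter> \<X>"
    then obtain D V x y \<delta> where D: "D \<in> \<D>" "V \<in> left_perp K \<D> \<inter> \<X>" and t: "e_triangle K Y D V x y \<delta>"
      using special_left_approximation[OF D, of Y] by (auto simp: e_triangle_objs_def)
    have "ext_orthogonal K V Y" using Y D(2) right_perp_iff[OF ob] by blast
    then have "ext_trivial K V Y" by (rule ext_orthogonal_trivial)
    then show "Y \<in> \<D>" using ext_trivial_split[OF t] subcategory_summand[OF sub(1)] D(1) by blast
  next
    fix Y assume "Y \<in> \<D>"
    then show "Y \<in> right_perp K (left_perp K \<D> \<inter> \<X>) \<inter> \<X>"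
      using right_perp_iff[OF ob] left_perp_iff[OF sub(3)] sub by blast
  qed
qed

section \<open>The left orthogonal class of a coresolving class\<close>

lemma left_perp_closed:
  assumes "\<D> \<subseteq> Ob K"
  shows "e_triangle_objs K A B C \<Longrightarrow> A \<in> left_perp K \<D> \<Longrightarrow> C \<in> left_perp K \<D> \<Longrightarrow> B \<in> left_perp K \<D>"
    "e_triangle_objs K A B C \<Longrightarrow> B \<in> left_perp K \<D> \<Longrightarrow> C \<in> left_perp K \<D> \<Longrightarrow> A \<in> left_perp K \<D>"
proof -
  assume t: "e_triangle_objs K A B C"
  then have ob: "A \<in> Ob K" "B \<in> Ob K" "C \<in> Ob K" using e_triangleD(4-6) by (auto simp: e_triangle_objs_def)
  have iff: "ext_orthogonal (opposite K) Y X \<longleftrightarrow> ext_orthogonal K X Y" if "X \<in> {A, B, C}" "Y \<in> \<D>" for X Y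
    using ext_orthogonal_opposite[of X Y] ob that assms by auto
  have t': "e_triangle_objs (opposite K) C B A" using t by simp
  show "B \<in> left_perp K \<D>" if AC: "A \<in> left_perp K \<D>" "C \<in> left_perp K \<D>"
  proof -
    have "ext_orthogonal K B Y" if Y: "Y \<in> \<D>" for Y
      using ks_extriangulated.ext_orthogonal_middle[OF ks_opposite t', of Y] iff Y AC left_perp_iff[OF assms] by simp
    then show ?thesis using left_perp_iff[OF assms] ob by blast
  qed
  show "A \<in> left_perp K \<D>" if BC: "B \<in> left_perp K \<D>" "C \<in> left_perp K \<D>"
  proof -
    have "ext_orthogonal K A Y" if Y: "Y \<in> \<D>" for Y
    proof -
      have "Y \<in> Ob (opposite K)" using Y assms by auto
      then show ?thesis
        using ks_extriangulated.ext_orthogonal_cone[OF ks_opposite _ t', of Y] iff Y BC left_perp_iff[OF assms] by simp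
    qed
    then show ?thesis using left_perp_iff[OF assms] ob by blast
  qed
qed

lemma subcategory_left_perp:
  assumes "\<D> \<subseteq> Ob K" shows "subcategory K (left_perp K \<D> \<inter> \<X>)"
proof -
  obtain Z where Z: "zero_object K Z" using ex_zero_object by blast
  then have "ext_orthogonal K Z Y" if "Y \<in> \<D>" for Y
    using ks_extriangulated.ext_orthogonal_zero_object[OF ks_opposite, of Z Y] that assms
      ext_orthogonal_opposite by (auto simp: zero_object_def)
  then have Z': "Z \<in> left_perp K \<D> \<inter> \<X>"
    using left_perp_iff[OF assms] subcategory_zero[OF subcategory_class Z] Z by (auto simp: zero_object_def)
  show ?thesis
  proof (rule subcategoryI[OF _ Z' Z])
    show "left_perp K \<D> \<inter> \<X> \<subseteq> Ob K" using class_ob by blast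
  next
    fix A B S i j p q
    assume b: "biproduct K A B S i j p q" and AB: "A \<in> left_perp K \<D> \<inter> \<X>" "B \<in> left_perp K \<D> \<inter> \<X>"
    have "e_triangle_objs K A S B" using real_zero[OF b] by (auto simp: e_triangle_objs_def)
    then show "S \<in> left_perp K \<D> \<inter> \<X>"
      using left_perp_closed(1)[OF assms] AB subcategory_biproduct[OF subcategory_class b] by blast
  next
    fix A S s r
    assume S: "S \<in> left_perp K \<D> \<inter> \<X>" and r: "mor K s A S" "mor K r S A" "r \<cdot> s = Id K A"
    have A: "A \<in> \<X>" using S r subcategory_retract[OF subcategory_class] by blast
    have "ext_orthogonal K A Y" if Y: "Y \<in> \<D>" for Y
    proof -
      have "ext_orthogonal (opposite K) Y S"
        using S Y left_perp_iff[OF assms] ext_orthogonal_opposite assms by blast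
      then have "ext_orthogonal (opposite K) Y A"
        using ks_extriangulated.ext_orthogonal_retract[OF ks_opposite, of Y S r A s] r by simp
      then show ?thesis using ext_orthogonal_opposite class_ob[OF A] Y assms by blast
    qed
    then show "A \<in> left_perp K \<D> \<inter> \<X>" using A class_ob[OF A] left_perp_iff[OF assms] by blast
  qed
qed

lemma resolving_left_perp:
  assumes D: "relative_coresolving K \<D> \<X>" "strongly_covariantly_finite K \<D> \<X>"
  shows "relative_resolving K (left_perp K \<D> \<inter> \<X>) \<X>"
proof -
  have sub: "subcategory K \<D>" "\<D> \<subseteq> \<X>" "\<D> \<subseteq> Ob K"
    using relative_coresolvingD(1,2)[OF D(1)] subcategory_ob[of \<D>] by auto
  \<comment> \<open>The generator is orthogonal to all of \<X>, so the relative projectives, which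
    lie in \<P>, belong to the new class.\<close>
  have "Q \<in> left_perp K \<D>" if "Q \<in> \<P>" for Q
    using that generator(2,3) class_ob left_perp_iff[OF sub(3)] sub(2) by blast
  then show ?thesis
    unfolding relative_resolving_def
    using subcategory_left_perp[OF sub(3)] left_perp_closed[OF sub(3)] projective_in_generator generator(2)
    by blast
qed

text \<open>Salce's trick: push out \<open>Y' \<rightarrow> Q \<rightarrow> Y\<close> along a left approximation of \<open>Y'\<close>.\<close>

lemma contravariantly_finite_left_perp:
  assumes D: "relative_coresolving K \<D> \<X>" "strongly_covariantly_finite K \<D> \<X>"
  shows "strongly_contravariantly_finite K (left_perp K \<D> \<inter> \<X>) \<X>"
proof -
  let ?B = "left_perp K \<D> \<inter> \<X>"
  have sub: "subcategory K \<D>" "\<D> \<subseteq> \<X>" "\<D> \<subseteq> Ob K"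
    using relative_coresolvingD(1,2)[OF D(1)] subcategory_ob[of \<D>] by auto
  have "\<exists>A D x g \<delta>. e_triangle K A D Y x g \<delta> \<and> right_approximation K ?B g D Y" if Y: "Y \<in> \<X>" for Y
  proof -
    obtain Q Y' where Q: "Q \<in> \<P>" "Y' \<in> \<X>" "e_triangle_objs K Y' Q Y" using generator(4)[OF Y] by blast
    obtain D V where D: "D \<in> \<D>" "V \<in> ?B" "e_triangle_objs K Y' D V"
      using special_left_approximation[OF D Q(2)] by blast
    obtain M where "e_triangle_objs K D M Y" and QM: "e_triangle_objs K Q M V"
      using triangle_objs_pushout[OF Q(3) D(3)] by blast
    then obtain x g \<delta> where M: "e_triangle K D M Y x g \<delta>" by (auto simp: e_triangle_objs_def)
    have "Q \<in> ?B" using Q(1) generator(2,3) class_ob left_perp_iff[OF sub(3)] sub(2) by blast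
    then have MB: "M \<in> ?B"
      using left_perp_closed(1)[OF sub(3) QM] extension_closed[OF QM] D(2) by blast
    note m = e_triangleD[OF M]
    have "\<exists>h. mor K h D' M \<and> g \<cdot> h = f" if "D' \<in> ?B" "mor K f D' Y" for D' f
    proof -
      have "ext_orthogonal K D' D" using that D(1) left_perp_iff[OF sub(3)] by blast
      then have "ext_trivial K D' D" by (rule ext_orthogonal_trivial)
      then show ?thesis
        using triangle_lift[OF M that(2)] extension_pull[OF m(3) that(2)] by (simp add: ext_trivial_def)
    qed
    then have "right_approximation K ?B g M Y" using MB m by (simp add: right_approximation_def)
    then show ?thesis using M by blast
  qed
  then show ?thesis
    unfolding strongly_contravariantly_finite_def using subcategory_left_perp[OF sub(3)] by blast
qed

end

section \<open>The class of resolved objects\<close>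

text \<open>Iterating a chosen step inside \<S> yields the whole resolution, so membership proofs
  need exhibit only one step that stays in \<S>.\<close>

lemma resolved_class_coinduct:
  assumes "A \<in> \<S>" "\<S> \<subseteq> right_perp K \<omega>" "\<And>A. A \<in> \<S> \<Longrightarrow> \<exists>W\<in>\<omega>. \<exists>A'\<in>\<S>. e_triangle_objs K A' W A"
  shows "A \<in> resolved_class K \<omega>"
proof -
  obtain w l where wl: "\<And>A. A \<in> \<S> \<Longrightarrow> w A \<in> \<omega> \<and> l A \<in> \<S> \<and> e_triangle_objs K (l A) (w A) A"
    using assms(3) by metis
  have S: "(l ^^ n) A \<in> \<S>" for n by (induction n) (use assms(1) wl in auto)
  show ?thesis
    unfolding resolved_class_def
    by (rule CollectI, rule exI[of _ "\<lambda>n. (l ^^ n) A"], rule exI[of _ "\<lambda>n. w ((l ^^ n) A)"])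
      (use S wl assms(2) in auto)
qed

lemma resolved_classD:
  assumes "A \<in> resolved_class K \<omega>"
  shows "A \<in> right_perp K \<omega>" "\<exists>W\<in>\<omega>. \<exists>A'\<in>resolved_class K \<omega>. e_triangle_objs K A' W A"
proof -
  obtain L W :: "nat \<Rightarrow> 'a" where LW: "L 0 = A"
    "\<And>i. W i \<in> \<omega> \<and> L i \<in> right_perp K \<omega> \<and> e_triangle_objs K (L (Suc i)) (W i) (L i)"
    using assms unfolding resolved_class_def by blast
  have "L (Suc 0) \<in> resolved_class K \<omega>"
    unfolding resolved_class_def
    by (rule CollectI, rule exI[of _ "\<lambda>n. L (Suc n)"], rule exI[of _ "\<lambda>n. W (Suc n)"]) (use LW in auto)
  then show "A \<in> right_perp K \<omega>" "\<exists>W\<in>\<omega>. \<exists>A'\<in>resolved_class K \<omega>. e_triangle_objs K A' W A"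
    using LW(2)[of 0] LW(1) by auto
qed

locale self_orthogonal_subcategory = ks_extriangulated K
  for K :: "('o, 'm, 'e, 'z) ext_category_scheme" (structure) +
  fixes \<omega> :: "'o set"
  assumes subcategory: "subcategory K \<omega>" and self_orthogonal: "self_orthogonal K \<omega>"
begin

lemma resolved_ob: "A \<in> resolved_class K \<omega> \<Longrightarrow> A \<in> Ob K"
  by (drule resolved_classD(1)) (simp add: right_perp_def)

lemma resolved_orthogonal: "A \<in> resolved_class K \<omega> \<Longrightarrow> W \<in> \<omega> \<Longrightarrow> ext_orthogonal K W A"
  by (drule resolved_classD(1)) (simp add: right_perp_iff[OF subcategory_ob[OF subcategory]])

lemma subset_resolved: "\<omega> \<subseteq> resolved_class K \<omega>"
proof
  fix A assume "A \<in> \<omega>"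
  then show "A \<in> resolved_class K \<omega>"
  proof (rule resolved_class_coinduct)
    show "\<omega> \<subseteq> right_perp K \<omega>" using self_orthogonal by (simp add: self_orthogonal_def)
    fix A assume A: "A \<in> \<omega>"
    obtain Z where Z: "zero_object K Z" using ex_zero_object by blast
    have "A \<in> Ob K" using A subcategory subcategory_ob by blast
    \<comment> \<open>A resolves itself in one step, with zero as the next term.\<close>
    then have "e_triangle_objs K Z A A" using triangle_zero_left[OF Z] by (auto simp: e_triangle_objs_def)
    then show "\<exists>W\<in>\<omega>. \<exists>A'\<in>\<omega>. e_triangle_objs K A' W A" using A subcategory_zero[OF subcategory Z] by blast
  qed
qed

text \<open>A horseshoe argument. The pullback M of B -> C and C0 -> C splits as A plus C0, since
  \<open>C0\<close> is orthogonal to A. Then A0 plus C0 covers M and, through it, B; by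
  \<open>ET4_op\<close> the cocone of this cover is an extension of \<open>C1\<close> by
  \<open>A1\<close>, so the step can be repeated.\<close>

lemma resolved_extension_closed:
  assumes "e_triangle_objs K A B C" "A \<in> resolved_class K \<omega>" "C \<in> resolved_class K \<omega>"
  shows "B \<in> resolved_class K \<omega>"
proof (rule resolved_class_coinduct)
  let ?S = "{B. \<exists>A \<in> resolved_class K \<omega>. \<exists>C \<in> resolved_class K \<omega>. e_triangle_objs K A B C}"
  show "B \<in> ?S" using assms by blast
  show "?S \<subseteq> right_perp K \<omega>"
    using resolved_orthogonal ext_orthogonal_middle right_perp_iff[OF subcategory_ob[OF subcategory]] e_triangleD(5)
    by (auto simp: e_triangle_objs_def) (metis e_triangle_objs_def)
  fix B assume "B \<in> ?S"
  then obtain A C x y \<delta> where A: "A \<in> resolved_class K \<omega>" and C: "C \<in> resolved_class K \<omega>"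
    and t: "e_triangle K A B C x y \<delta>" by (auto simp: e_triangle_objs_def)
  obtain A0 A1 xa ya \<alpha> where A0: "A0 \<in> \<omega>" and A1: "A1 \<in> resolved_class K \<omega>" and ta: "e_triangle K A1 A0 A xa ya \<alpha>"
    using resolved_classD(2)[OF A] unfolding e_triangle_objs_def by blast
  obtain C0 C1 xc yc \<gamma> where C0: "C0 \<in> \<omega>" and C1: "C1 \<in> resolved_class K \<omega>" and tc: "e_triangle K C1 C0 C xc yc \<gamma>"
    using resolved_classD(2)[OF C] unfolding e_triangle_objs_def by blast
  obtain M m1 n1 m2 n2 where M: "e_triangle K A M C0 m1 n1 (Pull K yc \<delta>)" "e_triangle K C1 M B m2 n2 (Pull K y \<gamma>)"
    using triangle_pullback[OF t tc] by blast
  obtain j p where bM: "biproduct K A C0 M m1 j p n1"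
    using ext_trivial_split[OF M(1) ext_orthogonal_trivial[OF resolved_orthogonal[OF A C0]]] by blast
  have ob: "A0 \<in> Ob K" "C0 \<in> Ob K" "A1 \<in> Ob K" using e_triangleD(4,5)[OF ta] e_triangleD(5)[OF tc] by auto
  obtain W iW jW pW qW where bW: "biproduct K A0 C0 W iW jW pW qW" using ex_biproduct ob by meson
  have W: "W \<in> \<omega>" using subcategory_biproduct[OF subcategory bW A0 C0] .
  obtain Z where Z: "zero_object K Z" using ex_zero_object by blast
  \<comment> \<open>The sum of A1 -> A0 -> A and Z -> C0 -> C0 with Z zero; adding Z leaves
    \<open>A1\<close> unchanged.\<close>
  obtain x' y' \<epsilon> where s: "e_triangle K A1 W M x' y' \<epsilon>"
    using real_sum[OF ta triangle_zero_left[OF Z ob(2)] biproduct_zero[OF Z ob(3)] bW bM] by blast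
  obtain E where "e_triangle_objs K E W B" "e_triangle_objs K A1 E C1"
    using ET4_op[OF s M(2)] unfolding e_triangle_objs_def by blast
  then show "\<exists>W\<in>\<omega>. \<exists>A'\<in>?S. e_triangle_objs K A' W B" using W A1 C1 by blast
qed

text \<open>Every map h from X to A lifts to W: s h lifts along n, because Ext(X, S') vanishes, and
  composing with r recovers h. So a class in Ext(X, A'), being pulled back along such an h, is zero.
  This vanishing splits the extriangle in the Schanuel argument that follows.\<close>

lemma cocone_of_summand:
  assumes t: "e_triangle K S' W S k n \<kappa>" and b: "biproduct K A B S s j r q"
    and v: "\<And>X. X \<in> \<omega> \<Longrightarrow> ext_trivial K X S'" "\<And>X. X \<in> \<omega> \<Longrightarrow> ext_trivial K X W"
  shows "\<exists>A'. e_triangle_objs K A' W A \<and> (\<forall>X\<in>\<omega>. ext_trivial K X A')"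
proof -
  note bm = biproductD[OF b] and m = e_triangleD[OF t]
  obtain A' x \<delta> where A': "e_triangle K A' W A x (r \<cdot> n) \<delta>"
    using ET4_op[OF t real_zero[OF biproduct_swap[OF b]]] by blast
  note m' = e_triangleD[OF A']
  have "ext_trivial K X A'" if X: "X \<in> \<omega>" for X
    unfolding ext_trivial_def
  proof (intro allI impI)
    fix \<alpha> assume \<alpha>: "extension K \<alpha> X A'"
    obtain h where h: "mor K h X A" "\<alpha> = Pull K h \<delta>"
      using triangle_push_kernel[OF A' \<alpha>] extension_push[OF \<alpha> m'(1)] v(2)[OF X] by (auto simp: ext_trivial_def)
    have sh: "mor K (s \<cdot> h) X S" using comp_mor[OF h(1) bm(1)] .
    obtain g where g: "mor K g X W" "n \<cdot> g = s \<cdot> h"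
      using triangle_lift[OF t sh] extension_pull[OF m(3) sh] v(1)[OF X] by (auto simp: ext_trivial_def)
    have "(r \<cdot> n) \<cdot> g = (r \<cdot> s) \<cdot> h"
      using comp_assoc[OF g(1) m(2) bm(3)] comp_assoc[OF h(1) bm(1,3)] g(2) by simp
    then have "h = (r \<cdot> n) \<cdot> g" using bm(5) comp_id_left[OF h(1)] by simp
    then have "\<alpha> = Pull K g (Pull K (r \<cdot> n) \<delta>)" using pull_comp[OF m'(3,2) g(1)] h(2) by simp
    then show "\<alpha> = \<one>\<^bsub>Ext K X A'\<^esub>" using triangle_pull_zero[OF A'] pull_zero[OF m'(4) g(1)] by simp
  qed
  then show ?thesis using A' by (auto simp: e_triangle_objs_def)
qed

text \<open>If \<open>S = A \<oplus> B\<close> with resolution step \<open>S' \<rightarrow> W \<rightarrow> S\<close>, and \<open>A'\<close>, \<open>B'\<close> are the cocones of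
  \<open>W \<rightarrow> A\<close> and \<open>W \<rightarrow> B\<close>, then Schanuel's lemma gives \<open>A' \<oplus> B' \<oplus> W \<cong> M\<close> with \<open>M\<close> an extension of
  \<open>W \<oplus> W\<close> by \<open>S'\<close>; so \<open>A'\<close> is again a retract of a resolved object.\<close>

lemma resolved_retract_closed:
  assumes "S \<in> resolved_class K \<omega>" "mor K s A S" "mor K r S A" "r \<cdot> s = Id K A"
  shows "A \<in> resolved_class K \<omega>"
proof (rule resolved_class_coinduct)
  let ?S = "{A. \<exists>S s r. S \<in> resolved_class K \<omega> \<and> mor K s A S \<and> mor K r S A \<and> r \<cdot> s = Id K A}"
  show "A \<in> ?S" using assms by blast
  show "?S \<subseteq> right_perp K \<omega>"
    using resolved_orthogonal ext_orthogonal_retract right_perp_iff[OF subcategory_ob[OF subcategory]] mor_obD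
    by blast
  fix A assume "A \<in> ?S"
  then obtain S s r where S: "S \<in> resolved_class K \<omega>" and r: "mor K s A S" "mor K r S A" "r \<cdot> s = Id K A"
    by blast
  obtain B j q where b: "biproduct K A B S s j r q" using retract_biproduct[OF r] by blast
  obtain W S' k n \<kappa> where W: "W \<in> \<omega>" and S': "S' \<in> resolved_class K \<omega>" and t: "e_triangle K S' W S k n \<kappa>"
    using resolved_classD(2)[OF S] unfolding e_triangle_objs_def by blast
  have v: "ext_trivial K X S'" "ext_trivial K X W" if "X \<in> \<omega>" for X
    using ext_orthogonal_trivial[OF resolved_orthogonal[OF _ that]] S' W subset_resolved by auto
  obtain A' xa ya \<alpha> where A': "e_triangle K A' W A xa ya \<alpha>" "\<And>X. X \<in> \<omega> \<Longrightarrow> ext_trivial K X A'"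
    using cocone_of_summand[OF t b v] by (auto simp: e_triangle_objs_def)
  obtain B' xb yb \<beta> where B': "e_triangle K B' W B xb yb \<beta>" "\<And>X. X \<in> \<omega> \<Longrightarrow> ext_trivial K X B'"
    using cocone_of_summand[OF t biproduct_swap[OF b] v] by (auto simp: e_triangle_objs_def)
  have ob: "A' \<in> Ob K" "B' \<in> Ob K" "W \<in> Ob K" using e_triangleD(4,5)[OF A'(1)] e_triangleD(4)[OF B'(1)] by auto
  obtain T iT jT pT qT where bT: "biproduct K A' B' T iT jT pT qT" using ex_biproduct ob by meson
  obtain W2 iW jW pW qW where bW: "biproduct K W W W2 iW jW pW qW" using ex_biproduct ob by meson
  obtain x' y' \<epsilon> where tT: "e_triangle K T W2 S x' y' \<epsilon>" using real_sum[OF A'(1) B'(1) bT bW b] by blast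
  \<comment> \<open>Schanuel's comparison of the two covers \<open>W2\<close> and \<open>W\<close>
    of S: M is at once an extension of W by T and of \<open>W2\<close> by S'.\<close>
  obtain M m1 n1 m2 n2 where M: "e_triangle K T M W m1 n1 (Pull K n \<epsilon>)" "e_triangle K S' M W2 m2 n2 (Pull K y' \<kappa>)"
    using triangle_pullback[OF tT t] by blast
  have "W2 \<in> resolved_class K \<omega>"
    using subset_resolved subcategory_biproduct[OF subcategory bW W W] by blast
  then have MX: "M \<in> resolved_class K \<omega>"
    using resolved_extension_closed[OF _ S', of M W2] M(2) by (auto simp: e_triangle_objs_def)
  have "ext_trivial K W T"
    using ext_trivial_middle[of A' T B' W] real_zero[OF bT] A'(2)[OF W] B'(2)[OF W]
    by (auto simp: e_triangle_objs_def)
  then obtain jM pM where bM: "biproduct K T W M m1 jM pM n1" using ext_trivial_split[OF M(1)] by blast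
  note mT = biproductD[OF bT] and mM = biproductD[OF bM]
  have "(pT \<cdot> pM) \<cdot> (m1 \<cdot> iT) = pT \<cdot> ((pM \<cdot> m1) \<cdot> iT)"
    using mT(1,3) mM(1,3) by (simp add: cat_simps)
  also have "\<dots> = Id K A'" using mM(5) mT(5) comp_id_left[OF mT(1)] by simp
  finally have "A' \<in> ?S" using MX comp_mor[OF mT(1) mM(1)] comp_mor[OF mM(3) mT(3)] by blast
  then show "\<exists>W\<in>\<omega>. \<exists>A'\<in>?S. e_triangle_objs K A' W A"
    using W A'(1) unfolding e_triangle_objs_def by blast
qed

lemma subcategory_resolved: "subcategory K (resolved_class K \<omega>)"
proof -
  obtain Z where Z: "zero_object K Z" using ex_zero_object by blast
  have "Z \<in> resolved_class K \<omega>" using subcategory_zero[OF subcategory Z] subset_resolved by blast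
  show ?thesis
  proof (rule subcategoryI[OF _ \<open>Z \<in> _\<close> Z])
    show "resolved_class K \<omega> \<subseteq> Ob K" using resolved_ob by blast
    show "S \<in> resolved_class K \<omega>"
      if "biproduct K A B S i j p q" "A \<in> resolved_class K \<omega>" "B \<in> resolved_class K \<omega>" for A B S i j p q
      using resolved_extension_closed[OF _ that(2,3)] real_zero[OF that(1)] by (auto simp: e_triangle_objs_def)
  qed (rule resolved_retract_closed)
qed

lemma generated_resolved_class:
  assumes "relative_injective_cogenerator K \<I> (resolved_class K \<omega>)"
  shows "generated_class K (resolved_class K \<omega>) \<omega> \<I>"
proof
  show "subcategory K (resolved_class K \<omega>)" by (rule subcategory_resolved)
  show "B \<in> resolved_class K \<omega>"
    if "e_triangle_objs K A B C" "A \<in> resolved_class K \<omega>" "C \<in> resolved_class K \<omega>" for A B C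
    using resolved_extension_closed that .
  show "subcategory K \<omega>" "\<omega> \<subseteq> resolved_class K \<omega>" by (rule subcategory, rule subset_resolved)
  show "ext_orthogonal K Q Y" if "Q \<in> \<omega>" "Y \<in> resolved_class K \<omega>" for Q Y
    using resolved_orthogonal that by blast
  show "\<exists>Q\<in>\<omega>. \<exists>Y'\<in>resolved_class K \<omega>. e_triangle_objs K Y' Q Y" if "Y \<in> resolved_class K \<omega>" for Y
    using resolved_classD(2)[OF that] .
  show "subcategory K \<I>" "\<I> \<subseteq> resolved_class K \<omega>"
    using assms by (auto simp: relative_injective_cogenerator_def)
  show "ext_orthogonal K Y J" if "J \<in> \<I>" "Y \<in> resolved_class K \<omega>" for J Y
    using assms that right_perp_iff[OF subcategory_ob[OF subcategory_resolved]]
    by (auto simp: relative_injective_cogenerator_def)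
  show "\<exists>J\<in>\<I>. \<exists>Y'\<in>resolved_class K \<omega>. e_triangle_objs K Y J Y'" if "Y \<in> resolved_class K \<omega>" for Y
    using assms that by (auto simp: relative_injective_cogenerator_def)
qed

end

theorem proposition5p13:
  fixes K :: "('o, 'm, 'e) ext_category"
    and \<C> :: "'o set"
  defines "\<X> \<equiv> resolved_class K \<C>"
  defines "coresolving_classes \<equiv>
      {\<D>. relative_coresolving K \<D> \<X> \<and> strongly_covariantly_finite K \<D> \<X>}"
    and "resolving_classes \<equiv>
      {\<B>. relative_resolving K \<B> \<X> \<and> strongly_contravariantly_finite K \<B> \<X>}"
  assumes "extriangulated_category K"
    and "krull_schmidt K"
    and "enough_projectives K"
    and "enough_injectives K"
    and "WIC K"
    and "subcategory K \<C>"
    and "self_orthogonal K \<C>"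
    and "\<exists>\<I>. relative_injective_cogenerator K \<I> \<X>"
  shows "bij_betw (\<lambda>\<D>. left_perp K \<D> \<inter> \<X>) coresolving_classes resolving_classes \<and>
    (\<forall>\<B> \<in> resolving_classes. right_perp K \<B> \<inter> \<X> \<in> coresolving_classes \<and>
       left_perp K (right_perp K \<B> \<inter> \<X>) \<inter> \<X> = \<B>) \<and>
    (\<forall>\<D> \<in> coresolving_classes. right_perp K (left_perp K \<D> \<inter> \<X>) \<inter> \<X> = \<D>)"
proof -
  interpret extriangulated_category K by fact
  interpret self_orthogonal_subcategory K \<C>
    by unfold_locales (use assms krull_schmidt_decomposition in auto)
  obtain \<I> where "relative_injective_cogenerator K \<I> \<X>" using assms by blast
  then interpret generated_class K \<X> \<C> \<I>
    unfolding \<X>_def by (rule generated_resolved_class)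
  interpret op: generated_class "opposite K" \<X> \<I> \<C> by (rule generated_opposite)
  have left: "left_perp K \<D> \<inter> \<X> \<in> resolving_classes" "right_perp K (left_perp K \<D> \<inter> \<X>) \<inter> \<X> = \<D>"
    if "\<D> \<in> coresolving_classes" for \<D>
    using that resolving_left_perp contravariantly_finite_left_perp right_perp_left_perp
    unfolding coresolving_classes_def resolving_classes_def by auto
  have right: "right_perp K \<B> \<inter> \<X> \<in> coresolving_classes" "left_perp K (right_perp K \<B> \<inter> \<X>) \<inter> \<X> = \<B>"
    if "\<B> \<in> resolving_classes" for \<B>
  proof -
    \<comment> \<open>In the opposite category \<B> is coresolving and strongly covariantly finite,
      and its left orthogonal class is \<open>right_perp K \<B>\<close>, so the results for
      coresolving classes apply to it.\<close>
    have B: "relative_coresolving (opposite K) \<B> \<X>" "strongly_covariantly_finite (opposite K) \<B> \<X>"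
      using that by (auto simp: resolving_classes_def)
    have "\<B> \<subseteq> Ob K" using B(1) class_ob by (auto simp: relative_resolving_def)
    then have p: "left_perp (opposite K) \<B> = right_perp K \<B>" by (rule left_perp_opposite)
    have "right_perp K \<B> \<inter> \<X> \<subseteq> Ob K" using class_ob by blast
    then have q: "right_perp (opposite K) (right_perp K \<B> \<inter> \<X>) = left_perp K (right_perp K \<B> \<inter> \<X>)"
      by (rule right_perp_opposite)
    show "right_perp K \<B> \<inter> \<X> \<in> coresolving_classes"
      using op.resolving_left_perp[OF B] op.contravariantly_finite_left_perp[OF B] p
      by (simp add: coresolving_classes_def)
    show "left_perp K (right_perp K \<B> \<inter> \<X>) \<inter> \<X> = \<B>"
      using op.right_perp_left_perp[OF B] p q by simp
  qed
  have "bij_betw (\<lambda>\<D>. left_perp K \<D> \<inter> \<X>) coresolving_classes resolving_classes"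
    by (rule bij_betw_byWitness[where f'="\<lambda>\<B>. right_perp K \<B> \<inter> \<X>"]) (use left right in auto)
  then show ?thesis using left right by blast
qed

end
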